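(* Let $F$ be an analytic function. The equation $$\ddot u\,u+\tfrac12\dot u^2+F'(u)=0$$ has peaked TWS if and only if - $F'(0)<0$, and - there exists $m>0$ such that $F(m)=F(0)$ and $F(u)<F(0)$ for $u\in(0,m)$. These solutions are either (i) peaked periodic, with period $T=\dfrac{2}{\sqrt2}\displaystyle\int_0^m\sqrt{\frac{u}{F(0)-F(u)}}\,du$, if and only if in addition $F'(m)\neq 0$, or (ii) peaked solitary, if and only if in addition $F'(m)=0$. These solutions are weak singular TWS and they are analytic except for a discontinuity in the first derivative at the peaks. Furthermore, the peaked solitary waves are symmetric with respect to their unique maximum and decay exponentially to zero at infinity. Peaked periodic solutions have a unique maximum and minimum per period and are symmetric with respect to these local extrema.
   Context: $F$ is a real-valued function of a real variable. Only solutions with values in $\{u\ge 0\}$ are considered, and the TWS considered are singular TWS in the sense below. Traveling wave solution (TWS): a bounded function $u\in H^1_{loc}(\mathbb{R})$ satisfying the equation $\ddot u\,u+\frac12\dot u^2+F'(u)=0$ in the sense of distributions, i.e. $$\int_{\mathbb{R}}(u^2)_t\phi_t+(u_t)^2\phi-2F'(u)\phi\,dt=0\quad\text{for all }\phi\in C_c^\infty(\mathbb{R}).$$ A non-constant TWS $u$ is a strong singular TWS if, for some constant $h\in\mathbb{R}$, it is a classical solution on $\mathbb{R}$ of $$\frac{u\dot u^2}{2}+F(u)=h;\qquad(\ast)$$ it is a weak singular TWS if it is a classical solution of $(\ast)$ on $\mathbb{R}\setminus\mathcal{S}$, where $\mathcal{S}$ is a set of countably many points $t_k$ such that $\lim_{t\to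 t_k}\big(\frac{u(t)\dot u(t)^2}{2}+F(u(t))\big)=h$. A singular TWS is one that is strong singular or weak singular. A TWS $u:\mathbb{R}\to\mathbb{R}$ is called peaked if it is smooth except at a finite or countable number of points (peaks) $\mathcal{S}=\{t_k\}$, where $$0\neq\lim_{t\to t_k^+}u'(t)=-\lim_{t\to t_k^-}u'(t)\neq\pm\infty.$$ It is peaked periodic if it is moreover periodic in $t$, and peaked solitary if it is a peaked solitary wave, i.e. it has a single peak and tends to the same limit as $t\to+\infty$ and as $t\to-\infty$.
   Formalization: For peaked solitary waves, the unique maximum, symmetry and decay to zero are stated for m-u, since u itself has its minimum 0 at the peak and tends to m; exponential decay is claimed only if F''(m)≠0, since it fails when F''(m)=0. *)

theory Defs
  imports "HOL-Analysis.Analysis"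
begin

text \<open>The library's \<open>analytic_on\<close> concerns complex
  functions only; here analyticity means being locally the sum of a convergent power series.\<close>

definition real_analytic_on :: "(real \<Rightarrow> real) \<Rightarrow> real set \<Rightarrow> bool" where
  "real_analytic_on f A \<longleftrightarrow> (\<forall>x\<in>A. \<exists>P. (\<lambda>y. f (x + y)) has_fps_expansion P)"

text \<open>The neighbourhood \<open>U\<close> makes the condition independent of the unspecified values that
  \<^const>\<open>deriv\<close> takes at points where the function is not differentiable.\<close>

definition smooth_on :: "(real \<Rightarrow> real) \<Rightarrow> real set \<Rightarrow> bool" where
  "smooth_on f A \<longleftrightarrow>
     (\<forall>x\<in>A. \<exists>U. open U \<and> x \<in> U \<and> (\<forall>k. \<forall>y\<in>U. (deriv ^^ k) f differentiable (at y)))"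

definition test_function :: "(real \<Rightarrow> real) \<Rightarrow> bool" where
  "test_function \<phi> \<longleftrightarrow> smooth_on \<phi> UNIV \<and> compact (closure {t. \<phi> t \<noteq> 0})"

definition loc_integrable :: "(real \<Rightarrow> real) \<Rightarrow> bool" where
  "loc_integrable f \<longleftrightarrow> (\<forall>a b. set_integrable lborel {a..b} f)"

definition loc_L2 :: "(real \<Rightarrow> real) \<Rightarrow> bool" where
  "loc_L2 f \<longleftrightarrow>
     f \<in> borel_measurable borel \<and> (\<forall>a b. set_integrable lborel {a..b} (\<lambda>t. (f t)\<^sup>2))"

definition weak_deriv :: "(real \<Rightarrow> real) \<Rightarrow> (real \<Rightarrow> real) \<Rightarrow> bool" where
  "weak_deriv f g \<longleftrightarrow> loc_integrable f \<and> loc_integrable g \<and>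
     (\<forall>\<phi>. test_function \<phi> \<longrightarrow>
        (LINT t|lborel. f t * deriv \<phi> t) = - (LINT t|lborel. g t * \<phi> t))"

text \<open>An element of \<open>H\<^sup>1\<^sub>l\<^sub>o\<^sub>c\<close> of the line is a class of functions that agree almost everywhere;
  it is represented by its unique continuous member.\<close>

definition H1_loc :: "(real \<Rightarrow> real) \<Rightarrow> bool" where
  "H1_loc u \<longleftrightarrow> continuous_on UNIV u \<and> loc_L2 u \<and> (\<exists>v. weak_deriv u v \<and> loc_L2 v)"

text \<open>In \<open>tws\<close>, \<open>v\<close> and \<open>w\<close> stand for the weak derivatives of \<open>u\<close> and \<open>u\<^sup>2\<close>, which are
  unique up to null sets.\<close>

definition tws :: "(real \<Rightarrow> real) \<Rightarrow> (real \<Rightarrow> real) \<Rightarrow> bool" where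
  "tws F u \<longleftrightarrow> bounded (range u) \<and> H1_loc u \<and>
     (\<exists>v w. weak_deriv u v \<and> weak_deriv (\<lambda>t. (u t)\<^sup>2) w \<and>
        (\<forall>\<phi>. test_function \<phi> \<longrightarrow>
           (LINT t|lborel. w t * deriv \<phi> t + (v t)\<^sup>2 * \<phi> t - 2 * deriv F (u t) * \<phi> t) = 0))"

definition energy :: "(real \<Rightarrow> real) \<Rightarrow> (real \<Rightarrow> real) \<Rightarrow> real \<Rightarrow> real" where
  "energy F u t = u t * (deriv u t)\<^sup>2 / 2 + F (u t)"

definition classical_energy_solution ::
    "(real \<Rightarrow> real) \<Rightarrow> real \<Rightarrow> (real \<Rightarrow> real) \<Rightarrow> real set \<Rightarrow> bool" where
  "classical_energy_solution F h u A \<longleftrightarrow> u C1_differentiable_on A \<and> (\<forall>t\<in>A. energy F u t = h)"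

definition strong_singular_tws :: "(real \<Rightarrow> real) \<Rightarrow> (real \<Rightarrow> real) \<Rightarrow> bool" where
  "strong_singular_tws F u \<longleftrightarrow>
     tws F u \<and> \<not> u constant_on UNIV \<and> (\<exists>h. classical_energy_solution F h u UNIV)"

definition weak_singular_tws_off ::
    "(real \<Rightarrow> real) \<Rightarrow> (real \<Rightarrow> real) \<Rightarrow> real set \<Rightarrow> bool" where
  "weak_singular_tws_off F u S \<longleftrightarrow>
     tws F u \<and> \<not> u constant_on UNIV \<and> countable S \<and>
     (\<exists>h. classical_energy_solution F h u (- S) \<and>
          (\<forall>s\<in>S. (energy F u \<longlongrightarrow> h) (at s within - S)))"

definition weak_singular_tws :: "(real \<Rightarrow> real) \<Rightarrow> (real \<Rightarrow> real) \<Rightarrow> bool" where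
  "weak_singular_tws F u \<longleftrightarrow> (\<exists>S. weak_singular_tws_off F u S)"

definition singular_tws :: "(real \<Rightarrow> real) \<Rightarrow> (real \<Rightarrow> real) \<Rightarrow> bool" where
  "singular_tws F u \<longleftrightarrow> strong_singular_tws F u \<or> weak_singular_tws F u"

text \<open>There is at least one peak: otherwise smooth waves would count as peaked.\<close>

definition peak_set :: "(real \<Rightarrow> real) \<Rightarrow> real set \<Rightarrow> bool" where
  "peak_set u S \<longleftrightarrow> countable S \<and> S \<noteq> {} \<and> smooth_on u (- S) \<and>
     (\<forall>s\<in>S. \<exists>l. l \<noteq> 0 \<and> (deriv u \<longlongrightarrow> l) (at_right s) \<and> (deriv u \<longlongrightarrow> - l) (at_left s))"

definition peaked_tws :: "(real \<Rightarrow> real) \<Rightarrow> (real \<Rightarrow> real) \<Rightarrow> bool" where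
  "peaked_tws F u \<longleftrightarrow> singular_tws F u \<and> (\<forall>t. 0 \<le> u t) \<and> (\<exists>S. peak_set u S)"

definition has_period :: "(real \<Rightarrow> real) \<Rightarrow> real \<Rightarrow> bool" where
  "has_period u T \<longleftrightarrow> 0 < T \<and> (\<forall>t. u (t + T) = u t)"

definition minimal_period :: "(real \<Rightarrow> real) \<Rightarrow> real \<Rightarrow> bool" where
  "minimal_period u T \<longleftrightarrow> has_period u T \<and> (\<forall>T'. has_period u T' \<longrightarrow> T \<le> T')"

definition peaked_periodic :: "(real \<Rightarrow> real) \<Rightarrow> (real \<Rightarrow> real) \<Rightarrow> bool" where
  "peaked_periodic F u \<longleftrightarrow> peaked_tws F u \<and> (\<exists>T. has_period u T)"

definition peaked_solitary :: "(real \<Rightarrow> real) \<Rightarrow> (real \<Rightarrow> real) \<Rightarrow> bool" where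
  "peaked_solitary F u \<longleftrightarrow> peaked_tws F u \<and> (\<exists>p. peak_set u {p}) \<and>
     (\<exists>L. (u \<longlongrightarrow> L) at_top \<and> (u \<longlongrightarrow> L) at_bot)"

definition is_local_max :: "(real \<Rightarrow> real) \<Rightarrow> real \<Rightarrow> bool" where
  "is_local_max f t \<longleftrightarrow> (\<forall>\<^sub>F s in nhds t. f s \<le> f t)"

definition is_local_min :: "(real \<Rightarrow> real) \<Rightarrow> real \<Rightarrow> bool" where
  "is_local_min f t \<longleftrightarrow> (\<forall>\<^sub>F s in nhds t. f t \<le> f s)"

definition symmetric_about :: "(real \<Rightarrow> real) \<Rightarrow> real \<Rightarrow> bool" where
  "symmetric_about f p \<longleftrightarrow> (\<forall>s. f (p + s) = f (p - s))"

definition decays_to_zero :: "(real \<Rightarrow> real) \<Rightarrow> bool" where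
  "decays_to_zero f \<longleftrightarrow> (f \<longlongrightarrow> 0) at_top \<and> (f \<longlongrightarrow> 0) at_bot"

definition decays_exponentially :: "(real \<Rightarrow> real) \<Rightarrow> bool" where
  "decays_exponentially f \<longleftrightarrow> (\<exists>C>0. \<exists>c>0. \<forall>t. \<bar>f t\<bar> \<le> C * exp (- c * \<bar>t\<bar>))"

text \<open>\<open>m\<close> is the first positive value at which \<open>F\<close> returns to \<open>F 0\<close>, from below.\<close>

definition first_return :: "(real \<Rightarrow> real) \<Rightarrow> real \<Rightarrow> bool" where
  "first_return F m \<longleftrightarrow> 0 < m \<and> F m = F 0 \<and> (\<forall>x. 0 < x \<and> x < m \<longrightarrow> F x < F 0)"

text \<open>Peaks lie where \<open>u = 0\<close>, since the weak equation forbids a jump of \<open>(u\<^sup>2)'\<close>. A peaked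
  solitary wave therefore has its peak at a minimum with value \<open>0\<close> and tends to \<open>m\<close>; e.g. for
  \<open>F x = - x * (1 - x)\<^sup>2\<close> it is \<open>1 - exp (- sqrt 2 * \<bar>t\<bar>)\<close> up to translation. The quantity with
  a unique maximum that decays to zero is the elevation relative to the asymptotic level,
  \<open>m - u\<close>. If \<open>F'' m = 0\<close>, its decay is algebraic, as for
  \<open>F x = - x * (1 - x) ^ 4\<close>, where it is \<open>1 / (1 + sqrt 2 * \<bar>t\<bar>)\<close>.\<close>

definition elevation :: "real \<Rightarrow> (real \<Rightarrow> real) \<Rightarrow> real \<Rightarrow> real" where
  "elevation m u t = m - u t"

end

theory Submission
  imports Defs "HOL-Complex_Analysis.Complex_Analysis"
begin

text \<open>A peaked wave turns out to be a solution of a scalar autonomous equation, and such solutions can be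
written down by measuring time.

Of the weak equation only one consequence is needed: that \<open>(u\<^sup>2)' = 2 u u'\<close> has a locally integrable
derivative, so this function cannot jump; since \<open>u'\<close> changes sign at a peak without vanishing, \<open>u\<close>
must be zero there (\<open>peak_at_zero\<close>). To read the equation with classical derivatives one has to know
that weak derivatives are unique, that is, the fundamental lemma of the calculus of variations,
which is proved with explicit bump functions. The energy level is then \<open>F 0\<close>, and with
\<open>g x = 2 (F 0 - F x) / x\<close>, extended analytically to \<open>0\<close>, the energy equation reads \<open>u'\<^sup>2 = g u\<close>. The
slope at a peak is \<open>\<plusminus> sqrt (g 0)\<close>, whence \<open>F' 0 < 0\<close>; \<open>u\<close> is positive off the peaks; and a bounded
\<open>u\<close> forces \<open>g\<close> to vanish at a first \<open>m > 0\<close>. The equation off the peaks and the behaviour at them make up a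
\<open>wave_profile\<close>.

After a peak a profile rises, and as long as it stays in \<open>(0, m)\<close> the clock \<open>G\<close>, a primitive of
\<open>1 / sqrt g\<close>, satisfies \<open>G (u t) = t - s\<close> (\<open>wave_profile_arc\<close>). What happens at \<open>m\<close> depends on the order
of the zero of \<open>g\<close> there.

If \<open>F' m = 0\<close>, the zero is at least double, \<open>G\<close> diverges and \<open>u\<close> approaches \<open>m\<close> without reaching it:
the wave is \<open>p \<bar>t - s\<bar>\<close> with \<open>p\<close> the inverse of \<open>G\<close>. If the zero is exactly double, \<open>p' \<ge> c (m - p)\<close>
gives exponential decay.

If \<open>F' m \<noteq> 0\<close>, the zero is simple and \<open>m\<close> is reached after the time \<open>\<tau> = \<integral>\<^sub>0\<^sup>m 1 / sqrt g\<close>. In the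
coordinate \<open>y\<close> with \<open>u = m - y\<^sup>2\<close> the equation becomes \<open>y' = sqrt (K y) / 2\<close> with an even positive analytic
\<open>K\<close>, so \<open>y\<close> passes through \<open>0\<close> analytically and the arch is symmetric about its crest. Smoothness of \<open>u\<close>
excludes that it rests at \<open>m\<close>, because \<open>u''\<close> is inherited from the rising side and is negative. So \<open>u\<close>
falls back to \<open>0\<close> after another \<open>\<tau>\<close>, where it has to have a peak again, and the period is \<open>2 \<tau>\<close>.

In both cases the wave is determined by one arch \<open>p\<close> up to translation (\<open>solitary_profile\<close>,
\<open>periodic_profile\<close>), and all properties are read off from \<open>p\<close>. Conversely, arches placed next to each
other form a peaked wave (\<open>arch_train_wave_profile\<close>, \<open>wave_profile_imp_peaked_tws\<close>). Analyticity comes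
from the inverse function theorem for holomorphic functions, applied to \<open>G\<close> and to the clock in the
coordinate \<open>y\<close>.\<close>

section \<open>Real-analytic functions of one variable\<close>

lemma tendsto_of_real_nhds:
  "filterlim complex_of_real (nhds 0) (nhds 0)"
  using tendsto_of_real[OF filterlim_ident, of "0::real"] by simp

text \<open>Real-analytic functions are the restrictions of holomorphic functions that are real on the real axis:
a real power series converges on a complex disc as well, and conversely the real parts of the
coefficients of the complex series already represent the function. Closure under composition, roots
and inversion is inherited from complex analysis in this way.\<close>

lemma real_analytic_imp_complex_extension:
  assumes "real_analytic_on f {x}"
  obtains h :: "complex \<Rightarrow> complex" where "h analytic_on {of_real x}"
    "eventually (\<lambda>y. h (of_real y) = of_real (f y)) (nhds x)"
proof -
  obtain P where P: "(\<lambda>y. f (x + y)) has_fps_expansion P"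
    using assms by (auto simp: real_analytic_on_def)
  define Q :: "complex fps" where "Q = Abs_fps (\<lambda>n. of_real (fps_nth P n))"
  have rad: "fps_conv_radius Q = fps_conv_radius P"
    by (simp add: Q_def fps_conv_radius_def conv_radius_def)
  have Qexp: "eval_fps Q has_fps_expansion Q"
    using P by (intro eval_fps_has_fps_expansion) (auto simp: rad has_fps_expansion_def)
  have *: "eval_fps Q (of_real y) = of_real (eval_fps P y)"
    if "norm y < fps_conv_radius P" for y :: real
  proof -
    have "(\<lambda>n. fps_nth P n * y ^ n) sums eval_fps P y"
      using that by (rule sums_eval_fps)
    then have "(\<lambda>n. of_real (fps_nth P n * y ^ n) :: complex) sums of_real (eval_fps P y)"
      by (rule sums_of_real)
    then show ?thesis
      by (simp add: eval_fps_def Q_def sums_iff)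
  qed
  have "eventually (\<lambda>y. y \<in> eball 0 (fps_conv_radius P)) (nhds (0::real))"
    using P by (intro eventually_nhds_in_open) (auto simp: has_fps_expansion_def zero_ereal_def)
  then have ev0: "eventually (\<lambda>y. eval_fps Q (of_real y) = of_real (f (x + y))) (nhds (0::real))"
    using P unfolding has_fps_expansion_def
    by (elim conjE, elim eventually_elim2) (auto simp: *)
  show thesis
  proof
    have "(eval_fps Q \<circ> (\<lambda>z. z - of_real x)) analytic_on {of_real x}"
      by (rule analytic_on_compose) (use has_fps_expansion_imp_analytic_0[OF Qexp] in
        \<open>auto intro!: analytic_on_diff analytic_on_ident analytic_on_const\<close>)
    then show "(\<lambda>z. eval_fps Q (z - of_real x)) analytic_on {of_real x}"
      by (simp add: o_def)
    have "eventually (\<lambda>y. eval_fps Q (of_real (y - x)) = of_real (f (x + (y - x)))) (nhds x)"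
      using ev0 unfolding nhds_to_0[of x] eventually_filtermap by simp
    then show "eventually (\<lambda>y. eval_fps Q (of_real y - of_real x) = of_real (f y)) (nhds x)"
      by simp
  qed
qed

lemma complex_extension_imp_real_analytic:
  fixes h :: "complex \<Rightarrow> complex"
  assumes "h analytic_on {of_real x}"
    and "eventually (\<lambda>y. h (of_real y) = of_real (f y)) (nhds x)"
  shows "real_analytic_on f {x}"
proof -
  define Q where "Q = fps_expansion h (of_real x)"
  have Q: "(\<lambda>z. h (of_real x + z)) has_fps_expansion Q"
    unfolding Q_def by (rule analytic_at_imp_has_fps_expansion) fact
  have rad: "fps_conv_radius Q > 0"
    using Q by (simp add: has_fps_expansion_def)
  define P where "P = Abs_fps (\<lambda>n. Re (fps_nth Q n))"
  have "eventually (\<lambda>z. z \<in> eball 0 (fps_conv_radius Q)) (nhds (0::complex))"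
    using rad by (intro eventually_nhds_in_open) (auto simp: zero_ereal_def)
  then have "eventually (\<lambda>z. (\<lambda>n. fps_nth Q n * z ^ n) sums h (of_real x + z)) (nhds (0::complex))"
    using conjunct2[OF Q[unfolded has_fps_expansion_def]]
  proof eventually_elim
    case (elim z)
    then show ?case
      using sums_eval_fps[of z Q] by simp
  qed
  then have "eventually (\<lambda>y. (\<lambda>n. fps_nth Q n * of_real y ^ n) sums h (of_real x + of_real y)) (nhds (0::real))"
    by (rule eventually_compose_filterlim) (rule tendsto_of_real_nhds)
  moreover have "eventually (\<lambda>y. h (of_real (x + y)) = of_real (f (x + y))) (nhds (0::real))"
    using assms(2) unfolding nhds_to_0[of x] eventually_filtermap by (simp add: add.commute)
  ultimately have "eventually (\<lambda>y. (\<lambda>n. fps_nth P n * y ^ n) sums f (x + y)) (nhds (0::real))"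
  proof eventually_elim
    case (elim y)
    then have "(\<lambda>n. Re (fps_nth Q n * of_real y ^ n)) sums Re (of_real (f (x + y)))"
      by (intro sums_Re) simp
    then show ?case
      by (simp add: P_def flip: of_real_power)
  qed
  then have "(\<lambda>y. f (x + y)) has_fps_expansion P"
    by (rule has_fps_expansionI)
  then show ?thesis
    by (auto simp: real_analytic_on_def)
qed

lemma real_analytic_onI: "(\<And>x. x \<in> A \<Longrightarrow> real_analytic_on f {x}) \<Longrightarrow> real_analytic_on f A"
  by (auto simp: real_analytic_on_def)

lemma real_analytic_onD: "real_analytic_on f A \<Longrightarrow> x \<in> A \<Longrightarrow> real_analytic_on f {x}"
  by (auto simp: real_analytic_on_def)

lemma real_analytic_on_subset: "real_analytic_on f B \<Longrightarrow> A \<subseteq> B \<Longrightarrow> real_analytic_on f A"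
  by (auto simp: real_analytic_on_def)

lemma real_analytic_on_const: "real_analytic_on (\<lambda>_. c) A"
  by (auto simp: real_analytic_on_def)

lemma real_analytic_on_ident: "real_analytic_on (\<lambda>x. x) A"
proof -
  have "real_analytic_on (\<lambda>x. x) {x}" for x
    by (rule complex_extension_imp_real_analytic[where h = "\<lambda>z. z"]) (auto intro: analytic_intros)
  then show ?thesis
    by (rule real_analytic_onI)
qed

lemma real_analytic_on_cong_ev:
  assumes "real_analytic_on f {x}" "eventually (\<lambda>y. f y = g y) (nhds x)"
  shows "real_analytic_on g {x}"
proof -
  obtain h where h: "h analytic_on {of_real x}"
    "eventually (\<lambda>y. h (of_real y) = complex_of_real (f y)) (nhds x)"
    using real_analytic_imp_complex_extension[OF assms(1)] .
  show ?thesis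
    by (rule complex_extension_imp_real_analytic[OF h(1)])
       (use h(2) assms(2) in eventually_elim, simp)
qed

lemma real_analytic_on_add:
  assumes "real_analytic_on f A" "real_analytic_on g A"
  shows "real_analytic_on (\<lambda>x. f x + g x) A"
  unfolding real_analytic_on_def
proof
  fix x assume "x \<in> A"
  then obtain P Q where "(\<lambda>y. f (x + y)) has_fps_expansion P" "(\<lambda>y. g (x + y)) has_fps_expansion Q"
    using assms unfolding real_analytic_on_def by meson
  then show "\<exists>P. (\<lambda>y. f (x + y) + g (x + y)) has_fps_expansion P"
    by (intro exI, rule has_fps_expansion_add)
qed

lemma real_analytic_on_mult:
  assumes "real_analytic_on f A" "real_analytic_on g A"
  shows "real_analytic_on (\<lambda>x. f x * g x) A"
  unfolding real_analytic_on_def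
proof
  fix x assume "x \<in> A"
  then obtain P Q where "(\<lambda>y. f (x + y)) has_fps_expansion P" "(\<lambda>y. g (x + y)) has_fps_expansion Q"
    using assms unfolding real_analytic_on_def by meson
  then show "\<exists>P. (\<lambda>y. f (x + y) * g (x + y)) has_fps_expansion P"
    by (intro exI, rule has_fps_expansion_mult)
qed

lemma real_analytic_on_cmult: "real_analytic_on f A \<Longrightarrow> real_analytic_on (\<lambda>x. c * f x) A"
  by (intro real_analytic_on_mult real_analytic_on_const)

lemma real_analytic_on_minus: "real_analytic_on f A \<Longrightarrow> real_analytic_on (\<lambda>x. - f x) A"
  using real_analytic_on_cmult[of f A "-1"] by simp

lemma real_analytic_on_diff:
  "real_analytic_on f A \<Longrightarrow> real_analytic_on g A \<Longrightarrow> real_analytic_on (\<lambda>x. f x - g x) A"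
  using real_analytic_on_add[of f A "\<lambda>x. - g x"] real_analytic_on_minus[of g A] by simp

lemma real_analytic_on_compose:
  assumes "real_analytic_on g A" "real_analytic_on f (g ` A)"
  shows "real_analytic_on (\<lambda>x. f (g x)) A"
proof (rule real_analytic_onI)
  fix x assume x: "x \<in> A"
  obtain hg where hg: "hg analytic_on {of_real x}"
    "eventually (\<lambda>y. hg (of_real y) = complex_of_real (g y)) (nhds x)"
    using real_analytic_imp_complex_extension[OF real_analytic_onD[OF assms(1) x]] .
  obtain hf where hf: "hf analytic_on {of_real (g x)}"
    "eventually (\<lambda>y. hf (of_real y) = complex_of_real (f y)) (nhds (g x))"
    using real_analytic_imp_complex_extension[OF real_analytic_onD[OF assms(2) imageI[OF x]]] .
  have hgx: "hg (of_real x) = of_real (g x)"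
    using eventually_nhds_x_imp_x[OF hg(2)] .
  have "isCont hg (of_real x)"
    using hg(1) by (simp add: analytic_at_imp_isCont)
  then have "((\<lambda>y. hg (of_real y)) \<longlongrightarrow> hg (of_real x)) (nhds x)"
    unfolding isCont_def tendsto_at_iff_tendsto_nhds
    by (rule filterlim_compose) (auto intro!: tendsto_eq_intros filterlim_ident)
  then have "((\<lambda>y. complex_of_real (g y)) \<longlongrightarrow> of_real (g x)) (nhds x)"
    unfolding hgx by (rule Lim_transform_eventually) (rule hg(2))
  then have "(g \<longlongrightarrow> g x) (nhds x)"
    by (simp add: tendsto_of_real_iff)
  then have "eventually (\<lambda>y. hf (of_real (g y)) = complex_of_real (f (g y))) (nhds x)"
    using hf(2) by (rule eventually_compose_filterlim[rotated])
  with hg(2) have "eventually (\<lambda>y. (hf \<circ> hg) (of_real y) = complex_of_real (f (g y))) (nhds x)"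
    by eventually_elim simp
  moreover have "(hf \<circ> hg) analytic_on {of_real x}"
    using hg(1) by (rule analytic_on_compose) (use hf(1) hgx in simp)
  ultimately show "real_analytic_on (\<lambda>x. f (g x)) {x}"
    by (rule complex_extension_imp_real_analytic[rotated])
qed

lemma real_analytic_on_inverse:
  assumes "real_analytic_on f A" "\<And>x. x \<in> A \<Longrightarrow> f x \<noteq> 0"
  shows "real_analytic_on (\<lambda>x. inverse (f x)) A"
proof -
  have *: "real_analytic_on inverse {x}" if "x \<noteq> 0" for x :: real
    by (rule complex_extension_imp_real_analytic[where h = inverse])
       (use that in \<open>auto intro!: analytic_intros\<close>)
  show ?thesis
    by (rule real_analytic_on_compose[OF assms(1)], rule real_analytic_onI)
       (use * assms(2) in auto)
qed

lemma real_analytic_on_divide: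
  assumes "real_analytic_on f A" "real_analytic_on g A" "\<And>x. x \<in> A \<Longrightarrow> g x \<noteq> 0"
  shows "real_analytic_on (\<lambda>x. f x / g x) A"
  unfolding divide_inverse using assms by (intro real_analytic_on_mult real_analytic_on_inverse)

lemma real_analytic_on_sqrt:
  assumes "real_analytic_on f A" "\<And>x. x \<in> A \<Longrightarrow> 0 < f x"
  shows "real_analytic_on (\<lambda>x. sqrt (f x)) A"
proof -
  have *: "real_analytic_on sqrt {x}" if "0 < x" for x :: real
  proof (rule complex_extension_imp_real_analytic[where h = csqrt])
    show "csqrt analytic_on {of_real x}"
      using that by (intro analytic_intros) (auto simp: complex_nonpos_Reals_iff)
    have "eventually (\<lambda>y. y \<in> {0<..}) (nhds x)"
      using that by (intro eventually_nhds_in_open) auto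
    then show "eventually (\<lambda>y. csqrt (of_real y) = of_real (sqrt y)) (nhds x)"
      by eventually_elim auto
  qed
  show ?thesis
    by (rule real_analytic_on_compose[OF assms(1)], rule real_analytic_onI)
       (use * assms(2) in auto)
qed

lemma DERIV_shift_left:
  "((\<lambda>y. f (x + y)) has_real_derivative D) (at y) \<longleftrightarrow> (f has_real_derivative D) (at (x + y))"
  using DERIV_shift[of f D y x] by (simp add: add.commute)

lemma deriv_shift_left: "deriv (\<lambda>y. f (x + y)) y = deriv f (x + y)" for x y :: real
  unfolding deriv_def DERIV_shift_left ..

lemma real_analytic_on_deriv:
  assumes "real_analytic_on f A"
  shows "real_analytic_on (deriv f) A"
  unfolding real_analytic_on_def
proof
  fix x assume "x \<in> A"
  then obtain P where "(\<lambda>y. f (x + y)) has_fps_expansion P"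
    using assms by (auto simp: real_analytic_on_def)
  then have "deriv (\<lambda>y. f (x + y)) has_fps_expansion fps_deriv P"
    by (rule has_fps_expansion_deriv)
  moreover have "deriv (\<lambda>y. f (x + y)) = (\<lambda>y. deriv f (x + y))"
    using deriv_shift_left by blast
  ultimately show "\<exists>P. (\<lambda>y. deriv f (x + y)) has_fps_expansion P"
    by metis
qed

lemma real_analytic_on_DERIV:
  assumes "real_analytic_on f A" "x \<in> A"
  shows "(f has_real_derivative deriv f x) (at x)"
proof -
  obtain P where P: "(\<lambda>y. f (x + y)) has_fps_expansion P"
    using assms by (auto simp: real_analytic_on_def)
  have "(eval_fps P has_real_derivative eval_fps (fps_deriv P) 0) (at 0)"
    using P by (intro has_field_derivative_eval_fps) (auto simp: has_fps_expansion_def zero_ereal_def)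
  then have "((\<lambda>y. f (x + y)) has_real_derivative eval_fps (fps_deriv P) 0) (at 0)"
    using P unfolding has_fps_expansion_def
    by (subst (asm) DERIV_cong_ev[OF refl _ refl]) auto
  then have "(f has_real_derivative eval_fps (fps_deriv P) 0) (at x)"
    by (simp add: DERIV_shift_left)
  then show ?thesis
    by (simp add: DERIV_imp_deriv)
qed

lemma real_analytic_on_imp_smooth_on:
  assumes "real_analytic_on f A" "open A"
  shows "smooth_on f A"
proof -
  have "real_analytic_on ((deriv ^^ k) f) A" for k
    by (induction k) (auto intro: real_analytic_on_deriv assms)
  then have "\<forall>y\<in>A. (deriv ^^ k) f differentiable (at y)" for k
    using real_analytic_on_DERIV real_differentiable_def by blast
  then show ?thesis
    using assms(2) by (auto simp: smooth_on_def)
qed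

text \<open>On a small disc the complex extension of \<open>f\<close> has a holomorphic primitive, which differs from \<open>g\<close> on the
real axis by a constant.\<close>

lemma real_analytic_on_antiderivative:
  assumes "real_analytic_on f A" "open A"
    and g: "\<And>x. x \<in> A \<Longrightarrow> (g has_real_derivative f x) (at x)"
  shows "real_analytic_on g A"
proof (rule real_analytic_onI)
  fix x assume x: "x \<in> A"
  obtain h where h: "h analytic_on {of_real x}"
    "eventually (\<lambda>y. h (of_real y) = complex_of_real (f y)) (nhds x)"
    using real_analytic_imp_complex_extension[OF real_analytic_onD[OF assms(1) x]] .
  obtain e where e: "e > 0" "h holomorphic_on ball (of_real x) e"
    using h(1) by (auto simp: analytic_on_def)
  then obtain H where H: "\<And>z. z \<in> ball (of_real x) e \<Longrightarrow> (H has_field_derivative h z) (at z)"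
    using holomorphic_convex_primitive'[OF convex_ball open_ball e(2)] at_within_open[OF _ open_ball]
    by metis
  have "eventually (\<lambda>y. y \<in> A) (nhds x)"
    using assms(2) x by (intro eventually_nhds_in_open)
  then have "eventually (\<lambda>y. h (of_real y) = of_real (f y) \<and> y \<in> A) (nhds x)"
    using h(2) by eventually_elim simp
  then obtain d0 where d0: "d0 > 0" "\<And>y. dist y x < d0 \<Longrightarrow> h (of_real y) = of_real (f y) \<and> y \<in> A"
    unfolding eventually_nhds_metric by blast
  define d where "d = min d0 e"
  have d: "d > 0" "\<And>y. y \<in> ball x d \<Longrightarrow> h (of_real y) = of_real (f y) \<and> y \<in> A \<and>
      complex_of_real y \<in> ball (of_real x) e"
    using d0 e(1) by (auto simp: d_def dist_commute dist_of_real)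
  have "((\<lambda>y. H (of_real y) - of_real (g y)) has_vector_derivative 0) (at y within ball x d)"
    if y: "y \<in> ball x d" for y
  proof -
    have "((\<lambda>y. H (of_real y)) has_vector_derivative h (of_real y)) (at y)"
      using H[of "of_real y"] d(2)[OF y] by (intro has_vector_derivative_real_field) blast
    moreover have "((\<lambda>y. complex_of_real (g y)) has_vector_derivative of_real (f y)) (at y)"
      using g d(2)[OF y]
      by (intro has_vector_derivative_of_real) (simp add: has_real_derivative_iff_has_vector_derivative)
    ultimately have "((\<lambda>y. H (of_real y) - of_real (g y)) has_vector_derivative (h (of_real y) - of_real (f y))) (at y)"
      by (rule has_vector_derivative_diff)
    then show ?thesis
      using d(2)[OF y] by (simp add: has_vector_derivative_at_within)
  qed
  then obtain c where c: "\<And>y. y \<in> ball x d \<Longrightarrow> H (of_real y) - of_real (g y) = c"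
    using has_vector_derivative_zero_constant[OF convex_ball,
      where f = "\<lambda>y. H (of_real y) - of_real (g y)"] by blast
  have "(\<lambda>z. H z - c) analytic_on {of_real x}"
  proof (intro analytic_on_diff analytic_on_const)
    have "H holomorphic_on ball (of_real x) e"
      using H by (meson holomorphic_on_open open_ball)
    then show "H analytic_on {of_real x}"
      using e(1) by (auto simp: analytic_on_def)
  qed
  moreover have "eventually (\<lambda>y. y \<in> ball x d) (nhds x)"
    using d(1) by (intro eventually_nhds_in_open) auto
  then have "eventually (\<lambda>y. H (of_real y) - c = of_real (g y)) (nhds x)"
    by eventually_elim (use c in \<open>force simp: algebra_simps\<close>)
  ultimately show "real_analytic_on g {x}"
    by (rule complex_extension_imp_real_analytic)
qed

text \<open>The difference quotient of \<open>f\<close> at \<open>a\<close>, with its removable singularity filled.\<close>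

definition slope_from :: "(real \<Rightarrow> real) \<Rightarrow> real \<Rightarrow> real \<Rightarrow> real" where
  "slope_from f a x = (if x = a then deriv f a else (f x - f a) / (x - a))"

lemma real_analytic_on_slope_from:
  assumes "real_analytic_on f A" "a \<in> A"
  shows "real_analytic_on (slope_from f a) A"
proof (rule real_analytic_onI)
  fix x assume x: "x \<in> A"
  show "real_analytic_on (slope_from f a) {x}"
  proof (cases "x = a")
    case False
    have "real_analytic_on (\<lambda>x. (f x - f a) / (x - a)) {x}"
      using False assms(1) x
      by (intro real_analytic_on_divide real_analytic_on_diff real_analytic_on_ident real_analytic_on_const)
         (auto intro: real_analytic_on_subset)
    moreover have "eventually (\<lambda>y. y \<in> - {a}) (nhds x)"
      using False by (intro eventually_nhds_in_open) auto
    then have "eventually (\<lambda>y. (f y - f a) / (y - a) = slope_from f a y) (nhds x)"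
      by eventually_elim (auto simp: slope_from_def)
    ultimately show ?thesis
      by (rule real_analytic_on_cong_ev)
  next
    case True
    obtain P where P: "(\<lambda>y. f (a + y)) has_fps_expansion P"
      using assms by (auto simp: real_analytic_on_def)
    then have P0: "fps_nth P 0 = f a"
      by (auto simp: has_fps_expansion_def eval_fps_at_0 dest: eventually_nhds_x_imp_x)
    have "deriv (\<lambda>y. f (a + y)) has_fps_expansion fps_deriv P"
      using P by (rule has_fps_expansion_deriv)
    then have P1: "fps_nth P 1 = deriv f a"
      by (auto simp: has_fps_expansion_def eval_fps_at_0 deriv_shift_left
            dest: eventually_nhds_x_imp_x)
    have Q: "(\<lambda>y. f (a + y) - f a) has_fps_expansion P - fps_const (f a)"
      using P by (intro has_fps_expansion_diff) auto
    have "(\<lambda>y. if y = 0 then deriv f a else slope_from f a (a + y)) has_fps_expansion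
        fps_shift 1 (P - fps_const (f a))"
    proof (cases "P - fps_const (f a) = 0")
      case True
      then have z: "\<And>n. fps_nth P n = fps_nth (fps_const (f a)) n"
        by simp
      have "eventually (\<lambda>y. f (a + y) - f a = 0) (nhds 0)"
        using Q True by (simp add: has_fps_expansion_0_iff)
      then have "eventually (\<lambda>y. (if y = 0 then deriv f a else slope_from f a (a + y)) = 0) (nhds 0)"
        by eventually_elim (use P1 z[of 1] in \<open>auto simp: slope_from_def\<close>)
      then show ?thesis
        using True by (simp add: has_fps_expansion_0_iff)
    next
      case False
      have "1 \<le> subdegree (P - fps_const (f a))"
        using False P0 by (intro subdegree_geI) auto
      then have "(\<lambda>y. if y = 0 then deriv f a else (f (a + y) - f a) / y ^ 1) has_fps_expansion
        fps_shift 1 (P - fps_const (f a))"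
        by (intro has_fps_expansion_shift Q) (auto simp: P1[symmetric])
      then show ?thesis
        by (simp add: slope_from_def cong: if_cong)
    qed
    moreover have "(\<lambda>y. if y = 0 then deriv f a else slope_from f a (a + y)) = (\<lambda>y. slope_from f a (a + y))"
      by (auto simp: slope_from_def)
    ultimately show ?thesis
      using True by (auto simp: real_analytic_on_def)
  qed
qed

text \<open>The complex extension of \<open>f\<close> has a holomorphic local inverse. It agrees with \<open>v\<close> on the real axis, since
the real point \<open>v r\<close> is a preimage of \<open>r\<close> and there is only one preimage near \<open>v t\<close>.\<close>

lemma real_analytic_on_inverse_function:
  assumes "real_analytic_on f {v t}" "deriv f (v t) \<noteq> 0" "isCont v t"
    and inv: "eventually (\<lambda>r. f (v r) = r) (nhds t)"
  shows "real_analytic_on v {t}"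
proof -
  define x where "x = v t"
  have fx: "f x = t"
    using eventually_nhds_x_imp_x[OF inv] by (simp add: x_def)
  obtain h where h: "h analytic_on {of_real x}"
    "eventually (\<lambda>y. h (of_real y) = complex_of_real (f y)) (nhds x)"
    using real_analytic_imp_complex_extension[of f x] assms(1) unfolding x_def by blast
  have hx: "h (of_real x) = of_real t"
    using eventually_nhds_x_imp_x[OF h(2)] fx by simp
  obtain U where U: "open U" "of_real x \<in> U" "h holomorphic_on U"
    using h(1) by (auto simp: analytic_at)
  have "(f has_real_derivative deriv f x) (at x)"
    using assms(1) real_analytic_on_DERIV by (auto simp: x_def)
  then have 1: "((\<lambda>y. complex_of_real (f y)) has_vector_derivative of_real (deriv f x)) (at x)"
    by (intro has_vector_derivative_of_real) (simp add: has_real_derivative_iff_has_vector_derivative)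
  have "(h has_field_derivative deriv h (of_real x)) (at (of_real x))"
    using U holomorphic_derivI by blast
  then have "((\<lambda>y. h (of_real y)) has_vector_derivative deriv h (of_real x)) (at x)"
    by (rule has_vector_derivative_real_field)
  then have "((\<lambda>y. complex_of_real (f y)) has_vector_derivative deriv h (of_real x)) (at x)"
    using h(2) by (subst (asm) has_vector_derivative_cong_ev[where g = "\<lambda>y. complex_of_real (f y)"])
      (auto dest: eventually_nhds_x_imp_x)
  then have "deriv h (of_real x) \<noteq> 0"
    using 1 assms(2) vector_derivative_unique_at by (fastforce simp: x_def)
  then obtain r where r: "r > 0" "ball (of_real x) r \<subseteq> U" "open (h ` ball (of_real x) r)"
      "inj_on h (ball (of_real x) r)"
    using has_complex_derivative_locally_invertible[OF U(3,2,1)] by blast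
  obtain g where g: "g holomorphic_on (h ` ball (of_real x) r)"
      "\<And>z. z \<in> ball (of_real x) r \<Longrightarrow> g (h z) = z"
    using holomorphic_has_inverse[OF holomorphic_on_subset[OF U(3) r(2)] open_ball r(4)] by metis
  have "of_real t \<in> h ` ball (of_real x) r"
    using r(1) hx by (metis centre_in_ball imageI)
  then have "g analytic_on {of_real t}"
    using g(1) r(3) by (auto simp: analytic_at)
  moreover have "eventually (\<lambda>s. g (of_real s) = complex_of_real (v s)) (nhds t)"
  proof -
    have lim: "(v \<longlongrightarrow> x) (nhds t)"
      using assms(3) by (simp add: isCont_def tendsto_at_iff_tendsto_nhds x_def)
    have "eventually (\<lambda>y. y \<in> ball x r) (nhds x)"
      using r(1) by (intro eventually_nhds_in_open) auto
    then have "eventually (\<lambda>s. v s \<in> ball x r) (nhds t)"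
      using lim by (rule eventually_compose_filterlim)
    moreover have "eventually (\<lambda>s. h (of_real (v s)) = of_real (f (v s))) (nhds t)"
      using h(2) lim by (rule eventually_compose_filterlim)
    ultimately show ?thesis
      using inv
    proof eventually_elim
      case (elim s)
      then have "complex_of_real (v s) \<in> ball (of_real x) r"
        by (simp add: dist_of_real)
      then show ?case
        using g(2) elim by metis
    qed
  qed
  ultimately show ?thesis
    by (rule complex_extension_imp_real_analytic)
qed

section \<open>Bump functions and weak derivatives\<close>

lemma DERIV_transform_ev:
  fixes f g :: "real \<Rightarrow> real"
  assumes "(f has_real_derivative D) (at x)" "eventually (\<lambda>y. f y = g y) (nhds x)"
  shows "(g has_real_derivative D) (at x)"
  using DERIV_cong_ev[OF refl assms(2) refl] assms(1) by simp

text \<open>The family is indexed by the power of \<open>y\<close> because differentiation leads from \<open>exp (- 1 / y)\<close> to its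
multiples by powers of \<open>1 / y\<close>; all of them are flat at \<open>0\<close>.\<close>

definition flat_exp :: "nat \<Rightarrow> real \<Rightarrow> real" where
  "flat_exp k y = (if 0 < y then exp (- 1 / y) / y ^ k else 0)"

lemma flat_exp_tendsto_0: "(flat_exp k \<longlongrightarrow> 0) (at 0)"
proof (subst filterlim_at_split, rule conjI)
  have "eventually (\<lambda>y. y \<in> {..<0}) (at_left (0::real))"
    by (simp add: eventually_at_filter)
  then show "(flat_exp k \<longlongrightarrow> 0) (at_left 0)"
    by (intro tendsto_eventually) (auto elim!: eventually_mono simp: flat_exp_def)
  have "((\<lambda>y::real. inverse y ^ k / exp (inverse y)) \<longlongrightarrow> 0) (at_right 0)"
    using tendsto_power_div_exp_0 filterlim_inverse_at_top_right by (rule filterlim_compose)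
  moreover have "eventually (\<lambda>y. y \<in> {0<..}) (at_right (0::real))"
    by (simp add: eventually_at_right_less)
  then have "eventually (\<lambda>y::real. inverse y ^ k / exp (inverse y) = flat_exp k y) (at_right 0)"
    by eventually_elim (simp add: flat_exp_def exp_minus field_simps)
  ultimately show "(flat_exp k \<longlongrightarrow> 0) (at_right 0)"
    by (rule Lim_transform_eventually)
qed

lemma DERIV_flat_exp:
  "(flat_exp k has_real_derivative flat_exp (k + 2) y - real k * flat_exp (k + 1) y) (at y)"
proof (cases y "0::real" rule: linorder_cases)
  case less
  have "((\<lambda>_. 0) has_real_derivative 0) (at y)"
    by simp
  moreover have "eventually (\<lambda>z. z \<in> {..<0}) (nhds y)"
    using less by (intro eventually_nhds_in_open) auto
  then have "eventually (\<lambda>z. 0 = flat_exp k z) (nhds y)"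
    by eventually_elim (simp add: flat_exp_def)
  ultimately have "(flat_exp k has_real_derivative 0) (at y)"
    by (rule DERIV_transform_ev)
  then show ?thesis
    using less by (simp add: flat_exp_def)
next
  case equal
  have "((\<lambda>h. (flat_exp k (0 + h) - flat_exp k 0) / h) \<longlongrightarrow> 0) (at 0)"
  proof (rule Lim_transform_eventually[OF flat_exp_tendsto_0])
    show "eventually (\<lambda>h. flat_exp (k + 1) h = (flat_exp k (0 + h) - flat_exp k 0) / h) (at 0)"
      by (rule always_eventually) (simp add: flat_exp_def)
  qed
  then show ?thesis
    using equal by (simp add: DERIV_def flat_exp_def)
next
  case greater
  have "((\<lambda>y. exp (- 1 / y) / y ^ k) has_real_derivative
      ((exp (- 1 / y) * (1 / (y * y))) * y ^ k - exp (- 1 / y) * (real k * y ^ (k - 1))) / (y ^ k * y ^ k)) (at y)"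
    using greater by (auto intro!: derivative_eq_intros simp: field_simps)
  also have "((exp (- 1 / y) * (1 / (y * y))) * y ^ k - exp (- 1 / y) * (real k * y ^ (k - 1))) / (y ^ k * y ^ k)
      = flat_exp (k + 2) y - real k * flat_exp (k + 1) y"
    using greater by (cases k) (simp_all add: flat_exp_def field_simps)
  finally have "((\<lambda>y. exp (- 1 / y) / y ^ k) has_real_derivative
      flat_exp (k + 2) y - real k * flat_exp (k + 1) y) (at y)" .
  moreover have "eventually (\<lambda>z. z \<in> {0<..}) (nhds y)"
    using greater by (intro eventually_nhds_in_open) auto
  then have "eventually (\<lambda>z. exp (- 1 / z) / z ^ k = flat_exp k z) (nhds y)"
    by eventually_elim (simp add: flat_exp_def)
  ultimately show ?thesis
    by (rule DERIV_transform_ev)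
qed

text \<open>On \<open>(a, b)\<close> this is \<open>exp (- 1 / (n (t - a) (b - t)))\<close>, which tends to \<open>1\<close> as \<open>n\<close> grows. The bumps thus
approximate the indicator function of the interval from below.\<close>

definition bump :: "real \<Rightarrow> real \<Rightarrow> nat \<Rightarrow> real \<Rightarrow> real" where
  "bump a b n t = flat_exp 0 (real n * ((t - a) * (b - t)))"

text \<open>An algebra of functions that contains the bumps, for the quadratic \<open>q\<close> in their exponent, and that is
closed under differentiation as soon as it contains \<open>q'\<close>.
Membership of all iterated derivatives gives smoothness without a formula for them.\<close>

inductive bump_algebra :: "(real \<Rightarrow> real) \<Rightarrow> (real \<Rightarrow> real) \<Rightarrow> bool" for q where
  flat: "bump_algebra q (\<lambda>t. flat_exp k (q t))"
| const: "bump_algebra q (\<lambda>_. c)"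
| ident: "bump_algebra q (\<lambda>t. t)"
| add: "bump_algebra q f \<Longrightarrow> bump_algebra q g \<Longrightarrow> bump_algebra q (\<lambda>t. f t + g t)"
| mult: "bump_algebra q f \<Longrightarrow> bump_algebra q g \<Longrightarrow> bump_algebra q (\<lambda>t. f t * g t)"

lemma bump_algebra_DERIV:
  assumes "bump_algebra q f" "\<And>t. (q has_real_derivative q' t) (at t)" "bump_algebra q q'"
  shows "\<exists>f'. bump_algebra q f' \<and> (\<forall>t. (f has_real_derivative f' t) (at t))"
  using assms(1)
proof induction
  case (flat k)
  have "bump_algebra q (\<lambda>t. (flat_exp (k + 2) (q t) + (- real k) * flat_exp (k + 1) (q t)) * q' t)"
    by (intro bump_algebra.intros assms)
  moreover have "((\<lambda>t. flat_exp k (q t)) has_real_derivative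
      (flat_exp (k + 2) (q t) + (- real k) * flat_exp (k + 1) (q t)) * q' t) (at t)" for t
    using DERIV_chain2[OF DERIV_flat_exp assms(2)] by simp
  ultimately show ?case by blast
next
  case (const c)
  then show ?case using bump_algebra.const[of q 0] by (intro exI[of _ "\<lambda>_. 0"]) auto
next
  case ident
  then show ?case using bump_algebra.const[of q 1] by (intro exI[of _ "\<lambda>_. 1"]) auto
next
  case (add f g)
  then obtain f' g' where *: "bump_algebra q f'" "\<forall>t. (f has_real_derivative f' t) (at t)"
    "bump_algebra q g'" "\<forall>t. (g has_real_derivative g' t) (at t)" by blast
  then have "bump_algebra q (\<lambda>t. f' t + g' t)"
    by (intro bump_algebra.intros)
  with * show ?case
    by (intro exI[of _ "\<lambda>t. f' t + g' t"]) (auto intro: derivative_intros)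
next
  case (mult f g)
  then obtain f' g' where *: "bump_algebra q f'" "\<forall>t. (f has_real_derivative f' t) (at t)"
    "bump_algebra q g'" "\<forall>t. (g has_real_derivative g' t) (at t)" by blast
  then have "bump_algebra q (\<lambda>t. f' t * g t + g' t * f t)"
    using mult by (intro bump_algebra.intros)
  with * show ?case
    by (intro exI[of _ "\<lambda>t. f' t * g t + g' t * f t"]) (auto intro: DERIV_mult)
qed

lemma bump_algebra_imp_smooth:
  assumes "bump_algebra q f" "\<And>t. (q has_real_derivative q' t) (at t)" "bump_algebra q q'"
  shows "smooth_on f UNIV"
proof -
  have "bump_algebra q ((deriv ^^ k) f)" for k
  proof (induction k)
    case (Suc k)
    then obtain f' where f': "bump_algebra q f'" "\<forall>t. ((deriv ^^ k) f has_real_derivative f' t) (at t)"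
      using bump_algebra_DERIV assms(2,3) by blast
    then have "deriv ((deriv ^^ k) f) = f'"
      by (auto intro: DERIV_imp_deriv)
    with f' show ?case by simp
  qed (use assms in simp)
  then have "(deriv ^^ k) f differentiable (at y)" for k y
    using bump_algebra_DERIV[OF _ assms(2,3)] real_differentiable_def by blast
  then show ?thesis
    unfolding smooth_on_def by blast
qed

lemma bump_eq_0: "t \<notin> {a<..<b} \<Longrightarrow> a < b \<Longrightarrow> bump a b n t = 0"
proof -
  assume *: "t \<notin> {a<..<b}" "a < b"
  then have "(t - a) * (b - t) \<le> 0"
    by (auto simp: mult_le_0_iff)
  then have "real n * ((t - a) * (b - t)) \<le> 0"
    by (simp add: mult_nonneg_nonpos)
  then show ?thesis
    by (simp add: bump_def flat_exp_def)
qed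

lemma bump_eq_exp: "t \<in> {a<..<b} \<Longrightarrow> n > 0 \<Longrightarrow> bump a b n t = exp (- 1 / (real n * ((t - a) * (b - t))))"
  by (simp add: bump_def flat_exp_def)

lemma bump_bounds: "0 \<le> bump a b n t" "bump a b n t \<le> 1"
  by (auto simp: bump_def flat_exp_def)

lemma test_function_bump:
  assumes "a < b"
  shows "test_function (bump a b n)"
  unfolding test_function_def
proof
  let ?q = "\<lambda>t. real n * ((t - a) * (b - t))"
  show "smooth_on (bump a b n) UNIV"
  proof (rule bump_algebra_imp_smooth)
    show "bump_algebra ?q (bump a b n)"
      unfolding bump_def by (rule bump_algebra.flat)
    show "(?q has_real_derivative real n * (a + b + (-2) * t)) (at t)" for t
      by (auto intro!: derivative_eq_intros simp: algebra_simps)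
    show "bump_algebra ?q (\<lambda>t. real n * (a + b + (-2) * t))"
      by (intro bump_algebra.intros)
  qed
  have "{t. bump a b n t \<noteq> 0} \<subseteq> {a..b}"
  proof
    fix t assume "t \<in> {t. bump a b n t \<noteq> 0}"
    then have "t \<in> {a<..<b}"
      using bump_eq_0[OF _ assms] by blast
    then show "t \<in> {a..b}" by simp
  qed
  then have "closure {t. bump a b n t \<noteq> 0} \<subseteq> {a..b}"
    by (rule closure_minimal) simp
  then show "compact (closure {t. bump a b n t \<noteq> 0})"
    by (metis bounded_closed_interval bounded_subset closed_closure compact_eq_bounded_closed)
qed

lemma bump_tendsto_1:
  assumes "t \<in> {a<..<b}"
  shows "(\<lambda>n. bump a b (Suc n) t) \<longlonglongrightarrow> 1"
proof -
  define c where "c = (t - a) * (b - t)"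
  have c: "c > 0" using assms by (simp add: c_def)
  have "(\<lambda>n. - (1 / c) * inverse (real (Suc n))) \<longlonglongrightarrow> - (1 / c) * 0"
    by (intro tendsto_intros LIMSEQ_inverse_real_of_nat)
  then have "(\<lambda>n. exp (- (1 / c) * inverse (real (Suc n)))) \<longlonglongrightarrow> exp 0"
    by (intro tendsto_exp) simp
  moreover have "bump a b (Suc n) t = exp (- (1 / c) * inverse (real (Suc n)))" for n
    unfolding bump_eq_exp[OF assms zero_less_Suc] c_def[symmetric]
    using c by (simp add: divide_inverse mult.commute del: of_nat_Suc)
  ultimately show ?thesis by simp
qed

lemma test_function_DERIV:
  assumes "test_function \<phi>"
  shows "(\<phi> has_real_derivative deriv \<phi> t) (at t)" "isCont (deriv \<phi>) t"
proof -
  have *: "(deriv ^^ k) \<phi> differentiable (at t)" for k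
    using assms unfolding test_function_def smooth_on_def by blast
  show "(\<phi> has_real_derivative deriv \<phi> t) (at t)"
    using *[of 0] by (simp add: DERIV_deriv_iff_real_differentiable)
  show "isCont (deriv \<phi>) t"
    using *[of 1] by (simp add: differentiable_imp_continuous_within)
qed

lemma test_function_continuous:
  assumes "test_function \<phi>"
  shows "continuous_on A \<phi>" "continuous_on A (deriv \<phi>)"
  using test_function_DERIV[OF assms]
  by (auto intro!: continuous_at_imp_continuous_on intro: DERIV_isCont)

lemma test_function_support:
  assumes "test_function \<phi>"
  obtains R where "R > 0" "\<And>t. t \<notin> {-R<..<R} \<Longrightarrow> \<phi> t = 0" "\<And>t. t \<notin> {-R<..<R} \<Longrightarrow> deriv \<phi> t = 0"
proof -
  let ?K = "closure {t. \<phi> t \<noteq> 0}"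
  have "bounded ?K"
    using assms by (auto simp: test_function_def compact_imp_bounded)
  then obtain r where r: "r > 0" "\<And>t. t \<in> ?K \<Longrightarrow> \<bar>t\<bar> \<le> r"
    by (auto simp: bounded_pos)
  have out: "t \<notin> ?K" if "t \<notin> {-(r + 1)<..<r + 1}" for t
    using r(2)[of t] that by auto
  show thesis
  proof
    show "r + 1 > 0" using r by simp
    show "\<phi> t = 0" if "t \<notin> {-(r + 1)<..<r + 1}" for t
      using out[OF that] closure_subset[of "{t. \<phi> t \<noteq> 0}"] by auto
    show "deriv \<phi> t = 0" if "t \<notin> {-(r + 1)<..<r + 1}" for t
    proof -
      have "eventually (\<lambda>s. s \<in> - ?K) (nhds t)"
        using out[OF that] by (intro eventually_nhds_in_open) auto
      then have ev: "eventually (\<lambda>s. 0 = \<phi> s) (nhds t)"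
        by eventually_elim (use closure_subset[of "{t. \<phi> t \<noteq> 0}"] in auto)
      have "((\<lambda>_. 0) has_real_derivative 0) (at t)" by simp
      then have "(\<phi> has_real_derivative 0) (at t)"
        using ev by (rule DERIV_transform_ev)
      then show ?thesis by (rule DERIV_imp_deriv)
    qed
  qed
qed

lemma loc_integrable_continuous: "continuous_on UNIV f \<Longrightarrow> loc_integrable f"
  unfolding loc_integrable_def
  by (intro allI borel_integrable_atLeastAtMost') (auto intro: continuous_on_subset)

lemma loc_integrable_diff: "loc_integrable f \<Longrightarrow> loc_integrable g \<Longrightarrow> loc_integrable (\<lambda>t. f t - g t)"
  unfolding loc_integrable_def by (auto intro: set_integral_diff)

lemma loc_integrable_bounded:
  assumes "f \<in> borel_measurable borel" "\<And>a b. \<exists>M. \<forall>t\<in>{a..b}. \<bar>f t\<bar> \<le> M"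
  shows "loc_integrable f"
  unfolding loc_integrable_def
proof (intro allI)
  fix a b
  obtain M where M: "\<And>t. t \<in> {a..b} \<Longrightarrow> \<bar>f t\<bar> \<le> M"
    using assms(2) by blast
  have "set_integrable lborel {a..b} (\<lambda>_. M)"
    by (rule borel_integrable_atLeastAtMost') simp
  then show "set_integrable lborel {a..b} f"
    unfolding set_integrable_def
    by (rule Bochner_Integration.integrable_bound)
       (use assms(1) M in \<open>auto simp: indicator_def intro!: AE_I2 order_trans[OF _ abs_ge_self]\<close>)
qed

lemma set_integrable_mult_continuous:
  assumes "loc_integrable f" "continuous_on UNIV \<phi>"
  shows "set_integrable lborel {a..b} (\<lambda>t. f t * \<phi> t)"
proof -
  have "compact (\<phi> ` {a..b})"
    using assms(2) by (intro compact_continuous_image) (auto intro: continuous_on_subset)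
  then obtain M where M: "\<And>t. t \<in> {a..b} \<Longrightarrow> \<bar>\<phi> t\<bar> \<le> M"
    using compact_imp_bounded bounded_iff by (metis imageI real_norm_def)
  have \<phi>[measurable]: "\<phi> \<in> borel_measurable borel"
    using assms(2) by (rule borel_measurable_continuous_onI)
  have int: "integrable lborel (\<lambda>t. indicator {a..b} t *\<^sub>R f t)"
    using assms(1) by (simp add: loc_integrable_def set_integrable_def)
  then have "integrable lborel (\<lambda>t. M * (indicator {a..b} t *\<^sub>R f t))"
    by simp
  then have "integrable lborel (\<lambda>t. (indicator {a..b} t *\<^sub>R f t) * \<phi> t)"
  proof (rule Bochner_Integration.integrable_bound)
    show "(\<lambda>t. (indicator {a..b} t *\<^sub>R f t) * \<phi> t) \<in> borel_measurable lborel"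
      using int by measurable
    show "AE t in lborel. norm ((indicator {a..b} t *\<^sub>R f t) * \<phi> t) \<le> norm (M * (indicator {a..b} t *\<^sub>R f t))"
    proof (intro AE_I2)
      fix t show "norm ((indicator {a..b} t *\<^sub>R f t) * \<phi> t) \<le> norm (M * (indicator {a..b} t *\<^sub>R f t))"
        using M[of t] by (auto simp: indicator_def abs_mult mult.commute intro!: mult_right_mono)
    qed
  qed
  then show ?thesis
    by (simp add: set_integrable_def mult.assoc)
qed

lemma LINT_eq_set_LINT:
  fixes f :: "real \<Rightarrow> real"
  assumes "\<And>t. t \<notin> A \<Longrightarrow> f t = 0"
  shows "(LINT t|lborel. f t) = (LINT t:A|lborel. f t)"
  unfolding set_lebesgue_integral_def
  by (intro Bochner_Integration.integral_cong) (use assms in \<open>auto simp: indicator_def\<close>)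

lemma integrable_mult_test:
  assumes "loc_integrable f" "continuous_on UNIV \<phi>" "\<And>t. t \<notin> {-R<..<R} \<Longrightarrow> \<phi> t = 0"
  shows "integrable lborel (\<lambda>t. f t * \<phi> t)"
proof -
  have "integrable lborel (\<lambda>t. indicator {-R..R} t *\<^sub>R (f t * \<phi> t))"
    using set_integrable_mult_continuous[OF assms(1,2)] by (simp add: set_integrable_def)
  also have "(\<lambda>t. indicator {-R..R} t *\<^sub>R (f t * \<phi> t)) = (\<lambda>t. f t * \<phi> t)"
  proof
    fix t show "indicator {-R..R} t *\<^sub>R (f t * \<phi> t) = f t * \<phi> t"
      using assms(3)[of t] by (cases "t \<in> {-R..R}") auto
  qed
  finally show ?thesis .
qed

lemma integrable_mult_test_function:
  assumes "loc_integrable f" "test_function \<phi>"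
  shows "integrable lborel (\<lambda>t. f t * \<phi> t)" "integrable lborel (\<lambda>t. f t * deriv \<phi> t)"
  using test_function_support[OF assms(2)] integrable_mult_test[OF assms(1)]
    test_function_continuous[OF assms(2)] by metis+

text \<open>Only finitely many kinks lie in the support of a test function, and integration by parts leaves no
boundary terms at them because \<open>f\<close> is continuous.\<close>

lemma weak_deriv_piecewise:
  assumes cont: "continuous_on UNIV f"
    and fin: "\<And>a b. finite (S \<inter> {a..b})"
    and der: "\<And>t. t \<notin> S \<Longrightarrow> (f has_real_derivative f' t) (at t)"
    and int: "loc_integrable f'"
  shows "weak_deriv f f'"
  unfolding weak_deriv_def
proof (intro conjI allI impI)
  show f: "loc_integrable f" using cont by (rule loc_integrable_continuous)
  show "loc_integrable f'" by fact
  fix \<phi> assume \<phi>: "test_function \<phi>"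
  obtain R where R: "R > 0" "\<And>t. t \<notin> {-R<..<R} \<Longrightarrow> \<phi> t = 0" "\<And>t. t \<notin> {-R<..<R} \<Longrightarrow> deriv \<phi> t = 0"
    using test_function_support[OF \<phi>] by blast
  have "((\<lambda>t. f' t * \<phi> t + f t * deriv \<phi> t) has_integral (f R * \<phi> R - f (-R) * \<phi> (-R))) {-R..R}"
  proof (rule fundamental_theorem_of_calculus_strong[of "S \<inter> {-R..R}"])
    show "((\<lambda>t. f t * \<phi> t) has_vector_derivative f' t * \<phi> t + f t * deriv \<phi> t) (at t)"
      if "t \<in> {-R..R} - S \<inter> {-R..R}" for t
      using that unfolding has_real_derivative_iff_has_vector_derivative[symmetric]
      by (auto intro!: derivative_eq_intros der test_function_DERIV[OF \<phi>])
    show "continuous_on {-R..R} (\<lambda>t. f t * \<phi> t)"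
      using cont test_function_continuous[OF \<phi>] by (intro continuous_on_mult) (auto intro: continuous_on_subset)
  qed (use fin R in auto)
  then have "((\<lambda>t. f' t * \<phi> t + f t * deriv \<phi> t) has_integral 0) {-R..R}"
    using R by simp
  then have "integral {-R..R} (\<lambda>t. f' t * \<phi> t + f t * deriv \<phi> t) = 0"
    by (rule integral_unique)
  moreover have i: "set_integrable lborel {-R..R} (\<lambda>t. f' t * \<phi> t)"
      "set_integrable lborel {-R..R} (\<lambda>t. f t * deriv \<phi> t)"
    by (intro set_integrable_mult_continuous int f test_function_continuous \<phi>)+
  ultimately have "(LINT t:{-R..R}|lborel. f' t * \<phi> t + f t * deriv \<phi> t) = 0"
    using set_borel_integral_eq_integral(2)[OF set_integral_add(1)[OF i]] by simp
  then have "(LINT t:{-R..R}|lborel. f' t * \<phi> t) + (LINT t:{-R..R}|lborel. f t * deriv \<phi> t) = 0"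
    using set_integral_add(2)[OF i] by simp
  moreover have "(LINT t|lborel. f' t * \<phi> t) = (LINT t:{-R..R}|lborel. f' t * \<phi> t)"
    by (rule LINT_eq_set_LINT) (use R in force)
  moreover have "(LINT t|lborel. f t * deriv \<phi> t) = (LINT t:{-R..R}|lborel. f t * deriv \<phi> t)"
    by (rule LINT_eq_set_LINT) (use R in force)
  ultimately show "(LINT t|lborel. f t * deriv \<phi> t) = - (LINT t|lborel. f' t * \<phi> t)"
    by simp
qed

text \<open>The positive and the negative part of \<open>h\<close> are densities of measures that agree on half-lines, hence
everywhere.\<close>

lemma AE_eq_0_of_interval_integrals:
  fixes h :: "real \<Rightarrow> real"
  assumes h: "integrable lborel h" and zero: "\<And>x. (LINT t:{x<..}|lborel. h t) = 0"
  shows "AE t in lborel. h t = 0"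
proof -
  have [measurable]: "h \<in> borel_measurable lborel"
    using h by (rule borel_measurable_integrable)
  let ?M = "\<lambda>h. density lborel (\<lambda>t. ennreal (h t))"
  have em: "emeasure (?M (\<lambda>t. max 0 (f t))) {x<..} = ennreal (LINT t:{x<..}|lborel. max 0 (f t))"
    if f: "integrable lborel f" for x and f :: "real \<Rightarrow> real"
  proof -
    have [measurable]: "f \<in> borel_measurable lborel"
      using f by (rule borel_measurable_integrable)
    have "emeasure (?M (\<lambda>t. max 0 (f t))) {x<..} = (\<integral>\<^sup>+t. ennreal (max 0 (f t)) * indicator {x<..} t \<partial>lborel)"
      by (subst emeasure_density) auto
    also have "\<dots> = (\<integral>\<^sup>+t. ennreal (indicator {x<..} t *\<^sub>R max 0 (f t)) \<partial>lborel)"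
      by (intro nn_integral_cong) (auto simp: indicator_def)
    also have "\<dots> = ennreal (LINT t:{x<..}|lborel. max 0 (f t))"
      unfolding set_lebesgue_integral_def
      by (intro nn_integral_eq_integral integrable_mult_indicator integrable_max f) auto
    finally show ?thesis .
  qed
  have "?M (\<lambda>t. max 0 (h t)) = ?M (\<lambda>t. max 0 (- h t))"
  proof (rule measure_eqI_lessThan)
    show "emeasure (?M (\<lambda>t. max 0 (h t))) {x<..} < \<infinity>" for x
      by (simp add: em[OF h])
    have int: "set_integrable lborel {x<..} (\<lambda>t. max 0 (h t))" "set_integrable lborel {x<..} (\<lambda>t. max 0 (- h t))" for x
      unfolding set_integrable_def using h
      by (intro integrable_mult_indicator integrable_max; simp)+
    have pm: "(\<lambda>t. max 0 (h t) - max 0 (- h t)) = h" by (auto simp: max_def)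
    have split: "(LINT t:{x<..}|lborel. max 0 (h t)) - (LINT t:{x<..}|lborel. max 0 (- h t)) =
        (LINT t:{x<..}|lborel. h t)" for x
      using set_integral_diff(2)[OF int[of x]] unfolding pm by simp
    show "emeasure (?M (\<lambda>t. max 0 (h t))) {x<..} = emeasure (?M (\<lambda>t. max 0 (- h t))) {x<..}" for x
      using zero[of x] split[of x] by (simp add: em[OF h] em[OF integrable_minus[OF h]])
  qed auto
  then have "AE t in lborel. ennreal (max 0 (h t)) = ennreal (max 0 (- h t))"
    by (intro sigma_finite_measure.density_unique[OF sigma_finite_lborel]) auto
  then show ?thesis
    by eventually_elim (auto simp: max_def split: if_splits)
qed

text \<open>By dominated convergence along the bumps, \<open>h\<close> has integral zero over every bounded interval.\<close>

theorem fundamental_lemma_calculus_of_variations: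
  assumes h: "loc_integrable h"
    and zero: "\<And>\<phi>. test_function \<phi> \<Longrightarrow> (LINT t|lborel. h t * \<phi> t) = 0"
  shows "AE t in lborel. h t = 0"
proof -
  have ivl: "(LINT t:{a<..<b}|lborel. h t) = 0" if "a < b" for a b
  proof -
    have int: "integrable lborel (\<lambda>t. indicator {a..b} t *\<^sub>R h t)"
      using h by (simp add: loc_integrable_def set_integrable_def)
    have "set_integrable lborel {a<..<b} h"
      using h by (auto simp: loc_integrable_def intro: set_integrable_subset[of _ "{a..b}"])
    then have meas: "(\<lambda>t. indicator {a<..<b} t *\<^sub>R h t) \<in> borel_measurable lborel"
      unfolding set_integrable_def by (rule borel_measurable_integrable)
    have "(\<lambda>n. LINT t|lborel. h t * bump a b (Suc n) t) \<longlonglongrightarrow> (LINT t|lborel. indicator {a<..<b} t *\<^sub>R h t)"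
    proof (rule integral_dominated_convergence)
      show "integrable lborel (\<lambda>t. norm (indicator {a..b} t *\<^sub>R h t))"
        using int by (rule integrable_norm)
      show "(\<lambda>t. h t * bump a b (Suc n) t) \<in> borel_measurable lborel" for n
        by (intro borel_measurable_integrable integrable_mult_test_function h test_function_bump that)
      show "AE t in lborel. (\<lambda>n. h t * bump a b (Suc n) t) \<longlonglongrightarrow> indicator {a<..<b} t *\<^sub>R h t"
      proof (intro AE_I2)
        fix t show "(\<lambda>n. h t * bump a b (Suc n) t) \<longlonglongrightarrow> indicator {a<..<b} t *\<^sub>R h t"
        proof (cases "t \<in> {a<..<b}")
          case True
          then show ?thesis
            using tendsto_mult_left[OF bump_tendsto_1[OF True], of "h t"] by simp
        next
          case False
          then show ?thesis using bump_eq_0[OF False that] by simp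
        qed
      qed
      show "AE t in lborel. norm (h t * bump a b (Suc n) t) \<le> norm (indicator {a..b} t *\<^sub>R h t)" for n
      proof (intro AE_I2)
        fix t show "norm (h t * bump a b (Suc n) t) \<le> norm (indicator {a..b} t *\<^sub>R h t)"
        proof (cases "t \<in> {a<..<b}")
          case True
          then show ?thesis
            using bump_bounds[of a b "Suc n" t] by (simp add: abs_mult mult_left_le)
        next
          case False
          then show ?thesis using bump_eq_0[OF False that] by simp
        qed
      qed
    qed (rule meas)
    moreover have "(LINT t|lborel. h t * bump a b (Suc n) t) = 0" for n
      by (intro zero test_function_bump that)
    ultimately show ?thesis
      unfolding set_lebesgue_integral_def by (simp add: LIMSEQ_const_iff del: real_scaleR_def)
  qed
  have "AE t in lborel. indicator {-real N<..<real N} t *\<^sub>R h t = 0" for N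
  proof (rule AE_eq_0_of_interval_integrals)
    have "set_integrable lborel {-real N<..<real N} h"
      using h by (auto simp: loc_integrable_def intro: set_integrable_subset[of _ "{-real N..real N}"])
    then show "integrable lborel (\<lambda>t. indicator {-real N<..<real N} t *\<^sub>R h t)"
      by (simp add: set_integrable_def)
    show "(LINT t:{x<..}|lborel. indicator {-real N<..<real N} t *\<^sub>R h t) = 0" for x
    proof -
      have "(LINT t:{x<..}|lborel. indicator {-real N<..<real N} t *\<^sub>R h t) =
          (LINT t:{max x (-real N)<..<real N}|lborel. h t)"
        unfolding set_lebesgue_integral_def
        by (intro Bochner_Integration.integral_cong) (auto simp: indicator_def)
      also have "\<dots> = 0"
        using ivl[of "max x (-real N)" "real N"]
        by (cases "max x (-real N) < real N") (auto simp: set_lebesgue_integral_def)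
      finally show ?thesis .
    qed
  qed
  then have "AE t in lborel. \<forall>N. indicator {-real N<..<real N} t *\<^sub>R h t = 0"
    by (subst AE_all_countable) blast
  then show ?thesis
  proof eventually_elim
    case (elim t)
    obtain N where "\<bar>t\<bar> < real N" using reals_Archimedean2 by blast
    then show ?case using elim[rule_format, of N] by (auto simp: indicator_def split: if_splits)
  qed
qed

lemma weak_deriv_unique:
  assumes "weak_deriv f g1" "weak_deriv f g2"
  shows "AE t in lborel. g1 t = g2 t"
proof -
  have l: "loc_integrable g1" "loc_integrable g2"
    using assms by (auto simp: weak_deriv_def)
  have "AE t in lborel. g1 t - g2 t = 0"
  proof (rule fundamental_lemma_calculus_of_variations)
    show "loc_integrable (\<lambda>t. g1 t - g2 t)"
      using l by (rule loc_integrable_diff)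
    fix \<phi> assume \<phi>: "test_function \<phi>"
    have "(LINT t|lborel. (g1 t - g2 t) * \<phi> t) = (LINT t|lborel. g1 t * \<phi> t - g2 t * \<phi> t)"
      by (simp add: left_diff_distrib)
    also have "\<dots> = (LINT t|lborel. g1 t * \<phi> t) - (LINT t|lborel. g2 t * \<phi> t)"
      by (intro Bochner_Integration.integral_diff integrable_mult_test_function l \<phi>)
    also have "\<dots> = 0"
      using assms \<phi> by (auto simp: weak_deriv_def)
    finally show "(LINT t|lborel. (g1 t - g2 t) * \<phi> t) = 0" .
  qed
  then show ?thesis by simp
qed

section \<open>Peaks and the energy\<close>

lemma bounded_on_compact_of_locally_bounded:
  fixes f :: "real \<Rightarrow> real"
  assumes "compact K" and loc: "\<And>x. x \<in> K \<Longrightarrow> \<exists>M. eventually (\<lambda>y. \<bar>f y\<bar> \<le> M) (nhds x)"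
  shows "\<exists>M. \<forall>x\<in>K. \<bar>f x\<bar> \<le> M"
proof -
  have "\<forall>x\<in>K. \<exists>U. \<exists>M. open U \<and> x \<in> U \<and> (\<forall>y\<in>U. \<bar>f y\<bar> \<le> M)"
    using loc unfolding eventually_nhds by meson
  then obtain U where "\<forall>x\<in>K. \<exists>M. open (U x) \<and> x \<in> U x \<and> (\<forall>y\<in>U x. \<bar>f y\<bar> \<le> M)"
    by (rule bchoice[THEN exE])
  then obtain M where UM: "\<forall>x\<in>K. open (U x) \<and> x \<in> U x \<and> (\<forall>y\<in>U x. \<bar>f y\<bar> \<le> M x)"
    by (rule bchoice[THEN exE])
  obtain C where C: "C \<subseteq> K" "finite C" "K \<subseteq> (\<Union>c\<in>C. U c)"
    using compactE_image[OF assms(1), of K U] UM by blast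
  have "\<bar>f x\<bar> \<le> (\<Sum>c\<in>C. \<bar>M c\<bar>)" if "x \<in> K" for x
  proof -
    obtain c where c: "c \<in> C" "x \<in> U c" using C(3) \<open>x \<in> K\<close> by blast
    then have "\<bar>f x\<bar> \<le> M c" using UM C(1) by blast
    also have "\<dots> \<le> \<bar>M c\<bar>" by simp
    also have "\<dots> \<le> (\<Sum>c\<in>C. \<bar>M c\<bar>)"
      using member_le_sum[of c C "\<lambda>c. \<bar>M c\<bar>"] c(1) C(2) by simp
    finally show ?thesis .
  qed
  then show ?thesis by blast
qed

lemma eventually_nhds_split_right_left:
  fixes x :: real
  assumes "eventually P (at_right x)" "eventually P (at_left x)" "P x"
  shows "eventually P (nhds x)"
  using assms by (simp add: eventually_at_split eventually_nhds_conv_at)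

lemma loc_integrable_imp_borel_measurable:
  assumes "loc_integrable f"
  shows "f \<in> borel_measurable borel"
proof (rule borel_measurable_LIMSEQ_real)
  show "(\<lambda>t. indicator {-real n..real n} t *\<^sub>R f t) \<in> borel_measurable borel" for n
    using assms borel_measurable_integrable[of lborel "\<lambda>t. indicator {-real n..real n} t *\<^sub>R f t"]
    by (simp add: loc_integrable_def set_integrable_def)
  fix t :: real
  obtain N where N: "\<bar>t\<bar> < real N" using reals_Archimedean2 by blast
  have "eventually (\<lambda>n. indicator {-real n..real n} t *\<^sub>R f t = f t) sequentially"
    using eventually_ge_at_top[of N] 
  proof eventually_elim
    case (elim n)
    then have "\<bar>t\<bar> \<le> real n" using N by linarith
    then have "t \<in> {-real n..real n}" by auto
    then show ?case by simp
  qed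
  then show "(\<lambda>n. indicator {-real n..real n} t *\<^sub>R f t) \<longlonglongrightarrow> f t"
    by (rule tendsto_eventually)
qed

lemma loc_integrable_mult_continuous:
  "loc_integrable f \<Longrightarrow> continuous_on UNIV \<phi> \<Longrightarrow> loc_integrable (\<lambda>t. f t * \<phi> t)"
  by (simp add: loc_integrable_def set_integrable_mult_continuous[unfolded loc_integrable_def])

lemma real_analytic_UNIV_continuous:
  assumes "real_analytic_on f UNIV"
  shows "isCont f x" "continuous_on A f"
proof -
  show *: "isCont f x" for x
    using real_analytic_on_DERIV[OF assms, of x] by (simp add: DERIV_isCont)
  show "continuous_on A f"
    by (intro continuous_at_imp_continuous_on ballI *)
qed

context
  fixes u :: "real \<Rightarrow> real" and S :: "real set"
  assumes peaks: "peak_set u S"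
begin

lemma peak_limits:
  assumes "s \<in> S"
  obtains l where "l \<noteq> 0" "(deriv u \<longlongrightarrow> l) (at_right s)" "(deriv u \<longlongrightarrow> - l) (at_left s)"
  using peaks assms unfolding peak_set_def by blast

lemma peak_not_isCont_deriv:
  assumes "s \<in> S"
  shows "\<not> isCont (deriv u) s"
proof
  obtain l where l: "l \<noteq> 0" "(deriv u \<longlongrightarrow> l) (at_right s)" "(deriv u \<longlongrightarrow> - l) (at_left s)"
    using peak_limits[OF assms] .
  assume "isCont (deriv u) s"
  then have "(deriv u \<longlongrightarrow> deriv u s) (at_right s)" "(deriv u \<longlongrightarrow> deriv u s) (at_left s)"
    by (simp_all add: isCont_def filterlim_at_split)
  then have "deriv u s = l" "deriv u s = - l"
    using l tendsto_unique trivial_limit_at_right_real trivial_limit_at_left_real by metis+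
  then show False using l(1) by simp
qed

text \<open>A neighbourhood on which \<open>u\<close> is smooth contains no peak, as \<open>u'\<close> is continuous there. In particular the
peaks form a closed set.\<close>

lemma smooth_off_peaks:
  assumes "t \<notin> S"
  obtains U where "open U" "t \<in> U" "U \<inter> S = {}" "\<And>k y. y \<in> U \<Longrightarrow> (deriv ^^ k) u differentiable (at y)"
proof -
  have "smooth_on u (- S)" using peaks by (simp add: peak_set_def)
  then obtain U where U: "open U" "t \<in> U" "\<And>k y. y \<in> U \<Longrightarrow> (deriv ^^ k) u differentiable (at y)"
    using assms unfolding smooth_on_def by (metis ComplI)
  have "isCont (deriv u) y" if "y \<in> U" for y
    using U(3)[OF that, of 1] by (simp add: differentiable_imp_continuous_within)
  then have "U \<inter> S = {}"
    using peak_not_isCont_deriv by blast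
  with U that show thesis by blast
qed

lemma closed_peaks: "closed S"
proof -
  have "open (- S)"
    by (subst open_subopen) (metis ComplD ComplI disjoint_eq_subset_Compl smooth_off_peaks)
  then show ?thesis by (simp add: closed_def)
qed

lemma eventually_off_peaks:
  assumes "t \<notin> S"
  shows "eventually (\<lambda>r. r \<notin> S) (nhds t)"
  using eventually_nhds_in_open[of "- S" t] closed_peaks assms by (simp add: closed_def)

lemma higher_deriv_off_peaks:
  assumes "t \<notin> S"
  shows "(u has_real_derivative deriv u t) (at t)"
    "(deriv u has_real_derivative deriv (deriv u) t) (at t)"
    "isCont (deriv u) t" "isCont (deriv (deriv u)) t"
proof -
  obtain U where U: "t \<in> U" "\<And>k y. y \<in> U \<Longrightarrow> (deriv ^^ k) u differentiable (at y)"
    using smooth_off_peaks[OF assms] by metis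
  show "(u has_real_derivative deriv u t) (at t)"
    using U(2)[OF U(1), of 0] by (simp add: DERIV_deriv_iff_real_differentiable)
  show "(deriv u has_real_derivative deriv (deriv u) t) (at t)" "isCont (deriv u) t"
    using U(2)[OF U(1), of 1]
    by (simp_all add: DERIV_deriv_iff_real_differentiable differentiable_imp_continuous_within)
  show "isCont (deriv (deriv u)) t"
    using U(2)[OF U(1), of 2] by (simp add: numeral_2_eq_2 differentiable_imp_continuous_within)
qed

text \<open>Next to a peak \<open>u'\<close> keeps the sign of its one-sided limit, while a second peak would give it
  both signs.\<close>

lemma peak_punctured_nbhd:
  assumes "s \<in> S"
  obtains d where "d > 0" "\<And>t. t \<in> {s-d..s+d} \<Longrightarrow> t \<noteq> s \<Longrightarrow> t \<notin> S \<and> deriv u t \<noteq> 0"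
proof -
  obtain l where l: "l \<noteq> 0" "(deriv u \<longlongrightarrow> l) (at_right s)" "(deriv u \<longlongrightarrow> - l) (at_left s)"
    using peak_limits[OF assms] .
  have nz: "0 < l * l" using l(1) by (auto simp: zero_less_mult_iff)
  have "((\<lambda>t. l * deriv u t) \<longlongrightarrow> l * l) (at_right s)" "((\<lambda>t. - l * deriv u t) \<longlongrightarrow> - l * - l) (at_left s)"
    by (intro tendsto_mult_left l)+
  then have "eventually (\<lambda>t. 0 < l * deriv u t) (at_right s)" "eventually (\<lambda>t. 0 < - l * deriv u t) (at_left s)"
    using nz by (auto dest!: order_tendstoD(1)[where a = 0])
  then obtain b c where b: "b > s" "\<And>t. s < t \<Longrightarrow> t < b \<Longrightarrow> 0 < l * deriv u t"
    and c: "c < s" "\<And>t. c < t \<Longrightarrow> t < s \<Longrightarrow> 0 < - l * deriv u t"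
    unfolding eventually_at_right_field eventually_at_left_field by metis
  have no_peak: "t \<notin> S" if ev: "eventually (\<lambda>r. 0 < k * deriv u r) (at t)" for t k
  proof
    assume "t \<in> S"
    then obtain l' where l': "l' \<noteq> 0" "(deriv u \<longlongrightarrow> l') (at_right t)" "(deriv u \<longlongrightarrow> - l') (at_left t)"
      using peak_limits by metis
    have e: "eventually (\<lambda>r. 0 \<le> k * deriv u r) (at_right t)" "eventually (\<lambda>r. 0 \<le> k * deriv u r) (at_left t)"
      using ev unfolding eventually_at_split by (auto elim!: eventually_mono)
    have "0 \<le> k * l'"
      by (rule tendsto_lowerbound[OF tendsto_mult_left[OF l'(2)] e(1)]) simp
    moreover have "0 \<le> k * - l'"
      by (rule tendsto_lowerbound[OF tendsto_mult_left[OF l'(3)] e(2)]) simp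
    ultimately have "k * l' = 0" by simp
    then have "k = 0" using l'(1) by simp
    then have "eventually (\<lambda>r. False) (at t)" using ev by simp
    then show False by simp
  qed
  define d where "d = min (b - s) (s - c) / 2"
  have d: "d > 0" "s + d < b" "c < s - d"
    using b(1) c(1) by (auto simp: d_def field_simps min_def)
  show thesis
  proof
    show "d > 0" by fact
    fix t assume t: "t \<in> {s-d..s+d}" "t \<noteq> s"
    show "t \<notin> S \<and> deriv u t \<noteq> 0"
    proof (cases "s < t")
      case True
      then have tb: "t \<in> {s<..<b}" using t d by auto
      have "eventually (\<lambda>r. r \<in> {s<..<b}) (nhds t)"
        using tb by (intro eventually_nhds_in_open) auto
      then have "eventually (\<lambda>r. 0 < l * deriv u r) (at t)"
        by (intro eventually_nhds_conv_at[THEN iffD1, THEN conjunct1]) (auto elim!: eventually_mono dest: b(2))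
      then show ?thesis using no_peak[of l] b(2)[of t] tb by fastforce
    next
      case False
      then have tc: "t \<in> {c<..<s}" using t d by auto
      have "eventually (\<lambda>r. r \<in> {c<..<s}) (nhds t)"
        using tc by (intro eventually_nhds_in_open) auto
      then have "eventually (\<lambda>r. 0 < - l * deriv u r) (at t)"
        by (intro eventually_nhds_conv_at[THEN iffD1, THEN conjunct1]) (auto elim!: eventually_mono dest: c(2))
      then show ?thesis using no_peak[of "- l"] c(2)[of t] tc by fastforce
    qed
  qed
qed

lemma finite_peaks_Icc: "finite (S \<inter> {a..b})"
proof -
  have "\<not> t islimpt S" for t
  proof (cases "t \<in> S")
    case True
    then obtain d where d: "d > 0" "\<And>r. r \<in> {t-d..t+d} \<Longrightarrow> r \<noteq> t \<Longrightarrow> r \<notin> S"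
      using peak_punctured_nbhd[of t] by metis
    show ?thesis
      unfolding islimpt_approachable
    proof
      assume "\<forall>e>0. \<exists>x'\<in>S. x' \<noteq> t \<and> dist x' t < e"
      then obtain r where "r \<in> S" "r \<noteq> t" "dist r t < d" using d(1) by blast
      then show False using d(2)[of r] by (auto simp: dist_real_def abs_less_iff)
    qed
  next
    case False
    then show ?thesis using closed_peaks closed_limpt by blast
  qed
  then have "finite ({a..b} \<inter> S)"
    by (intro finite_not_islimpt_in_compact) auto
  then show ?thesis by (simp add: Int_commute)
qed

lemma deriv_locally_bounded: "\<exists>M. \<forall>t\<in>{a..b}. \<bar>deriv u t\<bar> \<le> M"
proof (rule bounded_on_compact_of_locally_bounded)
  fix t :: real
  show "\<exists>M. eventually (\<lambda>r. \<bar>deriv u r\<bar> \<le> M) (nhds t)"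
  proof (cases "t \<in> S")
    case True
    obtain l where l: "(deriv u \<longlongrightarrow> l) (at_right t)" "(deriv u \<longlongrightarrow> - l) (at_left t)"
      using peak_limits[OF True] by metis
    let ?M = "max (\<bar>l\<bar> + 1) \<bar>deriv u t\<bar>"
    have "eventually (\<lambda>r. \<bar>deriv u r\<bar> < \<bar>l\<bar> + 1) (at_right t)" "eventually (\<lambda>r. \<bar>deriv u r\<bar> < \<bar>l\<bar> + 1) (at_left t)"
      using order_tendstoD(2)[OF tendsto_rabs[OF l(1)], of "\<bar>l\<bar> + 1"]
        order_tendstoD(2)[OF tendsto_rabs[OF l(2)], of "\<bar>l\<bar> + 1"] by auto
    then have "eventually (\<lambda>r. \<bar>deriv u r\<bar> \<le> ?M) (nhds t)"
      by (intro eventually_nhds_split_right_left) (auto elim!: eventually_mono)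
    then show ?thesis by blast
  next
    case False
    have "((\<lambda>r. \<bar>deriv u r\<bar>) \<longlongrightarrow> \<bar>deriv u t\<bar>) (nhds t)"
      using higher_deriv_off_peaks(3)[OF False]
      by (intro tendsto_rabs) (simp add: isCont_def tendsto_at_iff_tendsto_nhds)
    then have "eventually (\<lambda>r. \<bar>deriv u r\<bar> < \<bar>deriv u t\<bar> + 1) (nhds t)"
      by (rule order_tendstoD) simp
    then show ?thesis by (intro exI[of _ "\<bar>deriv u t\<bar> + 1"]) (auto elim!: eventually_mono)
  qed
qed simp

lemma deriv_borel_measurable: "deriv u \<in> borel_measurable borel"
proof (rule borel_measurable_continuous_countable_exceptions)
  show "countable S" using peaks by (simp add: peak_set_def)
  show "continuous_on (- S) (deriv u)"
    by (intro continuous_at_imp_continuous_on) (auto intro: higher_deriv_off_peaks(3))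
qed

lemma loc_integrable_deriv: "loc_integrable (deriv u)"
  using deriv_borel_measurable deriv_locally_bounded by (rule loc_integrable_bounded)

lemma loc_integrable_deriv_square: "loc_integrable (\<lambda>t. (deriv u t)\<^sup>2)"
proof (rule loc_integrable_bounded)
  show "(\<lambda>t. (deriv u t)\<^sup>2) \<in> borel_measurable borel"
    using deriv_borel_measurable by measurable
  fix a b
  obtain M where "\<And>t. t \<in> {a..b} \<Longrightarrow> \<bar>deriv u t\<bar> \<le> M" using deriv_locally_bounded by blast
  then have "\<bar>(deriv u t)\<^sup>2\<bar> \<le> M\<^sup>2" if "t \<in> {a..b}" for t
    using that power_mono[of "\<bar>deriv u t\<bar>" M 2] by simp
  then show "\<exists>M. \<forall>t\<in>{a..b}. \<bar>(deriv u t)\<^sup>2\<bar> \<le> M" by blast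
qed

text \<open>The exceptional set in the definition of a singular wave need not be the set of peaks, but its
complement is dense, and the energy is continuous off the peaks.\<close>

lemma energy_off_peaks:
  assumes "real_analytic_on F UNIV" "singular_tws F u"
  obtains h where "\<And>t. t \<notin> S \<Longrightarrow> energy F u t = h"
proof -
  obtain h S' where S': "countable S'" and h: "\<And>t. t \<notin> S' \<Longrightarrow> energy F u t = h"
    using assms(2) unfolding singular_tws_def strong_singular_tws_def weak_singular_tws_def
      weak_singular_tws_off_def classical_energy_solution_def
    by (metis ComplI UNIV_I countable_empty empty_iff)
  show thesis
  proof
    fix t assume t: "t \<notin> S"
    have uc: "isCont u t" using higher_deriv_off_peaks(1)[OF t] by (rule DERIV_isCont)
    have "isCont (\<lambda>t. F (u t)) t"
      by (rule isCont_o2[OF uc real_analytic_UNIV_continuous(1)[OF assms(1)]])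
    then have "isCont (energy F u) t"
      using uc higher_deriv_off_peaks(3)[OF t] unfolding energy_def by (intro continuous_intros) auto
    then have lim: "(energy F u \<longlongrightarrow> energy F u t) (nhds t)"
      by (simp add: isCont_def tendsto_at_iff_tendsto_nhds)
    show "energy F u t = h"
    proof (rule ccontr)
      assume "energy F u t \<noteq> h"
      then have "eventually (\<lambda>r. energy F u r \<noteq> h) (nhds t)"
        using lim by (metis tendsto_imp_eventually_ne)
      then obtain U where U: "open U" "t \<in> U" "\<And>r. r \<in> U \<Longrightarrow> energy F u r \<noteq> h"
        unfolding eventually_nhds by blast
      then obtain r where "r \<in> U" "r \<notin> S'"
        using open_minus_countable[OF S', of U] by blast
      then show False using h U(3) by blast
    qed
  qed
qed

end

lemma weak_deriv_of_peaked:
  assumes peaks: "peak_set u S" and cont: "continuous_on UNIV u"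
  shows "weak_deriv u (deriv u)" "weak_deriv (\<lambda>t. (u t)\<^sup>2) (\<lambda>t. 2 * u t * deriv u t)"
    "loc_integrable (\<lambda>t. 2 * u t * deriv u t)"
proof -
  note du = higher_deriv_off_peaks(1)[OF peaks]
  show "weak_deriv u (deriv u)"
    using cont finite_peaks_Icc[OF peaks] du loc_integrable_deriv[OF peaks]
    by (rule weak_deriv_piecewise)
  show int2: "loc_integrable (\<lambda>t. 2 * u t * deriv u t)"
    using loc_integrable_mult_continuous[OF loc_integrable_deriv[OF peaks] continuous_on_mult_left[OF cont, of 2]]
    by (simp add: mult_ac)
  show "weak_deriv (\<lambda>t. (u t)\<^sup>2) (\<lambda>t. 2 * u t * deriv u t)"
  proof (rule weak_deriv_piecewise[OF _ finite_peaks_Icc[OF peaks] _ int2])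
    show "continuous_on UNIV (\<lambda>t. (u t)\<^sup>2)"
      using cont by (intro continuous_intros)
    show "((\<lambda>t. (u t)\<^sup>2) has_real_derivative 2 * u t * deriv u t) (at t)" if "t \<notin> S" for t
      by (auto intro!: derivative_eq_intros du[OF that])
  qed
qed

lemma loc_integrable_flux_deriv:
  assumes peaks: "peak_set u S" and cont: "continuous_on UNIV u" and F: "real_analytic_on F UNIV"
  shows "loc_integrable (\<lambda>t. (deriv u t)\<^sup>2 - 2 * deriv F (u t))"
proof -
  have "isCont u t" for t using cont by (simp add: continuous_on_eq_continuous_at)
  then have "continuous_on UNIV (\<lambda>t. 2 * deriv F (u t))"
    by (intro continuous_on_mult_left continuous_at_imp_continuous_on ballI
        isCont_o2[OF _ real_analytic_UNIV_continuous(1)[OF real_analytic_on_deriv[OF F]]])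
  then show ?thesis
    by (intro loc_integrable_diff loc_integrable_deriv_square[OF peaks] loc_integrable_continuous)
qed

text \<open>The weak derivatives in the definition of \<open>tws\<close> may be replaced by the classical ones, with which
  they agree almost everywhere by uniqueness.\<close>

lemma tws_classical_weak_form:
  assumes peaks: "peak_set u S" and F: "real_analytic_on F UNIV" and tws: "tws F u" and \<phi>: "test_function \<phi>"
  shows "(LINT t|lborel. 2 * u t * deriv u t * deriv \<phi> t + (deriv u t)\<^sup>2 * \<phi> t
      - 2 * deriv F (u t) * \<phi> t) = 0"
proof -
  have cont: "continuous_on UNIV u"
    using tws by (simp add: tws_def H1_loc_def)
  obtain v w where v: "weak_deriv u v" and w: "weak_deriv (\<lambda>t. (u t)\<^sup>2) w" and
    eq: "(LINT t|lborel. w t * deriv \<phi> t + (v t)\<^sup>2 * \<phi> t - 2 * deriv F (u t) * \<phi> t) = 0"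
    using tws \<phi> unfolding tws_def by blast
  have AEv: "AE t in lborel. v t = deriv u t"
    by (rule weak_deriv_unique[OF v weak_deriv_of_peaked(1)[OF peaks cont]])
  have AEw: "AE t in lborel. w t = 2 * u t * deriv u t"
    by (rule weak_deriv_unique[OF w weak_deriv_of_peaked(2)[OF peaks cont]])
  have [measurable]: "v \<in> borel_measurable borel" "w \<in> borel_measurable borel" "deriv u \<in> borel_measurable borel"
    using v w loc_integrable_imp_borel_measurable deriv_borel_measurable[OF peaks]
    by (auto simp: weak_deriv_def)
  have [measurable]: "u \<in> borel_measurable borel"
    using cont by (rule borel_measurable_continuous_onI)
  have [measurable]: "deriv F \<in> borel_measurable borel"
    using real_analytic_UNIV_continuous(2)[OF real_analytic_on_deriv[OF F]] by (rule borel_measurable_continuous_onI)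
  have [measurable]: "\<phi> \<in> borel_measurable borel" "deriv \<phi> \<in> borel_measurable borel"
    using test_function_continuous[OF \<phi>] borel_measurable_continuous_onI by blast+
  have "(LINT t|lborel. w t * deriv \<phi> t + (v t)\<^sup>2 * \<phi> t - 2 * deriv F (u t) * \<phi> t) =
     (LINT t|lborel. 2 * u t * deriv u t * deriv \<phi> t + (deriv u t)\<^sup>2 * \<phi> t - 2 * deriv F (u t) * \<phi> t)"
  proof (rule integral_cong_AE)
    show "AE t in lborel. w t * deriv \<phi> t + (v t)\<^sup>2 * \<phi> t - 2 * deriv F (u t) * \<phi> t =
       2 * u t * deriv u t * deriv \<phi> t + (deriv u t)\<^sup>2 * \<phi> t - 2 * deriv F (u t) * \<phi> t"
      using AEv AEw by eventually_elim simp
  qed measurable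
  with eq show ?thesis by simp
qed

lemma FTC_one_sided_limits:
  fixes f g :: "real \<Rightarrow> real"
  assumes "a < b" and der: "\<And>t. t \<in> {a<..<b} \<Longrightarrow> (g has_real_derivative f t) (at t)"
    and lim: "(g \<longlongrightarrow> A) (at_right a)" "(g \<longlongrightarrow> B) (at_left b)"
  shows "(f has_integral B - A) {a..b}"
proof -
  define Z where "Z t = (if t = a then A else if t = b then B else g t)" for t
  have near: "eventually (\<lambda>r. g r = Z r) (nhds t)" if t: "t \<in> {a<..<b}" for t
  proof -
    have "eventually (\<lambda>r. r \<in> {a<..<b}) (nhds t)"
      using t by (intro eventually_nhds_in_open) auto
    then show ?thesis by eventually_elim (auto simp: Z_def)
  qed
  have "eventually (\<lambda>r. g r = Z r) (at_right a)"
    using eventually_at_right_real[OF \<open>a < b\<close>] by eventually_elim (auto simp: Z_def)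
  then have a: "(Z \<longlongrightarrow> Z a) (at_right a)"
    using lim(1) by (simp add: Z_def[of a] Lim_transform_eventually)
  have "eventually (\<lambda>r. g r = Z r) (at_left b)"
    using eventually_at_left_real[OF \<open>a < b\<close>] by eventually_elim (auto simp: Z_def)
  then have b: "(Z \<longlongrightarrow> Z b) (at_left b)"
    using lim(2) \<open>a < b\<close> by (simp add: Z_def[of b] Lim_transform_eventually)
  have dZ: "(Z has_real_derivative f t) (at t)" if "t \<in> {a<..<b}" for t
    using der[OF that] near[OF that] by (rule DERIV_transform_ev)
  have cZ: "(Z \<longlongrightarrow> Z t) (at t)" if "t \<in> {a<..<b}" for t
    using DERIV_isCont[OF dZ[OF that]] by (simp add: isCont_def)
  have "(f has_integral Z b - Z a) {a..b}"
  proof (rule fundamental_theorem_of_calculus_interior)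
    show "continuous_on {a..b} Z"
      using a b cZ \<open>a < b\<close> by (intro continuous_on_IccI) auto
  qed (use dZ \<open>a < b\<close> in \<open>auto simp: has_real_derivative_iff_has_vector_derivative\<close>)
  then show ?thesis using \<open>a < b\<close> by (simp add: Z_def)
qed

text \<open>At energy level \<open>F 0\<close> the energy equation is \<open>u'\<^sup>2 = 2 (F 0 - F u) / u\<close>. Writing the right-hand side as a
slope of \<open>F\<close> makes it analytic at \<open>u = 0\<close>, where the peaks are.\<close>

definition speed_sq :: "(real \<Rightarrow> real) \<Rightarrow> real \<Rightarrow> real" where
  "speed_sq F x = - 2 * slope_from F 0 x"

lemma speed_sq_eq: "x \<noteq> 0 \<Longrightarrow> x * speed_sq F x / 2 + F x = F 0"
  by (simp add: speed_sq_def slope_from_def field_simps)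

lemma speed_sq_0: "speed_sq F 0 = - 2 * deriv F 0"
  by (simp add: speed_sq_def slope_from_def)

lemma speed_sq_analytic: "real_analytic_on F UNIV \<Longrightarrow> real_analytic_on (speed_sq F) UNIV"
  unfolding speed_sq_def[abs_def] by (intro real_analytic_on_cmult real_analytic_on_slope_from) auto

text \<open>Differentiating the energy and dividing by \<open>u'\<close> gives the equation in divergence form.\<close>

lemma flux_DERIV:
  assumes F: "real_analytic_on F UNIV"
    and D: "(u has_real_derivative deriv u t) (at t)" "(deriv u has_real_derivative deriv (deriv u) t) (at t)"
    and nz: "deriv u t \<noteq> 0" and en: "eventually (\<lambda>r. energy F u r = h) (nhds t)"
  shows "((\<lambda>t. 2 * u t * deriv u t) has_real_derivative (deriv u t)\<^sup>2 - 2 * deriv F (u t)) (at t)"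
proof -
  have DF: "((\<lambda>t. F (u t)) has_real_derivative deriv F (u t) * deriv u t) (at t)"
    by (rule DERIV_chain2[OF real_analytic_on_DERIV[OF F UNIV_I] D(1)])
  have "(energy F u has_real_derivative
      (deriv u t * (deriv u t)\<^sup>2 + u t * (2 * deriv u t * deriv (deriv u) t)) / 2 + deriv F (u t) * deriv u t) (at t)"
    unfolding energy_def by (auto intro!: derivative_eq_intros D DF simp: power2_eq_square algebra_simps)
  moreover have "(energy F u has_real_derivative 0) (at t)"
  proof (rule DERIV_transform_ev[where f = "\<lambda>_. h"])
    show "eventually (\<lambda>r. h = energy F u r) (nhds t)"
      using en by eventually_elim simp
  qed simp
  ultimately have "(deriv u t * (deriv u t)\<^sup>2 + u t * (2 * deriv u t * deriv (deriv u) t)) / 2 + deriv F (u t) * deriv u t = 0"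
    by (rule DERIV_unique)
  then have "deriv u t * ((deriv u t)\<^sup>2 + 2 * u t * deriv (deriv u) t + 2 * deriv F (u t)) = 0"
    by (simp add: field_simps power2_eq_square)
  then have e: "2 * (deriv u t)\<^sup>2 + 2 * u t * deriv (deriv u) t = (deriv u t)\<^sup>2 - 2 * deriv F (u t)"
    using nz by simp
  have "((\<lambda>t. 2 * u t * deriv u t) has_real_derivative 2 * (deriv u t)\<^sup>2 + 2 * u t * deriv (deriv u) t) (at t)"
    by (auto intro!: derivative_eq_intros D simp: power2_eq_square algebra_simps)
  then show ?thesis unfolding e .
qed

text \<open>A jump of \<open>(u\<^sup>2)' = 2 u u'\<close> across a peak would contribute a Dirac mass to the second
  derivative of \<open>u\<^sup>2\<close>, and nothing else in the weak equation could balance it.\<close>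

lemma peak_at_zero:
  assumes peaks: "peak_set u S" and F: "real_analytic_on F UNIV" and sing: "singular_tws F u" and s: "s \<in> S"
  shows "u s = 0"
proof -
  have tws: "tws F u"
    using sing by (auto simp: singular_tws_def strong_singular_tws_def weak_singular_tws_def weak_singular_tws_off_def)
  then have cont: "continuous_on UNIV u" by (simp add: tws_def H1_loc_def)
  then have contu: "isCont u t" for t by (simp add: continuous_on_eq_continuous_at)
  obtain h where h: "\<And>t. t \<notin> S \<Longrightarrow> energy F u t = h"
    using energy_off_peaks[OF peaks F sing] by blast
  obtain l where l: "l \<noteq> 0" "(deriv u \<longlongrightarrow> l) (at_right s)" "(deriv u \<longlongrightarrow> - l) (at_left s)"
    using peak_limits[OF peaks s] .
  obtain d where d: "d > 0" "\<And>t. t \<in> {s-d..s+d} \<Longrightarrow> t \<noteq> s \<Longrightarrow> t \<notin> S \<and> deriv u t \<noteq> 0"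
    using peak_punctured_nbhd[OF peaks s] by blast
  define W where "W t = 2 * u t * deriv u t" for t
  define W' where "W' t = (deriv u t)\<^sup>2 - 2 * deriv F (u t)" for t
  have dW: "(W has_real_derivative W' t) (at t)" if t: "t \<in> {s-d..s+d}" "t \<noteq> s" for t
  proof -
    have nS: "t \<notin> S" and nz: "deriv u t \<noteq> 0" using d(2)[OF t] by auto
    note D = higher_deriv_off_peaks[OF peaks nS]
    have "eventually (\<lambda>r. energy F u r = h) (nhds t)"
      using eventually_off_peaks[OF peaks nS] by eventually_elim (simp add: h)
    then show ?thesis
      unfolding W_def W'_def by (rule flux_DERIV[OF F D(1,2) nz])
  qed
  \<comment> \<open>a test function that sees no peak but \<open>s\<close>\<close>
  define \<phi> where "\<phi> = bump (s - d) (s + d) 1"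
  have \<phi>: "test_function \<phi>" unfolding \<phi>_def using d(1) by (intro test_function_bump) simp
  have \<phi>0: "\<phi> t = 0" if "t \<notin> {s-d<..<s+d}" for t
    unfolding \<phi>_def using bump_eq_0[OF that] d(1) by simp
  have \<phi>s: "\<phi> s > 0"
    unfolding \<phi>_def using bump_eq_exp[of s "s - d" "s + d" 1] d(1) by simp
  have d\<phi>0: "deriv \<phi> t = 0" if t: "t \<notin> {s-d..s+d}" for t
  proof (rule DERIV_imp_deriv)
    have "eventually (\<lambda>r. r \<in> - {s-d..s+d}) (nhds t)"
      using t by (intro eventually_nhds_in_open) auto
    then have "eventually (\<lambda>r. 0 = \<phi> r) (nhds t)"
      by eventually_elim (use \<phi>0 in auto)
    then show "(\<phi> has_real_derivative 0) (at t)"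
      by (rule DERIV_transform_ev[rotated]) simp
  qed
  have cont\<phi>: "isCont \<phi> t" for t using test_function_DERIV(1)[OF \<phi>] by (rule DERIV_isCont)
  define f where "f t = W' t * \<phi> t + W t * deriv \<phi> t" for t
  have dW\<phi>: "((\<lambda>t. W t * \<phi> t) has_real_derivative f t) (at t)" if "t \<in> {s-d..s+d}" "t \<noteq> s" for t
    unfolding f_def using DERIV_mult[OF dW[OF that] test_function_DERIV(1)[OF \<phi>, of t]]
    by (simp add: mult.commute)
  \<comment> \<open>The difference of these two limits is the jump that has to vanish.\<close>
  have ext: "((\<lambda>t. W t * \<phi> t) \<longlongrightarrow> 2 * u s * l * \<phi> s) (at_right s)"
    "((\<lambda>t. W t * \<phi> t) \<longlongrightarrow> 2 * u s * (- l) * \<phi> s) (at_left s)"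
  proof -
    have lims: "(u \<longlongrightarrow> u s) (at_right s)" "(u \<longlongrightarrow> u s) (at_left s)"
      "(\<phi> \<longlongrightarrow> \<phi> s) (at_right s)" "(\<phi> \<longlongrightarrow> \<phi> s) (at_left s)"
      using contu[of s] cont\<phi>[of s] by (auto simp: isCont_def filterlim_at_split)
    show "((\<lambda>t. W t * \<phi> t) \<longlongrightarrow> 2 * u s * l * \<phi> s) (at_right s)"
      unfolding W_def by (intro tendsto_mult tendsto_const l lims)
    show "((\<lambda>t. W t * \<phi> t) \<longlongrightarrow> 2 * u s * (- l) * \<phi> s) (at_left s)"
      unfolding W_def by (intro tendsto_mult tendsto_const l lims)
  qed
  have end0: "((\<lambda>t. W t * \<phi> t) \<longlongrightarrow> 0) (at r)" if "r \<in> {s-d, s+d}" for r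
    using DERIV_isCont[OF dW\<phi>[of r]] that d(1) \<phi>0[of r] by (auto simp: isCont_def)
  have left: "(f has_integral 2 * u s * (- l) * \<phi> s - 0) {s-d..s}"
    by (rule FTC_one_sided_limits[OF _ dW\<phi> _ ext(2)])
      (use d(1) end0[of "s - d"] in \<open>auto simp: filterlim_at_split\<close>)
  have right: "(f has_integral 0 - 2 * u s * l * \<phi> s) {s..s+d}"
    by (rule FTC_one_sided_limits[OF _ dW\<phi> ext(1)])
      (use d(1) end0[of "s + d"] in \<open>auto simp: filterlim_at_split\<close>)
  have "(f has_integral (2 * u s * (- l) * \<phi> s - 0) + (0 - 2 * u s * l * \<phi> s)) {s-d..s+d}"
    by (rule has_integral_combine[OF _ _ left right]) (use d in auto)
  then have tot: "integral {s-d..s+d} f = - 4 * u s * l * \<phi> s"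
    by (simp add: integral_unique)
  have intW: "loc_integrable W"
    unfolding W_def[abs_def] by (rule weak_deriv_of_peaked(3)[OF peaks cont])
  have intW': "loc_integrable W'"
    unfolding W'_def[abs_def] by (rule loc_integrable_flux_deriv[OF peaks cont F])
  have si: "set_integrable lborel {s-d..s+d} (\<lambda>t. W' t * \<phi> t)" "set_integrable lborel {s-d..s+d} (\<lambda>t. W t * deriv \<phi> t)"
    by (intro set_integrable_mult_continuous intW intW' test_function_continuous[OF \<phi>])+
  have "set_integrable lborel {s-d..s+d} f"
    unfolding f_def[abs_def] by (rule set_integral_add(1)[OF si])
  then have "(LINT t:{s-d..s+d}|lborel. f t) = - 4 * u s * l * \<phi> s"
    using set_borel_integral_eq_integral(2) tot by metis
  moreover have "(LINT t:{s-d..s+d}|lborel. f t) = (LINT t|lborel. f t)"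
  proof (rule LINT_eq_set_LINT[symmetric])
    fix t assume "t \<notin> {s-d..s+d}"
    then show "f t = 0" using \<phi>0[of t] d\<phi>0[of t] by (auto simp: f_def)
  qed
  moreover have "(LINT t|lborel. f t) = 0"
    using tws_classical_weak_form[OF peaks F tws \<phi>] by (simp add: f_def W_def W'_def algebra_simps)
  ultimately show "u s = 0" using l(1) \<phi>s by simp
qed

section \<open>Profiles of peaked waves\<close>

text \<open>What the differential equation off the peaks and the behaviour at the peaks amount to, without any
reference to weak derivatives. The right-hand side \<open>g\<close> takes the place of \<open>speed_sq F\<close>.\<close>

definition wave_profile :: "(real \<Rightarrow> real) \<Rightarrow> (real \<Rightarrow> real) \<Rightarrow> real set \<Rightarrow> bool" where
  "wave_profile g u S \<longleftrightarrow> continuous_on UNIV u \<and> closed S \<and> (\<forall>a b. finite (S \<inter> {a..b})) \<and>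
     (\<forall>s\<in>S. u s = 0 \<and> (deriv u \<longlongrightarrow> sqrt (g 0)) (at_right s) \<and> (deriv u \<longlongrightarrow> - sqrt (g 0)) (at_left s)) \<and>
     (\<forall>t. t \<notin> S \<longrightarrow> 0 < u t \<and> (u has_real_derivative deriv u t) (at t) \<and>
        (deriv u has_real_derivative deriv (deriv u) t) (at t) \<and> isCont (deriv (deriv u)) t \<and>
        (deriv u t)\<^sup>2 = g (u t))"

lemma wave_profileD:
  assumes "wave_profile g u S"
  shows "isCont u t" "closed S" "finite (S \<inter> {a..b})"
    "s \<in> S \<Longrightarrow> u s = 0" "s \<in> S \<Longrightarrow> (deriv u \<longlongrightarrow> sqrt (g 0)) (at_right s)"
    "s \<in> S \<Longrightarrow> (deriv u \<longlongrightarrow> - sqrt (g 0)) (at_left s)"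
    "t \<notin> S \<Longrightarrow> 0 < u t" "t \<notin> S \<Longrightarrow> (u has_real_derivative deriv u t) (at t)"
    "t \<notin> S \<Longrightarrow> (deriv u has_real_derivative deriv (deriv u) t) (at t)"
    "t \<notin> S \<Longrightarrow> isCont (deriv (deriv u)) t" "t \<notin> S \<Longrightarrow> (deriv u t)\<^sup>2 = g (u t)"
  using assms unfolding wave_profile_def by (auto simp: continuous_on_eq_continuous_at)

lemma wave_profile_nonneg: "wave_profile g u S \<Longrightarrow> 0 \<le> u t"
  by (metis wave_profileD(4,7) less_imp_le order_refl)

lemma wave_profile_zero_set: "wave_profile g u S \<Longrightarrow> S = {t. u t = 0}"
  using wave_profileD(4,7) by (metis (mono_tags, lifting) Collect_cong Collect_mem_eq less_irrefl)

lemma Rolle_off_peaks: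
  assumes "a < b" "u a = u b" "\<And>t. isCont u t" and der: "\<And>t. t \<in> {a<..<b} \<Longrightarrow> (u has_real_derivative deriv u t) (at t)"
  obtains t where "t \<in> {a<..<b}" "deriv u t = (0::real)"
proof -
  obtain z where z: "a < z" "z < b" "DERIV u z :> 0"
    using Rolle[OF assms(1,2)] assms(3) der
    by (metis continuous_at_imp_continuous_on greaterThanLessThan_iff real_differentiable_def)
  then show thesis using that[of z] by (metis DERIV_imp_deriv greaterThanLessThan_iff)
qed

text \<open>Letting \<open>t\<close> tend to a peak in the energy gives the level \<open>F 0\<close>, and then \<open>u'\<^sup>2 = g u\<close> gives the slope
\<open>l\<^sup>2 = g 0\<close>. A zero of \<open>u\<close> off the peaks would be a minimum with \<open>u' = 0\<close>; as \<open>g 0 > 0\<close> and \<open>u'\<close> is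
continuous, \<open>u\<close> would vanish in a neighbourhood. The set of such zeros is therefore open and closed,
and it is not the whole line.\<close>

lemma peaked_tws_imp_wave_profile:
  assumes F: "real_analytic_on F UNIV" and u: "peaked_tws F u" and peaks: "peak_set u S"
  shows "deriv F 0 < 0" "wave_profile (speed_sq F) u S"
proof -
  have sing: "singular_tws F u" and nonneg: "\<And>t. 0 \<le> u t"
    using u by (auto simp: peaked_tws_def)
  then have cont: "continuous_on UNIV u"
    by (auto simp: singular_tws_def strong_singular_tws_def weak_singular_tws_def weak_singular_tws_off_def
        tws_def H1_loc_def)
  then have contu: "isCont u t" for t by (simp add: continuous_on_eq_continuous_at)
  note zero = peak_at_zero[OF peaks F sing]
  note D = higher_deriv_off_peaks[OF peaks]
  obtain h where h: "\<And>t. t \<notin> S \<Longrightarrow> energy F u t = h"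
    using energy_off_peaks[OF peaks F sing] by blast
  have ne: "S \<noteq> {}" using peaks by (simp add: peak_set_def)
  have nbhd: "\<exists>d>0. \<forall>t\<in>{s-d..s+d}. t \<noteq> s \<longrightarrow> t \<notin> S \<and> deriv u t \<noteq> 0 \<and> u t \<noteq> 0" if s: "s \<in> S" for s
  proof -
    obtain d where d: "d > 0" "\<And>t. t \<in> {s-d..s+d} \<Longrightarrow> t \<noteq> s \<Longrightarrow> t \<notin> S \<and> deriv u t \<noteq> 0"
      using peak_punctured_nbhd[OF peaks s] by blast
    have "u t \<noteq> 0" if t: "t \<in> {s-d..s+d}" "t \<noteq> s" for t
    proof
      assume 0: "u t = 0"
      have "\<exists>r\<in>{min s t<..<max s t}. deriv u r = 0"
      proof -
        have "(u has_real_derivative deriv u r) (at r)" if "r \<in> {min s t<..<max s t}" for r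
          by (rule D(1)) (use that t d(1) d(2)[of r] in \<open>auto simp: min_def max_def split: if_splits\<close>)
        moreover have "u (min s t) = u (max s t)" "min s t < max s t"
          using 0 zero[OF s] t(2) by (auto simp: min_def max_def)
        ultimately show ?thesis using Rolle_off_peaks[of "min s t" "max s t" u] contu by metis
      qed
      then obtain r where "r \<in> {min s t<..<max s t}" "deriv u r = 0" by blast
      then show False
        using d t by (auto simp: min_def max_def split: if_splits)
    qed
    with d show ?thesis by blast
  qed
  have right_nbhd: "\<exists>d>0. \<forall>t\<in>{s<..<s+d}. t \<notin> S \<and> deriv u t \<noteq> 0 \<and> u t \<noteq> 0" if "s \<in> S" for s
  proof -
    obtain d where d: "d > 0" "\<forall>t\<in>{s-d..s+d}. t \<noteq> s \<longrightarrow> t \<notin> S \<and> deriv u t \<noteq> 0 \<and> u t \<noteq> 0"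
      using nbhd[OF \<open>s \<in> S\<close>] by blast
    then have "\<forall>t\<in>{s<..<s+d}. t \<notin> S \<and> deriv u t \<noteq> 0 \<and> u t \<noteq> 0" by auto
    with d(1) show ?thesis by blast
  qed
  note contF = real_analytic_UNIV_continuous(1)[OF F]
  note contg = real_analytic_UNIV_continuous(1)[OF speed_sq_analytic[OF F]]
  obtain s0 where s0: "s0 \<in> S" using ne by blast
  have u_right: "(u \<longlongrightarrow> 0) (at_right s)" if "s \<in> S" for s
    using contu[of s] zero[OF that] by (simp add: isCont_def filterlim_at_split)
  have ev_right: "eventually (\<lambda>t. t \<notin> S \<and> deriv u t \<noteq> 0 \<and> u t \<noteq> 0) (at_right s)" if s: "s \<in> S" for s
  proof -
    obtain d where d: "d > 0" "\<forall>t\<in>{s<..<s+d}. t \<notin> S \<and> deriv u t \<noteq> 0 \<and> u t \<noteq> 0"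
      using right_nbhd[OF s] by blast
    then show ?thesis unfolding eventually_at_right_field by (intro exI[of _ "s + d"]) auto
  qed
  have hF: "h = F 0"
  proof -
    obtain l where l: "(deriv u \<longlongrightarrow> l) (at_right s0)"
      using peak_limits[OF peaks s0] by metis
    have "((\<lambda>t. F (u t)) \<longlongrightarrow> F 0) (at_right s0)"
      using contF[of 0] u_right[OF s0] by (rule isCont_tendsto_compose)
    then have "(energy F u \<longlongrightarrow> 0 * l\<^sup>2 / 2 + F 0) (at_right s0)"
      unfolding energy_def by (intro tendsto_intros l u_right s0) auto
    then have "(energy F u \<longlongrightarrow> F 0) (at_right s0)" by simp
    moreover have "(energy F u \<longlongrightarrow> h) (at_right s0)"
      by (rule tendsto_eventually) (use ev_right[OF s0] h in \<open>auto elim!: eventually_mono\<close>)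
    ultimately show ?thesis using tendsto_unique trivial_limit_at_right_real by metis
  qed
  have sq: "(deriv u t)\<^sup>2 = speed_sq F (u t)" if "t \<notin> S" "u t \<noteq> 0" for t
  proof -
    have "u t * (deriv u t)\<^sup>2 / 2 + F (u t) = F 0"
      using h[OF that(1)] hF by (simp add: energy_def)
    then have "u t * (deriv u t)\<^sup>2 = u t * speed_sq F (u t)"
      using speed_sq_eq[OF that(2), of F] by linarith
    then show ?thesis using that(2) by simp
  qed
  have lim_pos: "l = sqrt (speed_sq F 0) \<and> speed_sq F 0 > 0"
    if s: "s \<in> S" and l: "l \<noteq> 0" "(deriv u \<longlongrightarrow> l) (at_right s)" for s l
  proof -
    have "((\<lambda>t. (deriv u t)\<^sup>2) \<longlongrightarrow> l\<^sup>2) (at_right s)"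
      by (intro tendsto_intros l)
    moreover have "eventually (\<lambda>t. (deriv u t)\<^sup>2 = speed_sq F (u t)) (at_right s)"
      using ev_right[OF s] by eventually_elim (use sq in auto)
    ultimately have "((\<lambda>t. speed_sq F (u t)) \<longlongrightarrow> l\<^sup>2) (at_right s)"
      by (rule Lim_transform_eventually)
    moreover have "((\<lambda>t. speed_sq F (u t)) \<longlongrightarrow> speed_sq F 0) (at_right s)"
      using contg[of 0] u_right[OF s] by (rule isCont_tendsto_compose)
    ultimately have e: "l\<^sup>2 = speed_sq F 0"
      using tendsto_unique trivial_limit_at_right_real by metis
    have "\<not> l < 0"
    proof
      assume "l < 0"
      then have "eventually (\<lambda>t. deriv u t < 0) (at_right s)"
        using order_tendstoD(2)[OF l(2)] by blast
      then have "eventually (\<lambda>t. deriv u t < 0 \<and> t \<notin> S \<and> u t \<noteq> 0) (at_right s)"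
        using ev_right[OF s] by eventually_elim auto
      then obtain b where b: "b > s" "\<And>t. s < t \<Longrightarrow> t < b \<Longrightarrow> deriv u t < 0 \<and> t \<notin> S \<and> u t \<noteq> 0"
        unfolding eventually_at_right_field by blast
      define c where "c = (s + b) / 2"
      have c: "s < c" "c < b" using b(1) by (auto simp: c_def)
      have "u c < u s"
      proof (rule DERIV_neg_imp_decreasing_open[OF c(1)])
        show "\<exists>y. DERIV u t :> y \<and> y < 0" if "s < t" "t < c" for t
          using D(1)[of t] b(2)[of t] that c by force
        show "continuous_on {s..c} u" using cont by (rule continuous_on_subset) auto
      qed
      then show False using zero[OF s] nonneg[of c] by simp
    qed
    then have "l > 0" using l(1) by simp
    then show ?thesis using e by (metis real_sqrt_unique less_imp_le zero_less_power)
  qed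
  obtain l0 where l0: "l0 \<noteq> 0" "(deriv u \<longlongrightarrow> l0) (at_right s0)"
    using peak_limits[OF peaks s0] by metis
  have g0: "speed_sq F 0 > 0" using lim_pos[OF s0 l0] by simp
  then show "deriv F 0 < 0" by (simp add: speed_sq_0)
  have pos: "u t \<noteq> 0" if "t \<notin> S" for t
  proof -
    define Z where "Z = {t. t \<notin> S \<and> u t = 0}"
    have "open Z"
      unfolding open_subopen[of Z]
    proof
      fix t assume "t \<in> Z"
      then have t: "t \<notin> S" "u t = 0" by (auto simp: Z_def)
      have "deriv u t = 0"
        by (rule DERIV_local_min[OF D(1)[OF t(1)], of 1]) (use t(2) nonneg in auto)
      then have "(deriv u \<longlongrightarrow> 0) (nhds t)"
        using D(3)[OF t(1)] by (metis isCont_def tendsto_at_iff_tendsto_nhds)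
      then have "((\<lambda>r. (deriv u r)\<^sup>2) \<longlongrightarrow> 0\<^sup>2) (nhds t)"
        by (rule tendsto_power)
      then have "((\<lambda>r. (deriv u r)\<^sup>2) \<longlongrightarrow> 0) (nhds t)" by simp
      then have e1: "eventually (\<lambda>r. (deriv u r)\<^sup>2 < speed_sq F 0 / 2) (nhds t)"
        by (rule order_tendstoD(2)) (use g0 in simp)
      have "isCont (\<lambda>r. speed_sq F (u r)) t"
        by (rule isCont_o2[OF contu contg])
      then have "((\<lambda>r. speed_sq F (u r)) \<longlongrightarrow> speed_sq F 0) (nhds t)"
        using tendsto_at_iff_tendsto_nhds[of "\<lambda>r. speed_sq F (u r)" t] t(2) by (simp add: isCont_def)
      then have e2: "eventually (\<lambda>r. speed_sq F 0 / 2 < speed_sq F (u r)) (nhds t)"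
        by (rule order_tendstoD(1)) (use g0 in simp)
      have "eventually (\<lambda>r. r \<in> Z) (nhds t)"
        using e1 e2 eventually_off_peaks[OF peaks t(1)]
      proof eventually_elim
        case (elim r)
        then have "u r = 0" using sq[of r] by force
        then show ?case using elim by (simp add: Z_def)
      qed
      then show "\<exists>T. open T \<and> t \<in> T \<and> T \<subseteq> Z"
        unfolding eventually_nhds by blast
    qed
    moreover have "closed Z"
      unfolding closed_sequential_limits
    proof (intro allI impI, elim conjE)
      fix x r assume x: "\<forall>n. x n \<in> Z" "x \<longlonglongrightarrow> r"
      have "(\<lambda>n. u (x n)) \<longlonglongrightarrow> u r"
        using contu x(2) by (rule isCont_tendsto_compose)
      then have "u r = 0" using x(1) by (simp add: Z_def LIMSEQ_const_iff)
      moreover have "r \<notin> S"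
      proof
        assume "r \<in> S"
        then obtain d where d: "d > 0" "\<forall>t\<in>{r-d..r+d}. t \<noteq> r \<longrightarrow> u t \<noteq> 0"
          using nbhd by metis
        have "eventually (\<lambda>n. dist (x n) r < d) sequentially"
          using x(2) d(1) by (rule tendstoD)
        then obtain n where "dist (x n) r < d" unfolding eventually_sequentially by blast
        then have "x n \<in> {r-d..r+d}" by (auto simp: dist_real_def abs_less_iff)
        moreover have "x n \<in> Z" using x(1) by blast
        ultimately show False using d(2) \<open>r \<in> S\<close> by (auto simp: Z_def)
      qed
      ultimately show "r \<in> Z" by (simp add: Z_def)
    qed
    ultimately have "Z = {} \<or> Z = UNIV" using clopen by blast
    moreover have "s0 \<notin> Z" using s0 by (simp add: Z_def)
    ultimately have "Z = {}" by auto
    then show ?thesis using that by (auto simp: Z_def)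
  qed
  show "wave_profile (speed_sq F) u S"
    unfolding wave_profile_def
  proof (intro conjI ballI allI impI)
    fix s assume s: "s \<in> S"
    obtain l where l: "l \<noteq> 0" "(deriv u \<longlongrightarrow> l) (at_right s)" "(deriv u \<longlongrightarrow> - l) (at_left s)"
      using peak_limits[OF peaks s] by blast
    have e: "l = sqrt (speed_sq F 0)" using lim_pos[OF s l(1,2)] by simp
    show "(deriv u \<longlongrightarrow> sqrt (speed_sq F 0)) (at_right s)" "(deriv u \<longlongrightarrow> - sqrt (speed_sq F 0)) (at_left s)"
      using l by (simp_all add: e)
  next
    fix t assume t: "t \<notin> S"
    show "0 < u t" using pos[OF t] nonneg[of t] by simp
    show "(deriv u t)\<^sup>2 = speed_sq F (u t)" using sq[OF t pos[OF t]] .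
  qed (use cont closed_peaks[OF peaks] finite_peaks_Icc[OF peaks] zero D in auto)
qed

text \<open>Without a first return \<open>g > 0\<close> on the compact range of \<open>u\<close>, so \<open>u'\<close> would stay away from
  zero: by Rolle there would be no further peak, and \<open>u\<close> would grow without bound.\<close>

lemma first_return_exists:
  assumes F: "real_analytic_on F UNIV" and F0: "deriv F 0 < 0"
    and prof: "wave_profile (speed_sq F) u S" and s: "s \<in> S" and bdd: "bounded (range u)"
  shows "\<exists>m. first_return F m"
proof (rule ccontr)
  assume none: "\<nexists>m. first_return F m"
  note P = wave_profileD[OF prof]
  note contF = real_analytic_UNIV_continuous(1)[OF F]
  obtain e where e: "e > 0" "\<And>x. 0 < x \<Longrightarrow> x < e \<Longrightarrow> F x < F 0"
    using DERIV_neg_dec_right[OF real_analytic_on_DERIV[OF F UNIV_I] F0] by auto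
  have below: "F x < F 0" if "x > 0" for x
  proof (rule ccontr)
    assume "\<not> F x < F 0"
    define m where "m = Inf {y \<in> {e/2..x}. F 0 \<le> F y}"
    let ?A = "{y \<in> {e/2..x}. F 0 \<le> F y}"
    have "e \<le> x" using e(2)[of x] that \<open>\<not> F x < F 0\<close> by force
    then have "x \<in> ?A" using \<open>\<not> F x < F 0\<close> e(1) by auto
    have "closed ({e/2..x} \<inter> {y. F 0 \<le> F y})"
      using real_analytic_UNIV_continuous(2)[OF F]
      by (intro closed_Int closed_Collect_le continuous_intros) auto
    then have "closed ?A" by (simp add: Int_def)
    have bdd: "bdd_below ?A"
      by (rule bdd_belowI[of _ "e / 2"]) auto
    have mA: "m \<in> ?A"
      unfolding m_def
      by (rule closed_contains_Inf) (use \<open>x \<in> ?A\<close> \<open>closed ?A\<close> bdd in auto)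
    have le: "m \<le> y" if "y \<in> ?A" for y
      unfolding m_def by (rule cInf_lower) (use that bdd in auto)
    have lt: "F y < F 0" if "0 < y" "y < m" for y
    proof (cases "y < e")
      case False
      then show ?thesis using le[of y] that mA e(1) by force
    qed (use e(2) that in auto)
    have m0: "0 < m" using mA e(1) by auto
    have "F m \<le> F 0"
    proof (rule tendsto_upperbound)
      show "(F \<longlongrightarrow> F m) (at_left m)"
        using contF[of m] by (simp add: isCont_def filterlim_at_split)
      show "eventually (\<lambda>y. F y \<le> F 0) (at_left m)"
        using eventually_at_left_real[OF m0] by eventually_elim (use lt in \<open>auto intro: less_imp_le\<close>)
    qed simp
    then have "first_return F m" using mA lt m0 by (auto simp: first_return_def)
    then show False using none by blast
  qed
  have gpos: "speed_sq F x > 0" if "x \<ge> 0" for x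
  proof (cases "x = 0")
    case False
    then have "x * speed_sq F x / 2 > 0" using speed_sq_eq[of x F] below[of x] that by simp
    then show ?thesis using that False by (auto simp: zero_less_mult_iff)
  qed (use F0 in \<open>simp add: speed_sq_0\<close>)
  obtain M where M: "\<And>t. \<bar>u t\<bar> \<le> M" using bdd by (auto simp: bounded_iff)
  have M0: "0 \<le> M" using M[of 0] by linarith
  have "compact {0..M}" "{0..M} \<noteq> {}" using M0 by auto
  then obtain x0 where x0: "x0 \<in> {0..M}" "\<And>x. x \<in> {0..M} \<Longrightarrow> speed_sq F x0 \<le> speed_sq F x"
    using continuous_attains_inf real_analytic_UNIV_continuous(2)[OF speed_sq_analytic[OF F]] by metis
  define c where "c = sqrt (speed_sq F x0)"
  have c: "c > 0" using gpos[of x0] x0(1) by (simp add: c_def)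
  have speed: "c \<le> \<bar>deriv u t\<bar>" if "t \<notin> S" for t
  proof -
    have "speed_sq F x0 \<le> (deriv u t)\<^sup>2"
      using x0(2)[of "u t"] P(11)[OF that] M[of t] wave_profile_nonneg[OF prof, of t] by simp
    then show ?thesis unfolding c_def by (metis real_sqrt_abs real_sqrt_le_mono)
  qed
  have noS: "t \<notin> S" if "t > s" for t
  proof
    assume t: "t \<in> S"
    \<comment> \<open>the next peak after \<open>s\<close>\<close>
    obtain t' where t': "t' \<in> S" "t' > s" "\<And>r. r \<in> {s<..<t'} \<Longrightarrow> r \<notin> S"
    proof -
      have fin: "finite (S \<inter> {s<..t})"
        using P(3)[of s t] by (rule finite_subset[rotated]) auto
      have ne: "S \<inter> {s<..t} \<noteq> {}" using t \<open>t > s\<close> by auto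
      have "r \<notin> S" if "r \<in> {s<..<Min (S \<inter> {s<..t})}" for r
      proof
        assume "r \<in> S"
        then have "r \<in> S \<inter> {s<..t}" using that Min_in[OF fin ne] by auto
        then show False using that Min_le[OF fin, of r] by auto
      qed
      then show thesis
        using that[of "Min (S \<inter> {s<..t})"] Min_in[OF fin ne] by auto
    qed
    obtain r where "r \<in> {s<..<t'}" "deriv u r = 0"
      using Rolle_off_peaks[of s t' u] P t' s by metis
    then show False using speed[of r] t'(3)[of r] c by simp
  qed
  have "\<bar>u t - u s\<bar> \<ge> c * (t - s)" if t: "t > s" for t
  proof -
    obtain l z where z: "s < z" "z < t" "DERIV u z :> l" "u t - u s = (t - s) * l"
      using MVT[OF t, of u] P(1,8) noS
      by (metis continuous_at_imp_continuous_on real_differentiable_def)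
    then have "c \<le> \<bar>l\<bar>" using speed[OF noS[OF z(1)]] by (simp add: DERIV_imp_deriv)
    then have "c * (t - s) \<le> \<bar>l\<bar> * (t - s)" using t by (intro mult_right_mono) auto
    also have "\<dots> = \<bar>u t - u s\<bar>" using z(4) t by (simp add: abs_mult)
    finally show ?thesis .
  qed
  from this[of "s + (M + 1) / c"] have "M + 1 \<le> \<bar>u (s + (M + 1) / c)\<bar>"
    using c M0 P(4)[OF s] by simp
  then show False using M[of "s + (M + 1) / c"] by linarith
qed

section \<open>Travel time along a monotone arc\<close>

lemma strict_mono_on_clock:
  assumes "\<And>x. x \<in> {a<..<b} \<Longrightarrow> (G has_real_derivative G' x) (at x)" "\<And>x. x \<in> {a<..<b} \<Longrightarrow> 0 < G' x"
  shows "strict_mono_on {a<..<b::real} G"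
proof (rule strict_mono_onI)
  fix x y assume xy: "x \<in> {a<..<b}" "y \<in> {a<..<b}" "x < y"
  show "G x < G y"
  proof (rule DERIV_pos_imp_increasing[OF xy(3)])
    fix z assume "x \<le> z" "z \<le> y"
    then have "z \<in> {a<..<b}" using xy by auto
    then show "\<exists>D. DERIV G z :> D \<and> D > 0" using assms by blast
  qed
qed

text \<open>As long as \<open>u\<close> meets neither a peak nor a turning point, \<open>G \<circ> u\<close> has slope \<open>\<sigma>\<close>. The premise \<open>room\<close> says that
the values of \<open>u\<close> predicted by this law stay inside \<open>(0, m)\<close>, where \<open>g > 0\<close>; at the first peak or
turning point before \<open>b\<close> continuity would put \<open>u\<close> inside \<open>(0, m)\<close>, with \<open>u'\<^sup>2 = g u > 0\<close>.\<close>

lemma wave_profile_arc: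
  assumes prof: "wave_profile g u S" and gm: "g m = 0" and gpos: "\<And>x. x \<in> {0<..<m} \<Longrightarrow> 0 < g x"
    and dG: "\<And>x. x \<in> {0<..<m} \<Longrightarrow> (G has_real_derivative 1 / sqrt (g x)) (at x)"
    and \<sigma>: "\<sigma> = 1 \<or> \<sigma> = - 1" and ab: "a < b"
    and start: "eventually (\<lambda>t. t \<notin> S \<and> u t \<in> {0<..<m} \<and> 0 < \<sigma> * deriv u t) (at_right a)"
    and lim: "((\<lambda>t. G (u t)) \<longlongrightarrow> G0) (at_right a)"
    and room: "\<And>t. t \<in> {a<..<b} \<Longrightarrow> \<exists>x\<in>{0<..<m}. G x = G0 + \<sigma> * (t - a)"
    and t: "t \<in> {a<..<b}"
  shows "t \<notin> S \<and> u t \<in> {0<..<m} \<and> G (u t) = G0 + \<sigma> * (t - a)"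
proof -
  note P = wave_profileD[OF prof]
  have mono: "strict_mono_on {0<..<m} G"
    by (rule strict_mono_on_clock[OF dG]) (use gpos in auto)
  obtain e0 where e0: "e0 > a" "\<And>t. t \<in> {a<..<e0} \<Longrightarrow> t \<notin> S \<and> u t \<in> {0<..<m} \<and> 0 < \<sigma> * deriv u t"
    using start unfolding eventually_at_right_field by auto
  define e where "e = min e0 b"
  have e: "a < e" "e \<le> b" "\<And>t. t \<in> {a<..<e} \<Longrightarrow> t \<notin> S \<and> u t \<in> {0<..<m} \<and> 0 < \<sigma> * deriv u t"
    using e0 ab by (auto simp: e_def)
  have cont_du: "isCont (deriv u) t" if "t \<notin> S" for t
    using P(9)[OF that] by (rule DERIV_isCont)
  have core: "t \<notin> S \<and> u t \<in> {0<..<m} \<and> G (u t) = G0 + \<sigma> * (t - a)"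
    if c: "e \<le> c" "c \<le> b" and good: "\<And>t. t \<in> {a<..<c} \<Longrightarrow> t \<notin> S \<and> deriv u t \<noteq> 0" and t: "t \<in> {a<..<c}" for c t
  proof -
    define r where "r = (a + e) / 2"
    have r: "r \<in> {a<..<e}" "r \<in> {a<..<c}" using e(1) c(1) by (auto simp: r_def)
    have um: "u t \<in> {0<..<m}" if t: "t \<in> {a<..<c}" for t
    proof -
      have "connected (u ` {a<..<c})"
        by (intro connected_continuous_image continuous_at_imp_continuous_on) (use P(1) in auto)
      moreover have "m \<notin> u ` {a<..<c}"
        using P(11) good gm by (metis imageE power_eq_0_iff)
      ultimately have "\<not> m \<le> u t"
        using connectedD_interval[of "u ` {a<..<c}" "u r" "u t" m] e(3)[OF r(1)] r(2) t by auto
      then show ?thesis using P(7)[of t] good[OF t] by simp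
    qed
    have sgn: "0 < \<sigma> * deriv u t" if t: "t \<in> {a<..<c}" for t
    proof (rule ccontr)
      assume n: "\<not> 0 < \<sigma> * deriv u t"
      have "connected ((\<lambda>t. \<sigma> * deriv u t) ` {a<..<c})"
        by (intro connected_continuous_image continuous_at_imp_continuous_on)
          (use cont_du good in \<open>auto intro!: continuous_intros\<close>)
      then have "0 \<in> (\<lambda>t. \<sigma> * deriv u t) ` {a<..<c}"
        using n e(3)[OF r(1)] r(2) t
        by (intro connectedD_interval[of _ "\<sigma> * deriv u t" "\<sigma> * deriv u r" 0] imageI) auto
      then show False using good \<sigma> by auto
    qed
    have "((\<lambda>t. G (u t) - \<sigma> * t) has_real_derivative 0) (at t within {a<..<c})" if t: "t \<in> {a<..<c}" for t
    proof -
      have nz: "sqrt (g (u t)) = \<sigma> * deriv u t"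
        using P(11)[of t] good[OF t] sgn[OF t] \<sigma> by (auto simp: real_sqrt_unique)
      have "((\<lambda>t. G (u t)) has_real_derivative 1 / sqrt (g (u t)) * deriv u t) (at t)"
        by (rule DERIV_chain2[OF dG[OF um[OF t]] P(8)]) (use good[OF t] in blast)
      also have "1 / sqrt (g (u t)) * deriv u t = \<sigma>"
        unfolding nz using \<sigma> good[OF t] by auto
      finally have "((\<lambda>t. G (u t) - \<sigma> * t) has_real_derivative \<sigma> - \<sigma> * 1) (at t)"
        by (intro DERIV_diff DERIV_cmult DERIV_ident)
      then show ?thesis by (simp add: has_field_derivative_at_within)
    qed
    then obtain k where k: "\<And>t. t \<in> {a<..<c} \<Longrightarrow> G (u t) - \<sigma> * t = k"
      using has_field_derivative_zero_constant[of "{a<..<c}" "\<lambda>t. G (u t) - \<sigma> * t"] by auto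
    have "((\<lambda>t. G (u t) - \<sigma> * t) \<longlongrightarrow> G0 - \<sigma> * a) (at_right a)"
      by (intro tendsto_intros lim)
    moreover have "((\<lambda>t. G (u t) - \<sigma> * t) \<longlongrightarrow> k) (at_right a)"
      by (rule tendsto_eventually)
        (use eventually_at_right_real[of a c] e(1) c(1) k in \<open>auto elim!: eventually_mono\<close>)
    ultimately have "k = G0 - \<sigma> * a" using tendsto_unique trivial_limit_at_right_real by metis
    then show ?thesis using k[OF t] um[OF t] good[OF t] by (simp add: algebra_simps)
  qed
  have good: "t \<notin> S \<and> deriv u t \<noteq> 0" if t: "t \<in> {a<..<b}" for t
  proof (rule ccontr)
    assume bad: "\<not> (t \<notin> S \<and> deriv u t \<noteq> 0)"
    define B where "B = {t \<in> {a<..<b}. t \<in> S \<or> deriv u t = 0}"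
    have tB: "t \<in> B" using bad t by (auto simp: B_def)
    have eB: "e \<le> r" if "r \<in> B" for r
      using that e(3)[of r] by (force simp: B_def)
    have bdd: "bdd_below B" using eB by (rule bdd_belowI)
    define z where "z = Inf B"
    have z: "e \<le> z" "z \<le> t"
      unfolding z_def using tB eB by (auto intro: cInf_greatest cInf_lower bdd)
    then have zab: "z \<in> {a<..<b}" using t e(1) by auto
    have before: "r \<notin> S \<and> deriv u r \<noteq> 0" if "r \<in> {a<..<z}" for r
    proof (rule ccontr)
      assume "\<not> (r \<notin> S \<and> deriv u r \<noteq> 0)"
      then have "r \<in> B" using that zab by (auto simp: B_def)
      then have "z \<le> r" unfolding z_def by (rule cInf_lower[OF _ bdd])
      then show False using that by simp
    qed
    obtain x where x: "x \<in> {0<..<m}" "G x = G0 + \<sigma> * (z - a)" using room[OF zab] by blast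
    define x1 x2 where "x1 = x / 2" and "x2 = (x + m) / 2"
    have x12: "x1 \<in> {0<..<m}" "x2 \<in> {0<..<m}" "x1 < x" "x < x2"
      using x(1) by (auto simp: x1_def x2_def)
    have Gx: "G x1 < G x" "G x < G x2"
      using strict_mono_onD[OF mono] x12 x(1) by auto
    have "((\<lambda>r. G0 + \<sigma> * (r - a)) \<longlongrightarrow> G x) (at_left z)"
      unfolding x(2) by (intro tendsto_intros)
    from order_tendstoD(1)[OF this Gx(1)] order_tendstoD(2)[OF this Gx(2)]
    have "eventually (\<lambda>r. G x1 < G0 + \<sigma> * (r - a) \<and> G0 + \<sigma> * (r - a) < G x2) (at_left z)"
      by eventually_elim simp
    moreover have "eventually (\<lambda>r. r \<in> {a<..<z}) (at_left z)"
      using zab by (intro eventually_at_left_real) auto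
    ultimately have ev: "eventually (\<lambda>r. x1 < u r \<and> u r < x2) (at_left z)"
    proof eventually_elim
      case (elim r)
      have "u r \<in> {0<..<m}" "G (u r) = G0 + \<sigma> * (r - a)"
        using core[of z r] z(1) zab before elim(2) by auto
      then show ?case
        using elim(1) strict_mono_on_less[OF mono] x12 by metis
    qed
    have lu: "(u \<longlongrightarrow> u z) (at_left z)"
      using P(1)[of z] by (simp add: isCont_def filterlim_at_split)
    have "x1 \<le> u z"
      by (rule tendsto_lowerbound[OF lu]) (use ev in \<open>auto elim!: eventually_mono\<close>)
    moreover have "u z \<le> x2"
      by (rule tendsto_upperbound[OF lu]) (use ev in \<open>auto elim!: eventually_mono\<close>)
    ultimately have uz: "u z \<in> {0<..<m}" using x12 by auto
    then have zS: "z \<notin> S" using P(4) by fastforce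
    have "deriv u z \<noteq> 0" using P(11)[OF zS] gpos[OF uz] by auto
    moreover have "(deriv u \<longlongrightarrow> deriv u z) (nhds z)"
      using cont_du[OF zS] by (simp add: isCont_def tendsto_at_iff_tendsto_nhds)
    ultimately have "eventually (\<lambda>r. deriv u r \<noteq> 0) (nhds z)"
      by (metis tendsto_imp_eventually_ne)
    moreover have "eventually (\<lambda>r. r \<in> - S) (nhds z)"
      using zS P(2) by (intro eventually_nhds_in_open) auto
    ultimately have "eventually (\<lambda>r. r \<notin> B) (nhds z)"
      by eventually_elim (auto simp: B_def)
    then obtain d where d: "d > 0" "\<And>r. dist r z < d \<Longrightarrow> r \<notin> B"
      unfolding eventually_nhds_metric by blast
    obtain r where r: "r \<in> B" "r < z + d"
      using cInf_lessD[of B "z + d"] tB d(1) unfolding z_def by auto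
    have "z \<le> r" unfolding z_def by (rule cInf_lower[OF r(1) bdd])
    then show False using d(2)[of r] r by (auto simp: dist_real_def)
  qed
  show ?thesis using core[of b t] e(2) good t by auto
qed

section \<open>Arches of a potential\<close>

lemma increasing_analytic_inverse:
  assumes G: "real_analytic_on G {a<..<b}" and pos: "\<And>x. x \<in> {a<..<b} \<Longrightarrow> 0 < deriv G x"
  obtains Y where "\<And>x. x \<in> {a<..<b} \<Longrightarrow> Y (G x) = x" "real_analytic_on Y (G ` {a<..<b})"
    "\<And>x. x \<in> {a<..<b} \<Longrightarrow> (Y has_real_derivative inverse (deriv G x)) (at (G x))"
    "\<And>c d y. c \<in> {a<..<b} \<Longrightarrow> d \<in> {a<..<b} \<Longrightarrow> G c \<le> y \<Longrightarrow> y \<le> G d \<Longrightarrow> \<exists>x\<in>{c..d}. G x = y"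
proof -
  define Y where "Y = inv_into {a<..<b} G"
  note D = real_analytic_on_DERIV[OF G]
  have mono: "strict_mono_on {a<..<b} G"
    using D pos by (rule strict_mono_on_clock)
  have YG: "Y (G x) = x" if "x \<in> {a<..<b}" for x
    unfolding Y_def using strict_mono_on_imp_inj_on[OF mono] that by (rule inv_into_f_f)
  have cont: "isCont G x" if "x \<in> {a<..<b}" for x
    using D[OF that] by (rule DERIV_isCont)
  have ivt: "\<exists>x\<in>{c..d}. G x = y" if "c \<in> {a<..<b}" "d \<in> {a<..<b}" "G c \<le> y" "y \<le> G d" for c d y
  proof -
    have "c \<le> d" using that strict_mono_on_leD[OF mono] strict_mono_onD[OF mono, of d c] by force
    then show ?thesis
      using IVT[of G c y d] that cont by auto
  qed
  have loc: "\<exists>d>0. (\<forall>z. \<bar>z - x\<bar> \<le> d \<longrightarrow> z \<in> {a<..<b}) \<and> G (x - d) < G x \<and> G x < G (x + d) \<and>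
     (\<forall>y. G (x - d) < y \<longrightarrow> y < G (x + d) \<longrightarrow> G (Y y) = y)" if x: "x \<in> {a<..<b}" for x
  proof -
    define d where "d = min (x - a) (b - x) / 2"
    have d: "d > 0" "x - d > a" "x + d < b" using x by (auto simp: d_def min_def field_simps)
    have m: "x - d \<in> {a<..<b}" "x + d \<in> {a<..<b}" using d x by auto
    have "G (Y y) = y" if y: "G (x - d) < y" "y < G (x + d)" for y
    proof -
      obtain z where "z \<in> {x-d..x+d}" "G z = y" using ivt[OF m] y by (meson less_imp_le)
      then show ?thesis using YG[of z] m by auto
    qed
    moreover have "G (x - d) < G x" "G x < G (x + d)"
      using strict_mono_onD[OF mono] m x d(1) by auto
    moreover have "z \<in> {a<..<b}" if "\<bar>z - x\<bar> \<le> d" for z using that d by (auto simp: abs_le_iff)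
    ultimately show ?thesis using d(1) by blast
  qed
  have contY: "isCont Y (G x)" if x: "x \<in> {a<..<b}" for x
  proof -
    obtain d where "d > 0" "\<And>z. \<bar>z - x\<bar> \<le> d \<Longrightarrow> z \<in> {a<..<b}" using loc[OF x] by blast
    then show ?thesis using isCont_inverse_function[of d x Y G] YG cont by blast
  qed
  have an: "real_analytic_on Y {G x}" if x: "x \<in> {a<..<b}" for x
  proof (rule real_analytic_on_inverse_function)
    show "real_analytic_on G {Y (G x)}" "deriv G (Y (G x)) \<noteq> 0"
      using real_analytic_onD[OF G x] pos[OF x] by (simp_all add: YG[OF x])
    show "isCont Y (G x)" using contY[OF x] .
    obtain d where d: "G (x - d) < G x" "G x < G (x + d)" "\<And>y. G (x - d) < y \<Longrightarrow> y < G (x + d) \<Longrightarrow> G (Y y) = y"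
      using loc[OF x] by blast
    have "eventually (\<lambda>y. y \<in> {G (x - d)<..<G (x + d)}) (nhds (G x))"
      using d by (intro eventually_nhds_in_open) auto
    then show "eventually (\<lambda>y. G (Y y) = y) (nhds (G x))"
      by eventually_elim (use d(3) in auto)
  qed
  have der: "(Y has_real_derivative inverse (deriv G x)) (at (G x))" if x: "x \<in> {a<..<b}" for x
  proof -
    obtain d where d: "G (x - d) < G x" "G x < G (x + d)" "\<And>y. G (x - d) < y \<Longrightarrow> y < G (x + d) \<Longrightarrow> G (Y y) = y"
      using loc[OF x] by blast
    show ?thesis
      by (rule DERIV_inverse_function[OF _ _ d(1,2) d(3) contY[OF x]])
        (use D[OF x] pos[OF x] YG[OF x] in auto)
  qed
  show thesis
    by (rule that[OF YG real_analytic_onI der ivt]) (use an in auto)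
qed

text \<open>The conditions on \<open>F\<close> that a peaked wave imposes; \<open>m\<close> is the supremum of each such wave.\<close>

locale potential =
  fixes F :: "real \<Rightarrow> real" and m :: real
  assumes analytic: "real_analytic_on F UNIV" and F0: "deriv F 0 < 0" and return: "first_return F m"
begin

abbreviation g where "g \<equiv> speed_sq F"

lemma m_pos: "0 < m" and F_m: "F m = F 0" and F_below: "0 < x \<Longrightarrow> x < m \<Longrightarrow> F x < F 0"
  using return by (auto simp: first_return_def)

lemma g_analytic: "real_analytic_on g UNIV"
  using analytic by (rule speed_sq_analytic)

lemma g_cont: "isCont g x" "continuous_on A g"
  using real_analytic_UNIV_continuous[OF g_analytic] by auto

lemma g_eq: "x * g x / 2 + F x = F 0"
  by (cases "x = 0") (auto simp: speed_sq_eq)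

lemma g_0: "0 < g 0"
  using F0 by (simp add: speed_sq_0)

lemma g_m: "g m = 0"
  using g_eq[of m] m_pos F_m by simp

lemma g_pos: "x \<in> {0..<m} \<Longrightarrow> 0 < g x"
proof (cases "x = 0")
  case False
  assume "x \<in> {0..<m}"
  then have "x > 0" "F x < F 0" using F_below[of x] False by auto
  then have "x * g x / 2 > 0" using g_eq[of x] by linarith
  then show ?thesis using \<open>x > 0\<close> by (simp add: zero_less_mult_iff)
qed (simp add: g_0)

lemma deriv_g_m: "deriv g m = - 2 * deriv F m / m"
proof -
  have "((\<lambda>x. x * g x / 2 + F x) has_real_derivative (1 * g m + deriv g m * m) / 2 + deriv F m) (at m)"
    by (intro DERIV_add DERIV_cdivide DERIV_mult DERIV_ident real_analytic_on_DERIV[OF analytic UNIV_I]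
        real_analytic_on_DERIV[OF g_analytic UNIV_I])
  then have "((\<lambda>x. F 0) has_real_derivative (1 * g m + deriv g m * m) / 2 + deriv F m) (at m)"
    by (simp add: g_eq)
  moreover have "((\<lambda>x. F 0) has_real_derivative 0) (at m)" by simp
  ultimately have "(1 * g m + deriv g m * m) / 2 + deriv F m = 0" by (rule DERIV_unique)
  then show ?thesis using m_pos by (simp add: g_m field_simps)
qed

lemma g_double_zero:
  assumes "deriv F m = 0"
  shows "g x = (x - m)\<^sup>2 * slope_from (slope_from g m) m x"
  using assms deriv_g_m g_m by (auto simp: slope_from_def power2_eq_square divide_simps)

lemma deriv_F_m_nonneg: "0 \<le> deriv F m"
proof (rule ccontr)
  assume "\<not> 0 \<le> deriv F m"
  then obtain d where d: "d > 0" "\<And>h. 0 < h \<Longrightarrow> h < d \<Longrightarrow> F m < F (m - h)"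
    using DERIV_neg_dec_left[OF real_analytic_on_DERIV[OF analytic UNIV_I], of m] by auto
  define h where "h = min d m / 2"
  have "0 < h" "h < d" "h < m" using d m_pos by (auto simp: h_def min_def)
  then show False using d(2)[of h] F_below[of "m - h"] F_m by auto
qed

text \<open>Positivity of \<open>g\<close> slightly beyond \<open>0\<close> lets the clock, and with it the arch, continue analytically
across the peak.\<close>

lemma g_pos_left: obtains e where "e > 0" "\<And>x. x \<in> {-e<..<m} \<Longrightarrow> 0 < g x"
proof -
  have "eventually (\<lambda>x. 0 < g x) (nhds 0)"
    using order_tendstoD(1)[OF _ g_0, of g] g_cont(1)[of 0] tendsto_at_iff_tendsto_nhds
    unfolding isCont_def by blast
  then obtain e where e: "e > 0" "\<And>x. dist x 0 < e \<Longrightarrow> 0 < g x"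
    unfolding eventually_nhds_metric by blast
  have "0 < g x" if "x \<in> {-e<..<m}" for x
    using that e(2)[of x] g_pos[of x] by (cases "x < 0") (auto simp: dist_real_def)
  with e(1) show thesis using that by blast
qed

end

text \<open>\<open>p y\<close> is the height of the wave at time \<open>y\<close> after its peak, and \<open>G x\<close> is the time of travel from \<open>0\<close> to the
height \<open>x\<close>.\<close>

locale solitary_wave = potential +
  fixes p G :: "real \<Rightarrow> real"
  assumes flat: "deriv F m = 0" and p_an: "real_analytic_on p {0..}" and p0: "p 0 = 0"
    and p_clock: "\<And>y. 0 < y \<Longrightarrow> p y \<in> {0<..<m} \<and> G (p y) = y"
    and p_DERIV: "\<And>y. 0 \<le> y \<Longrightarrow> (p has_real_derivative sqrt (g (p y))) (at y)"
    and dG: "\<And>x. x \<in> {0<..<m} \<Longrightarrow> (G has_real_derivative 1 / sqrt (g x)) (at x)"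
    and G0: "isCont G 0" "G 0 = 0"

text \<open>As before, but the crest is reached at the time \<open>\<tau>\<close>, and \<open>p\<close> describes the whole arch up to the next peak
at \<open>2 \<tau>\<close>.\<close>

locale periodic_wave = potential +
  fixes p G :: "real \<Rightarrow> real" and \<tau> :: real
  assumes \<tau>: "0 < \<tau>" and p_an: "real_analytic_on p {0..2 * \<tau>}" and p0: "p 0 = 0" and p\<tau>: "p \<tau> = m"
    and sym: "\<And>y. y \<in> {0..2 * \<tau>} \<Longrightarrow> p (2 * \<tau> - y) = p y"
    and p_clock: "\<And>y. y \<in> {0<..<\<tau>} \<Longrightarrow> p y \<in> {0<..<m} \<and> G (p y) = y"
    and p_sq: "\<And>y. y \<in> {0..2 * \<tau>} \<Longrightarrow> (deriv p y)\<^sup>2 = g (p y)"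
    and p_deriv: "\<And>y. y \<in> {0..<\<tau>} \<Longrightarrow> deriv p y = sqrt (g (p y))"
    and p2: "deriv (deriv p) \<tau> < 0"
    and dG: "\<And>x. x \<in> {0<..<m} \<Longrightarrow> (G has_real_derivative 1 / sqrt (g x)) (at x)"
    and G0: "isCont G 0" "G 0 = 0" and G\<tau>: "(G \<longlongrightarrow> \<tau>) (at_left m)"

lemma (in potential) ex_solitary_wave:
  assumes flat: "deriv F m = 0"
  obtains p G where "solitary_wave F m p G"
proof -
  obtain e where e: "e > 0" "\<And>x. x \<in> {-e<..<m} \<Longrightarrow> 0 < g x" using g_pos_left by blast
  have em: "ereal (- e) < ereal m" using e(1) m_pos by simp
  have "\<exists>G. \<forall>x. ereal (- e) < ereal x \<longrightarrow> ereal x < ereal m \<longrightarrow> (G has_vector_derivative 1 / sqrt (g x)) (at x)"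
  proof (rule einterval_antiderivative[OF em])
    fix x assume "ereal (- e) < ereal x" "ereal x < ereal m"
    then have "g x > 0" using e(2)[of x] by simp
    then show "isCont (\<lambda>x. 1 / sqrt (g x)) x" by (intro continuous_intros g_cont) simp
  qed
  then obtain G0 where G0: "\<And>x. x \<in> {-e<..<m} \<Longrightarrow> (G0 has_real_derivative 1 / sqrt (g x)) (at x)"
    by (auto simp: has_real_derivative_iff_has_vector_derivative)
  define G where "G x = G0 x - G0 0" for x
  have dG: "(G has_real_derivative 1 / sqrt (g x)) (at x)" if "x \<in> {-e<..<m}" for x
    unfolding G_def using DERIV_diff[OF G0[OF that] DERIV_const[of "G0 0"]] by simp
  have Gan: "real_analytic_on G {-e<..<m}"
  proof (rule real_analytic_on_antiderivative[OF _ _ dG])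
    show "real_analytic_on (\<lambda>x. 1 / sqrt (g x)) {-e<..<m}"
      by (intro real_analytic_on_divide real_analytic_on_const real_analytic_on_sqrt
          real_analytic_on_subset[OF g_analytic]) (use e(2) in \<open>auto simp: less_imp_neq[symmetric]\<close>)
  qed auto
  have dG': "deriv G x = 1 / sqrt (g x)" if "x \<in> {-e<..<m}" for x
    using dG[OF that] by (rule DERIV_imp_deriv)
  obtain Y where Y: "\<And>x. x \<in> {-e<..<m} \<Longrightarrow> Y (G x) = x" "real_analytic_on Y (G ` {-e<..<m})"
    "\<And>x. x \<in> {-e<..<m} \<Longrightarrow> (Y has_real_derivative inverse (deriv G x)) (at (G x))"
    "\<And>c d y. c \<in> {-e<..<m} \<Longrightarrow> d \<in> {-e<..<m} \<Longrightarrow> G c \<le> y \<Longrightarrow> y \<le> G d \<Longrightarrow> \<exists>x\<in>{c..d}. G x = y"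
    using increasing_analytic_inverse[OF Gan] dG' e(2) by (metis divide_pos_pos real_sqrt_gt_zero zero_less_one)
  have mono: "strict_mono_on {-e<..<m} G"
    by (rule strict_mono_on_clock[OF dG]) (use e(2) in auto)
  \<comment> \<open>\<open>g\<close> has at least a double zero at \<open>m\<close>, so the travel time diverges at least logarithmically.\<close>
  define q where "q = slope_from (slope_from g m) m"
  have q: "g x = (x - m)\<^sup>2 * q x" for x
    unfolding q_def using flat by (rule g_double_zero)
  have qan: "real_analytic_on q UNIV"
    unfolding q_def by (intro real_analytic_on_slope_from g_analytic) auto
  obtain C0 where C0: "\<And>x. x \<in> {0..m} \<Longrightarrow> \<bar>q x\<bar> \<le> C0"
  proof -
    have "compact (q ` {0..m})"
      using real_analytic_UNIV_continuous(2)[OF qan] by (intro compact_continuous_image) auto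
    then show thesis using that compact_imp_bounded bounded_iff by (metis imageI real_norm_def)
  qed
  define C where "C = sqrt (\<bar>C0\<bar> + 1)"
  have C: "C > 0" by (simp add: C_def)
  have le: "sqrt (g x) \<le> C * (m - x)" if "x \<in> {0..<m}" for x
  proof -
    have "g x \<le> (x - m)\<^sup>2 * (\<bar>C0\<bar> + 1)"
      unfolding q by (rule mult_left_mono) (use C0[of x] that in auto)
    then have "sqrt (g x) \<le> sqrt ((x - m)\<^sup>2 * (\<bar>C0\<bar> + 1))" by simp
    also have "\<dots> = C * (m - x)" using that by (simp add: real_sqrt_mult C_def)
    finally show ?thesis .
  qed
  have unbdd: "\<exists>x\<in>{0..<m}. y \<le> G x" if "0 \<le> y" for y
  proof -
    \<comment> \<open>chosen such that the lower bound \<open>- ln (1 - x / m) / C\<close> of the clock equals \<open>y\<close>\<close>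
    define x where "x = m * (1 - exp (- C * y))"
    have "exp (- C * y) \<le> 1" "exp (- C * y) > 0" using C that by auto
    then have x: "x \<in> {0..<m}" using m_pos by (auto simp: x_def mult_less_cancel_left1)
    have "G 0 + ln (m - 0) / C \<le> G x + ln (m - x) / C"
    proof (rule DERIV_nonneg_imp_nondecreasing[where f = "\<lambda>z. G z + ln (m - z) / C"])
      show "0 \<le> x" using x by simp
      fix z assume z: "0 \<le> z" "z \<le> x"
      have zm: "z \<in> {0..<m}" "z \<in> {-e<..<m}" using z x e(1) by auto
      have "((\<lambda>z. G z + ln (m - z) / C) has_real_derivative 1 / sqrt (g z) + (0 - 1) / (m - z) / C) (at z)"
        using zm C by (auto intro!: derivative_eq_intros dG)
      moreover have "1 / (C * (m - z)) \<le> 1 / sqrt (g z)"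
        using le[OF zm(1)] e(2)[OF zm(2)] by (intro divide_left_mono) (use C zm in auto)
      then have "0 \<le> 1 / sqrt (g z) + (0 - 1) / (m - z) / C" by (simp add: mult.commute)
      ultimately show "\<exists>D. ((\<lambda>z. G z + ln (m - z) / C) has_real_derivative D) (at z) \<and> 0 \<le> D" by blast
    qed
    moreover have "ln (m - x) = ln m - C * y"
      using m_pos by (simp add: x_def algebra_simps ln_mult)
    ultimately have "C * y \<le> C * G x" using C by (simp add: G_def field_simps)
    then have "y \<le> G x" using C by simp
    then show ?thesis using x by blast
  qed
  have G0: "G 0 = 0" by (simp add: G_def)
  have onto: "\<exists>x\<in>{0..<m}. G x = y" if y: "0 \<le> y" for y
  proof -
    obtain d where d: "d \<in> {0..<m}" "y \<le> G d" using unbdd[OF y] by blast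
    then obtain x where "x \<in> {0..d}" "G x = y"
      using Y(4)[of 0 d y] y G0 e(1) m_pos by auto
    then show ?thesis using d by auto
  qed
  show thesis
  proof (rule that[of Y G], unfold_locales)
    show "real_analytic_on Y {0..}"
      by (rule real_analytic_on_subset[OF Y(2)]) (use onto e(1) in force)
    show Y0: "Y 0 = 0" using Y(1)[of 0] G0 e(1) m_pos by simp
    show "Y y \<in> {0<..<m} \<and> G (Y y) = y" if "0 < y" for y
    proof -
      obtain x where x: "x \<in> {0..<m}" "G x = y" using onto[of y] \<open>0 < y\<close> by auto
      moreover have "x \<noteq> 0" using x G0 that by auto
      moreover have "Y (G x) = x" using x e(1) by (intro Y(1)) auto
      ultimately show ?thesis by auto
    qed
    show "(Y has_real_derivative sqrt (g (Y y))) (at y)" if "0 \<le> y" for y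
    proof -
      obtain x where x: "x \<in> {0..<m}" "G x = y" using onto[OF \<open>0 \<le> y\<close>] by blast
      then have xe: "x \<in> {-e<..<m}" using e(1) by auto
      show ?thesis using Y(3)[OF xe] dG'[OF xe] Y(1)[OF xe] x(2) by simp
    qed
    show "(G has_real_derivative 1 / sqrt (g x)) (at x)" if "x \<in> {0<..<m}" for x
      by (rule dG) (use that e(1) in auto)
    show "isCont G 0" by (rule DERIV_isCont[OF dG]) (use e(1) m_pos in auto)
  qed (simp_all add: G0 flat)
qed

text \<open>The clock \<open>G\<close> has a square-root singularity at the crest, which disappears in the coordinate \<open>y\<close> with
\<open>u = m - y\<^sup>2\<close>. There \<open>g u = y\<^sup>2 K y\<close> with \<open>K\<close> even and positive, and the clock is the odd function \<open>H\<close> with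
\<open>H' = 2 / sqrt K\<close>, measured from the crest. Its inverse \<open>Y\<close> is analytic, and \<open>p y = m - (Y (y - \<tau>))\<^sup>2\<close>.\<close>

lemma (in potential) ex_periodic_wave:
  assumes steep: "deriv F m \<noteq> 0"
  obtains p G \<tau> where "periodic_wave F m p G \<tau>"
proof -
  define k where "k z = - slope_from g m (m - z)" for z
  have k: "z * k z = g (m - z)" for z
    using g_m by (auto simp: k_def slope_from_def)
  have kan: "real_analytic_on k UNIV"
  proof -
    have "real_analytic_on (slope_from g m) ((\<lambda>z. m - z) ` UNIV)"
      by (rule real_analytic_on_subset[OF real_analytic_on_slope_from[OF g_analytic UNIV_I]]) simp
    from real_analytic_on_compose[OF real_analytic_on_diff[OF real_analytic_on_const real_analytic_on_ident] this]
    show ?thesis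
      unfolding k_def by (rule real_analytic_on_minus)
  qed
  have k_pos: "0 < k z" if "z \<in> {0..m}" for z
  proof (cases "z = 0")
    case True
    then show ?thesis using steep deriv_F_m_nonneg m_pos deriv_g_m by (simp add: k_def slope_from_def)
  next
    case False
    then have "0 < z * k z" unfolding k using that by (intro g_pos) auto
    then show ?thesis using False that by (simp add: zero_less_mult_iff)
  qed
  define K where "K y = k (y * y)" for y
  have Kan: "real_analytic_on K UNIV"
    unfolding K_def
    by (intro real_analytic_on_compose[OF _ real_analytic_on_subset[OF kan]] real_analytic_on_mult real_analytic_on_ident) simp
  define r where "r = sqrt m"
  have r: "r > 0" "r * r = m" using m_pos by (auto simp: r_def)
  have K_pos0: "0 < K y" if "\<bar>y\<bar> \<le> r" for y
  proof -
    have "y * y \<le> m" using mult_mono[OF that that] r by simp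
    then show ?thesis unfolding K_def by (intro k_pos) auto
  qed
  have "eventually (\<lambda>y. 0 < K y) (nhds r)"
    using order_tendstoD(1)[of K "K r" "nhds r" 0] K_pos0[of r] r(1)
      real_analytic_UNIV_continuous(1)[OF Kan, of r] tendsto_at_iff_tendsto_nhds[of K r]
    by (simp add: isCont_def)
  then obtain \<delta> where \<delta>: "\<delta> > 0" "\<And>y. dist y r < \<delta> \<Longrightarrow> 0 < K y"
    unfolding eventually_nhds_metric by blast
  define R where "R = r + \<delta>"
  have R: "r < R" "0 < R" using \<delta>(1) r(1) by (auto simp: R_def)
  have K_pos: "0 < K y" if "y \<in> {-R<..<R}" for y
  proof (cases "\<bar>y\<bar> \<le> r")
    case False
    then have "0 < K \<bar>y\<bar>" using that by (intro \<delta>(2)) (auto simp: R_def dist_real_def)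
    then show ?thesis by (simp add: K_def)
  qed (rule K_pos0)
  have "\<exists>H. \<forall>x. ereal (- R) < ereal x \<longrightarrow> ereal x < ereal R \<longrightarrow> (H has_vector_derivative 2 / sqrt (K x)) (at x)"
  proof (rule einterval_antiderivative)
    fix x assume "ereal (- R) < ereal x" "ereal x < ereal R"
    then have "K x > 0" using K_pos[of x] by simp
    then show "isCont (\<lambda>x. 2 / sqrt (K x)) x"
      by (intro continuous_intros real_analytic_UNIV_continuous(1)[OF Kan]) simp
  qed (use R in simp)
  then obtain H0 where H0: "\<And>x. x \<in> {-R<..<R} \<Longrightarrow> (H0 has_real_derivative 2 / sqrt (K x)) (at x)"
    by (auto simp: has_real_derivative_iff_has_vector_derivative)
  define H where "H x = H0 x - H0 0" for x
  have dH: "(H has_real_derivative 2 / sqrt (K x)) (at x)" if "x \<in> {-R<..<R}" for x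
    unfolding H_def using DERIV_diff[OF H0[OF that] DERIV_const[of "H0 0"]] by simp
  have H_0: "H 0 = 0" by (simp add: H_def)
  have dH': "deriv H x = 2 / sqrt (K x)" if "x \<in> {-R<..<R}" for x
    using dH[OF that] by (rule DERIV_imp_deriv)
  have Han: "real_analytic_on H {-R<..<R}"
  proof (rule real_analytic_on_antiderivative[OF _ _ dH])
    show "real_analytic_on (\<lambda>x. 2 / sqrt (K x)) {-R<..<R}"
      by (intro real_analytic_on_divide real_analytic_on_const real_analytic_on_sqrt
          real_analytic_on_subset[OF Kan]) (use K_pos in \<open>auto simp: less_imp_neq[symmetric]\<close>)
  qed auto
  have mono: "strict_mono_on {-R<..<R} H"
    by (rule strict_mono_on_clock[OF dH]) (use K_pos in auto)
  have odd: "H (- y) = - H y" if y: "y \<in> {-R<..<R}" for y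
  proof -
    have "((\<lambda>y. H y + H (- y)) has_real_derivative 0) (at x within {-R<..<R})" if x: "x \<in> {-R<..<R}" for x
    proof -
      have "((\<lambda>y. H (- y)) has_real_derivative 2 / sqrt (K (- x)) * - 1) (at x)"
        by (rule DERIV_chain2[OF dH]) (use x in \<open>auto intro!: derivative_eq_intros\<close>)
      then have "((\<lambda>y. H y + H (- y)) has_real_derivative 2 / sqrt (K x) + 2 / sqrt (K (- x)) * - 1) (at x)"
        by (rule DERIV_add[OF dH[OF x]])
      then show ?thesis by (simp add: K_def has_field_derivative_at_within)
    qed
    then obtain c where c: "\<And>x. x \<in> {-R<..<R} \<Longrightarrow> H x + H (- x) = c"
      using has_field_derivative_zero_constant[of "{-R<..<R}" "\<lambda>y. H y + H (- y)"] by auto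
    show ?thesis using c[of 0] c[OF y] H_0 R by auto
  qed
  obtain Y where Y: "\<And>x. x \<in> {-R<..<R} \<Longrightarrow> Y (H x) = x" "real_analytic_on Y (H ` {-R<..<R})"
    "\<And>x. x \<in> {-R<..<R} \<Longrightarrow> (Y has_real_derivative inverse (deriv H x)) (at (H x))"
    "\<And>c d y. c \<in> {-R<..<R} \<Longrightarrow> d \<in> {-R<..<R} \<Longrightarrow> H c \<le> y \<Longrightarrow> y \<le> H d \<Longrightarrow> \<exists>x\<in>{c..d}. H x = y"
    using increasing_analytic_inverse[OF Han] dH' K_pos
    by (metis divide_pos_pos real_sqrt_gt_zero zero_less_numeral)
  define \<tau> where "\<tau> = H r"
  have \<tau>: "\<tau> > 0"
    using strict_mono_onD[OF mono, of 0 r] r R by (simp add: \<tau>_def H_0)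
  define p where "p y = m - Y (y - \<tau>) * Y (y - \<tau>)" for y
  have x_of: "\<exists>x\<in>{-r..r}. H x = y - \<tau>" if "y \<in> {0..2 * \<tau>}" for y
    using Y(4)[of "- r" r "y - \<tau>"] odd[of r] that r R by (auto simp: \<tau>_def)
  have p_x: "p (H x + \<tau>) = m - x * x" if "x \<in> {-R<..<R}" for x
    using Y(1)[OF that] by (simp add: p_def)
  have dp_x: "(p has_real_derivative - (x * sqrt (K x))) (at (H x + \<tau>))" if x: "x \<in> {-R<..<R}" for x
  proof -
    have dY: "(Y has_real_derivative sqrt (K x) / 2) (at (H x))"
      using Y(3)[OF x] dH'[OF x] by simp
    have "((\<lambda>y. Y (y - \<tau>)) has_real_derivative sqrt (K x) / 2 * 1) (at (H x + \<tau>))"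
      by (rule DERIV_chain2[where f = Y]) (use dY in \<open>auto intro!: derivative_eq_intros\<close>)
    from DERIV_diff[OF DERIV_const[of m] DERIV_mult[OF this this]] show ?thesis
      using Y(1)[OF x] by (simp add: p_def[abs_def])
  qed
  have x_g: "(x * sqrt (K x))\<^sup>2 = g (m - x * x)" if "x \<in> {-R<..<R}" for x
    using K_pos[OF that] k[of "x * x"] by (simp add: power_mult_distrib K_def) (simp add: power2_eq_square)
  define G where "G x = \<tau> - H (sqrt (m - x))" for x
  have dG: "(G has_real_derivative 1 / sqrt (g x)) (at x)" if x: "x \<in> {0..<m}" for x
  proof -
    define y where "y = sqrt (m - x)"
    have y: "y > 0" "y * y = m - x" "y \<le> r" using x by (auto simp: y_def r_def)
    have "((\<lambda>x. sqrt (m - x)) has_real_derivative inverse y / 2 * (0 - 1)) (at x)"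
      unfolding y_def by (rule DERIV_chain2[OF DERIV_real_sqrt]) (use x in \<open>auto intro!: derivative_eq_intros\<close>)
    then have "((\<lambda>x. H (sqrt (m - x))) has_real_derivative 2 / sqrt (K y) * (inverse y / 2 * (0 - 1))) (at x)"
      unfolding y_def by (rule DERIV_chain2[OF dH, rotated]) (use y R in \<open>auto simp: y_def[symmetric]\<close>)
    from DERIV_diff[OF DERIV_const[of \<tau>] this]
    have "(G has_real_derivative 1 / (y * sqrt (K y))) (at x)"
      by (simp add: G_def[abs_def] field_simps)
    also have "y * sqrt (K y) = sqrt (g x)"
    proof (rule real_sqrt_unique[symmetric])
      show "(y * sqrt (K y))\<^sup>2 = g x" using x_g[of y] y R by auto
      show "0 \<le> y * sqrt (K y)" using y R K_pos[of y] by simp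
    qed
    finally show ?thesis .
  qed
  show thesis
  proof (rule that[of p G \<tau>], unfold_locales)
    show "real_analytic_on p {0..2 * \<tau>}"
    proof -
      have "(\<lambda>y. y - \<tau>) ` {0..2 * \<tau>} \<subseteq> H ` {-R<..<R}"
      proof
        fix z assume "z \<in> (\<lambda>y. y - \<tau>) ` {0..2 * \<tau>}"
        then obtain x where "x \<in> {-r..r}" "H x = z" using x_of by blast
        then show "z \<in> H ` {-R<..<R}" using R by auto
      qed
      then have "real_analytic_on (\<lambda>y. Y (y - \<tau>)) {0..2 * \<tau>}"
        by (intro real_analytic_on_compose[OF real_analytic_on_diff[OF real_analytic_on_ident real_analytic_on_const]
            real_analytic_on_subset[OF Y(2)]])
      then show ?thesis
        unfolding p_def by (intro real_analytic_on_diff real_analytic_on_const real_analytic_on_mult)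
    qed
    show "p 0 = 0" using p_x[of "- r"] odd[of r] r R by (simp add: \<tau>_def)
    show "p \<tau> = m" using p_x[of 0] H_0 R by simp
    show "p (2 * \<tau> - y) = p y" if y: "y \<in> {0..2 * \<tau>}" for y
    proof -
      obtain x where x: "x \<in> {-r..r}" "H x = y - \<tau>" using x_of[OF y] by blast
      then have "p y = m - x * x" "p (H (- x) + \<tau>) = m - x * x"
        using p_x[of x] p_x[of "- x"] R by auto
      moreover have "H (- x) + \<tau> = 2 * \<tau> - y" using odd[of x] x R by auto
      ultimately show ?thesis by simp
    qed
    show "p y \<in> {0<..<m} \<and> G (p y) = y" if y: "y \<in> {0<..<\<tau>}" for y
    proof -
      obtain x where x: "x \<in> {-r..r}" "H x = y - \<tau>" using x_of[of y] y by auto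
      have xR: "x \<in> {-R<..<R}" using x R by auto
      have py: "p y = m - x * x" using p_x[OF xR] x(2) by simp
      have "H x < H 0" "H (- r) < H x" using y x(2) H_0 odd[of r] r R by (auto simp: \<tau>_def)
      then have "x < 0" "- r < x"
        using strict_mono_on_less[OF mono, of x 0] strict_mono_on_less[OF mono, of "- r" x] xR r R by auto
      then have "0 < x * x" "x * x < r * r"
        using mult_strict_mono[of "- x" r "- x" r] by (auto simp: mult_neg_neg)
      moreover have "sqrt (m - p y) = - x"
        using \<open>x < 0\<close> by (simp add: py)
      ultimately show ?thesis
        using odd[OF xR] x(2) r(2) by (simp add: G_def py)
    qed
    show "(deriv p y)\<^sup>2 = g (p y)" if y: "y \<in> {0..2 * \<tau>}" for y
    proof -
      obtain x where x: "x \<in> {-r..r}" "H x = y - \<tau>" using x_of[OF y] by blast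
      then have xR: "x \<in> {-R<..<R}" using R by auto
      show ?thesis
        using DERIV_imp_deriv[OF dp_x[OF xR]] p_x[OF xR] x_g[OF xR] x(2) by simp
    qed
    show "deriv p y = sqrt (g (p y))" if y: "y \<in> {0..<\<tau>}" for y
    proof -
      obtain x where x: "x \<in> {-r..r}" "H x = y - \<tau>" using x_of[of y] y by auto
      then have xR: "x \<in> {-R<..<R}" using R by auto
      have "H x < H 0" using y x(2) H_0 by auto
      then have "x < 0" using strict_mono_on_less[OF mono, of x 0] xR R by auto
      then have "sqrt (g (p y)) = - (x * sqrt (K x))"
        using x_g[OF xR] p_x[OF xR] x(2) K_pos[OF xR]
        by (intro real_sqrt_unique) (auto simp: mult_nonpos_nonneg)
      then show ?thesis
        using DERIV_imp_deriv[OF dp_x[OF xR]] x(2) by simp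
    qed
    show "deriv (deriv p) \<tau> < 0"
    proof -
      have K0: "0 < K 0" using K_pos[of 0] R by simp
      have Y0: "Y 0 = 0" using Y(1)[of 0] H_0 R by simp
      have dY: "(Y has_real_derivative sqrt (K 0) / 2) (at 0)"
        using Y(3)[of 0] dH'[of 0] H_0 R by simp
      have dY\<tau>: "((\<lambda>y. Y (y - \<tau>)) has_real_derivative sqrt (K 0) / 2 * 1) (at \<tau>)"
        by (rule DERIV_chain2[where f = Y]) (use dY in \<open>auto intro!: derivative_eq_intros\<close>)
      have "real_analytic_on (\<lambda>x. sqrt (K x)) {0}"
        using K0 by (intro real_analytic_on_sqrt real_analytic_on_subset[OF Kan]) auto
      from real_analytic_on_DERIV[OF this, of 0]
      have dsK: "((\<lambda>x. sqrt (K x)) has_real_derivative deriv (\<lambda>x. sqrt (K x)) 0) (at (Y (\<tau> - \<tau>)))"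
        using Y0 by simp
      have "((\<lambda>y. - (Y (y - \<tau>) * sqrt (K (Y (y - \<tau>))))) has_real_derivative - (K 0 / 2)) (at \<tau>)"
        using DERIV_minus[OF DERIV_mult[OF dY\<tau> DERIV_chain2[OF dsK dY\<tau>]]] Y0 K0 by simp
      moreover have "eventually (\<lambda>y. - (Y (y - \<tau>) * sqrt (K (Y (y - \<tau>)))) = deriv p y) (nhds \<tau>)"
      proof -
        have "eventually (\<lambda>y. y \<in> {0<..<2 * \<tau>}) (nhds \<tau>)"
          using \<tau> by (intro eventually_nhds_in_open) auto
        then show ?thesis
        proof eventually_elim
          case (elim y)
          then obtain x where x: "x \<in> {-r..r}" "H x = y - \<tau>" using x_of[of y] by auto
          then have xR: "x \<in> {-R<..<R}" using R by auto
          show ?case using DERIV_imp_deriv[OF dp_x[OF xR]] Y(1)[OF xR] x(2) by simp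
        qed
      qed
      ultimately have "(deriv p has_real_derivative - (K 0 / 2)) (at \<tau>)"
        by (rule DERIV_transform_ev)
      then show ?thesis using K0 by (simp add: DERIV_imp_deriv)
    qed
    show "(G has_real_derivative 1 / sqrt (g x)) (at x)" if "x \<in> {0<..<m}" for x
      by (rule dG) (use that in auto)
    show "isCont G 0" by (rule DERIV_isCont[OF dG]) (use m_pos in auto)
    show "G 0 = 0" by (simp add: G_def \<tau>_def r_def)
    have "isCont H (sqrt (m - m))" using DERIV_isCont[OF dH[of 0]] R by simp
    then have "isCont G m"
      unfolding G_def by (intro continuous_intros isCont_o2[where f = "\<lambda>x. sqrt (m - x)" and g = H]) auto
    then show "(G \<longlongrightarrow> \<tau>) (at_left m)"
      by (simp add: isCont_def filterlim_at_split G_def H_0)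
  qed (rule \<tau>)
qed

section \<open>The shape of a profile\<close>

lemma wave_profile_eventually_off:
  assumes "wave_profile g u S"
  shows "t \<notin> S \<Longrightarrow> eventually (\<lambda>r. r \<notin> S) (nhds t)" "eventually (\<lambda>r. r \<notin> S) (at t)"
proof -
  show "t \<notin> S \<Longrightarrow> eventually (\<lambda>r. r \<notin> S) (nhds t)"
    using eventually_nhds_in_open[of "- S" t] wave_profileD(2)[OF assms] by (simp add: closed_def)
  have "finite (S \<inter> {t-1..t+1})" by (rule wave_profileD(3)[OF assms])
  then have "open (- (S \<inter> {t-1..t+1} - {t}))" by (intro open_Compl finite_imp_closed) simp
  then have "eventually (\<lambda>r. r \<in> - (S \<inter> {t-1..t+1} - {t})) (nhds t)"
    by (intro eventually_nhds_in_open) auto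
  moreover have "eventually (\<lambda>r. r \<in> {t-1<..<t+1}) (nhds t)"
    by (intro eventually_nhds_in_open) auto
  ultimately have "eventually (\<lambda>r. r \<noteq> t \<longrightarrow> r \<notin> S) (nhds t)"
    by eventually_elim auto
  then show "eventually (\<lambda>r. r \<notin> S) (at t)" by (simp add: eventually_at_filter)
qed

lemma wave_profile_reflect:
  assumes prof: "wave_profile g u S"
  shows "wave_profile g (\<lambda>t. u (- t)) (uminus ` S)"
proof -
  note P = wave_profileD[OF prof]
  let ?v = "\<lambda>t. u (- t)"
  have mem: "t \<in> uminus ` S \<longleftrightarrow> - t \<in> S" for t by force
  have d1: "(?v has_real_derivative - deriv u (- t)) (at t)" if "- t \<notin> S" for t
    using P(8)[OF that] by (simp add: DERIV_mirror)
  then have e1: "deriv ?v t = - deriv u (- t)" if "- t \<notin> S" for t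
    using that by (simp add: DERIV_imp_deriv)
  have near: "eventually (\<lambda>r. - r \<notin> S) (nhds t)" if "- t \<notin> S" for t
    using wave_profile_eventually_off(1)[OF prof that]
    by (rule eventually_compose_filterlim) (rule tendsto_minus[OF filterlim_ident])
  have d2: "(deriv ?v has_real_derivative deriv (deriv u) (- t)) (at t)" if t: "- t \<notin> S" for t
  proof (rule DERIV_transform_ev)
    have "((\<lambda>r. deriv u (- r)) has_real_derivative - deriv (deriv u) (- t)) (at t)"
      using P(9)[OF t] by (simp add: DERIV_mirror)
    from DERIV_minus[OF this]
    show "((\<lambda>r. - deriv u (- r)) has_real_derivative deriv (deriv u) (- t)) (at t)" by simp
    show "eventually (\<lambda>r. - deriv u (- r) = deriv ?v r) (nhds t)"
      using near[OF t] by eventually_elim (simp add: e1)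
  qed
  then have e2: "deriv (deriv ?v) t = deriv (deriv u) (- t)" if "- t \<notin> S" for t
    using that by (simp add: DERIV_imp_deriv)
  have off: "eventually (\<lambda>r. - r \<notin> S) (at_right s)" "eventually (\<lambda>r. - r \<notin> S) (at_left s)" for s
    using wave_profile_eventually_off(2)[OF prof, of "- s"]
    by (auto simp: eventually_at_split at_right_minus[of s] at_left_minus[of s] eventually_filtermap)
  show ?thesis
    unfolding wave_profile_def
  proof (intro conjI ballI allI impI)
    show "continuous_on UNIV ?v"
      by (intro continuous_at_imp_continuous_on ballI isCont_o2[OF _ P(1)]) (auto intro: continuous_intros)
    show "closed (uminus ` S)" using P(2) by (rule closed_negations)
    show "finite (uminus ` S \<inter> {a..b})" for a b
    proof -
      have "uminus ` S \<inter> {a..b} = uminus ` (S \<inter> {-b..-a})" by force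
      then show ?thesis using P(3) by simp
    qed
  next
    fix s assume s: "s \<in> uminus ` S"
    then have sS: "- s \<in> S" by (simp add: mem)
    then show "u (- s) = 0" by (rule P(4))
    have "((\<lambda>r. - deriv u (- r)) \<longlongrightarrow> - (- sqrt (g 0))) (at_right s)"
      using P(6)[OF sS] by (intro tendsto_minus) (simp add: filterlim_at_left_to_right)
    then have "((\<lambda>r. - deriv u (- r)) \<longlongrightarrow> sqrt (g 0)) (at_right s)" by simp
    then show "(deriv ?v \<longlongrightarrow> sqrt (g 0)) (at_right s)"
      using off(1)[of s] by (elim Lim_transform_eventually) (auto elim!: eventually_mono simp: e1)
    have "((\<lambda>r. - deriv u (- r)) \<longlongrightarrow> - sqrt (g 0)) (at_left s)"
      using P(5)[OF sS] by (intro tendsto_minus) (simp add: at_left_minus[of s] filterlim_filtermap)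
    then show "(deriv ?v \<longlongrightarrow> - sqrt (g 0)) (at_left s)"
      using off(2)[of s] by (elim Lim_transform_eventually)
        (auto elim!: eventually_mono simp: e1)
  next
    fix t assume "t \<notin> uminus ` S"
    then have t: "- t \<notin> S" by (simp add: mem)
    show "0 < u (- t)" using P(7)[OF t] .
    show "(?v has_real_derivative deriv ?v t) (at t)" using d1[OF t] e1[OF t] by simp
    show "(deriv ?v has_real_derivative deriv (deriv ?v) t) (at t)" using d2[OF t] e2[OF t] by simp
    have "isCont (\<lambda>r. deriv (deriv u) (- r)) t"
      by (rule isCont_o2[where f = uminus and g = "deriv (deriv u)"]) (use P(10)[OF t] in \<open>auto intro: continuous_intros\<close>)
    then show "isCont (deriv (deriv ?v)) t"
      by (subst isCont_cong[where g = "\<lambda>r. deriv (deriv u) (- r)"])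
        (use near[OF t] in \<open>auto elim!: eventually_mono simp: e2\<close>)
    show "(deriv ?v t)\<^sup>2 = g (u (- t))" using P(11)[OF t] e1[OF t] by simp
  qed
qed

context potential
begin

text \<open>The arc law with \<open>\<sigma> = 1\<close>, started at a peak, says that \<open>u t\<close> and \<open>p (t - s)\<close> show the same time on the
clock, which is injective.\<close>

lemma wave_profile_rise:
  assumes prof: "wave_profile g u S" and s: "s \<in> S" and b: "0 < b"
    and dG: "\<And>x. x \<in> {0<..<m} \<Longrightarrow> (G has_real_derivative 1 / sqrt (g x)) (at x)"
    and G0: "isCont G 0" "G 0 = 0"
    and p_clock: "\<And>y. y \<in> {0<..<b} \<Longrightarrow> p y \<in> {0<..<m} \<and> G (p y) = y"
    and t: "t \<in> {s<..<s+b}"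
  shows "t \<notin> S \<and> u t = p (t - s)"
proof -
  note P = wave_profileD[OF prof]
  have mono: "strict_mono_on {0<..<m} G"
    by (rule strict_mono_on_clock[OF dG]) (use g_pos in auto)
  have u0: "(u \<longlongrightarrow> 0) (at_right s)"
    using P(1)[of s] P(4)[OF s] by (simp add: isCont_def filterlim_at_split)
  have off: "eventually (\<lambda>t. t \<notin> S) (at_right s)"
    using wave_profile_eventually_off(2)[OF prof, of s] by (simp add: eventually_at_split)
  have "eventually (\<lambda>t. 0 < deriv u t) (at_right s)"
    by (rule order_tendstoD(1)[OF P(5)[OF s]]) (use g_0 in simp)
  moreover have "eventually (\<lambda>t. u t < m) (at_right s)"
    by (rule order_tendstoD(2)[OF u0 m_pos])
  ultimately have start: "eventually (\<lambda>t. t \<notin> S \<and> u t \<in> {0<..<m} \<and> 0 < 1 * deriv u t) (at_right s)"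
    using off by eventually_elim (use P(7) in auto)
  have lim: "((\<lambda>t. G (u t)) \<longlongrightarrow> 0) (at_right s)"
    using isCont_tendsto_compose[OF G0(1) u0] G0(2) by simp
  have "\<exists>x\<in>{0<..<m}. G x = 0 + 1 * (t - s)" if "t \<in> {s<..<s+b}" for t
    using p_clock[of "t - s"] that by (intro bexI[of _ "p (t - s)"]) auto
  from wave_profile_arc[OF prof g_m _ dG _ _ start lim this t]
  have *: "t \<notin> S" "u t \<in> {0<..<m}" "G (u t) = t - s" using g_pos b by auto
  moreover have "p (t - s) \<in> {0<..<m}" "G (p (t - s)) = t - s" using p_clock[of "t - s"] t by auto
  ultimately show ?thesis
    using strict_mono_on_eqD[OF mono, of "u t" "p (t - s)"] by auto
qed

end

lemma (in solitary_wave) solitary_profile: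
  assumes prof: "wave_profile g u S" and s: "s \<in> S"
  shows "S = {s}" "u t = p \<bar>t - s\<bar>"
proof -
  have right: "t \<notin> S \<and> u t = p (t - s)" if "t > s" for t
    by (rule wave_profile_rise[OF prof s _ dG G0, of "t - s + 1"]) (use p_clock that in auto)
  have left: "t \<notin> S \<and> u t = p (s - t)" if "t < s" for t
  proof -
    have "- t \<notin> uminus ` S \<and> u (- (- t)) = p (- t - (- s))"
      by (rule wave_profile_rise[OF wave_profile_reflect[OF prof] _ _ dG G0, of "- s" "s - t + 1" p "- t"])
        (use p_clock s that in auto)
    then show ?thesis by force
  qed
  show "S = {s}"
  proof
    show "S \<subseteq> {s}"
    proof
      fix t assume "t \<in> S"
      then show "t \<in> {s}" using left[of t] right[of t] by (cases t s rule: linorder_cases) auto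
    qed
  qed (use s in simp)
  show "u t = p \<bar>t - s\<bar>"
    using left[of t] right[of t] wave_profileD(4)[OF prof s] p0 by (cases t s rule: linorder_cases) auto
qed

text \<open>Between the peak and the crest \<open>u\<close> follows \<open>p\<close>. The second derivative of \<open>u\<close> is continuous at the crest,
so it equals that of \<open>p\<close> and is negative; hence \<open>u\<close> cannot rest at the level \<open>m\<close>, and the arc law with
\<open>\<sigma> = - 1\<close> takes it down to \<open>0\<close>. A zero is a peak.\<close>

lemma (in periodic_wave) periodic_profile_step:
  assumes prof: "wave_profile g u S" and s: "s \<in> S"
  shows "s + 2 * \<tau> \<in> S" "x \<in> {0..2 * \<tau>} \<Longrightarrow> u (s + x) = p x"
proof -
  note P = wave_profileD[OF prof]
  have mono: "strict_mono_on {0<..<m} G"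
    by (rule strict_mono_on_clock[OF dG]) (use g_pos in auto)
  have rise: "t \<notin> S \<and> u t = p (t - s)" if "t \<in> {s<..<s+\<tau>}" for t
    by (rule wave_profile_rise[OF prof s \<tau> dG G0]) (use p_clock that in auto)
  note Dp = real_analytic_on_DERIV[OF p_an] real_analytic_on_DERIV[OF real_analytic_on_deriv[OF p_an]]
    real_analytic_on_DERIV[OF real_analytic_on_deriv[OF real_analytic_on_deriv[OF p_an]]]
  have cp: "isCont p y" "isCont (deriv (deriv p)) y" if "y \<in> {0..2 * \<tau>}" for y
    using Dp(1,3)[OF that] by (auto intro: DERIV_isCont)
  define T where "T = s + \<tau>"
  have shift: "((\<lambda>t. f (t - s)) \<longlongrightarrow> f \<tau>) (at_left T)" if "isCont f \<tau>" for f :: "real \<Rightarrow> real"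
    using that by (rule isCont_tendsto_compose) (auto simp: T_def intro!: tendsto_eq_intros)
  have near: "eventually (\<lambda>t. t \<in> {s<..<T}) (at_left T)"
    using \<tau> by (intro eventually_at_left_real) (auto simp: T_def)
  have \<tau>I: "\<tau> \<in> {0..2 * \<tau>}" using \<tau> by simp
  have uT: "u T = m"
  proof -
    have "eventually (\<lambda>t. p (t - s) = u t) (at_left T)"
      using near by eventually_elim (use rise in \<open>auto simp: T_def\<close>)
    from Lim_transform_eventually[OF shift[OF cp(1)[OF \<tau>I]] this]
    have "(u \<longlongrightarrow> m) (at_left T)" by (simp add: p\<tau>)
    moreover have "(u \<longlongrightarrow> u T) (at_left T)"
      using P(1)[of T] by (simp add: isCont_def filterlim_at_split)
    ultimately show ?thesis using tendsto_unique trivial_limit_at_left_real by metis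
  qed
  have TS: "T \<notin> S" using P(4)[of T] uT m_pos by auto
  have duT: "deriv u T = 0" using P(11)[OF TS] uT g_m by simp
  \<comment> \<open>At the crest \<open>u''\<close> is inherited from the rising side; it is negative, so \<open>u\<close> has to turn.\<close>
  have dduT: "deriv (deriv u) T = deriv (deriv p) \<tau>"
  proof -
    have ev1: "eventually (\<lambda>r. p (r - s) = u r) (nhds t)" if t: "t \<in> {s<..<T}" for t
    proof -
      have "eventually (\<lambda>r. r \<in> {s<..<T}) (nhds t)"
        using t by (intro eventually_nhds_in_open) auto
      then show ?thesis by eventually_elim (use rise in \<open>auto simp: T_def\<close>)
    qed
    have in_dom: "t - s \<in> {0..2 * \<tau>}" if "t \<in> {s<..<T}" for t using that by (auto simp: T_def)
    have sh: "((\<lambda>r. f (r - s)) has_real_derivative D) (at t)" if "(f has_real_derivative D) (at (t - s))"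
      for f :: "real \<Rightarrow> real" and D t
    proof -
      have "((\<lambda>r. r - s) has_real_derivative 1) (at t)" by (auto intro!: derivative_eq_intros)
      from DERIV_chain2[where f = f and g = "\<lambda>r. r - s", OF that this] show ?thesis by simp
    qed
    have d1: "deriv u t = deriv p (t - s)" if "t \<in> {s<..<T}" for t
      using DERIV_transform_ev[OF sh[OF Dp(1)[OF in_dom[OF that]]] ev1[OF that]] by (rule DERIV_imp_deriv)
    have ev2: "eventually (\<lambda>r. deriv p (r - s) = deriv u r) (nhds t)" if t: "t \<in> {s<..<T}" for t
    proof -
      have "eventually (\<lambda>r. r \<in> {s<..<T}) (nhds t)"
        using t by (intro eventually_nhds_in_open) auto
      then show ?thesis by eventually_elim (simp add: d1)
    qed
    have d2: "deriv (deriv u) t = deriv (deriv p) (t - s)" if "t \<in> {s<..<T}" for t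
      using DERIV_transform_ev[OF sh[OF Dp(2)[OF in_dom[OF that]]] ev2[OF that]] by (rule DERIV_imp_deriv)
    have "eventually (\<lambda>t. deriv (deriv p) (t - s) = deriv (deriv u) t) (at_left T)"
      using near by eventually_elim (simp add: d2)
    from Lim_transform_eventually[OF shift[OF cp(2)[OF \<tau>I]] this]
    have "(deriv (deriv u) \<longlongrightarrow> deriv (deriv p) \<tau>) (at_left T)" .
    moreover have "(deriv (deriv u) \<longlongrightarrow> deriv (deriv u) T) (at_left T)"
      using P(10)[OF TS] by (simp add: isCont_def filterlim_at_split)
    ultimately show ?thesis using tendsto_unique trivial_limit_at_left_real by metis
  qed
  obtain d where d: "d > 0" "\<And>h. 0 < h \<Longrightarrow> h < d \<Longrightarrow> deriv u (T + h) < 0"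
    using DERIV_neg_dec_right[OF P(9)[OF TS]] dduT p2 duT by auto
  have neg: "eventually (\<lambda>t. deriv u t < 0) (at_right T)"
    unfolding eventually_at_right_field
    by (intro exI[of _ "T + d"]) (use d(1) d(2)[of "y - T" for y] in auto)
  have uTr: "(u \<longlongrightarrow> m) (at_right T)"
    using P(1)[of T] uT by (simp add: isCont_def filterlim_at_split)
  have offT: "eventually (\<lambda>t. t \<notin> S) (at_right T)"
    using wave_profile_eventually_off(2)[OF prof, of T] by (simp add: eventually_at_split)
  have below: "eventually (\<lambda>t. u t < m) (at_right T)"
  proof -
    obtain c where c: "c > T" "\<And>t. T < t \<Longrightarrow> t < c \<Longrightarrow> deriv u t < 0 \<and> t \<notin> S"
      using eventually_conj[OF neg offT] unfolding eventually_at_right_field by blast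
    have "u t < u T" if t: "T < t" "t < c" for t
    proof (rule DERIV_neg_imp_decreasing_open[OF t(1)])
      show "\<exists>D. DERIV u r :> D \<and> D < 0" if "T < r" "r < t" for r
        using P(8)[of r] c(2)[of r] that t by auto
      show "continuous_on {T..t} u" using P(1) by (intro continuous_at_imp_continuous_on) auto
    qed
    then show ?thesis unfolding eventually_at_right_field uT using c(1) by blast
  qed
  have start: "eventually (\<lambda>t. t \<notin> S \<and> u t \<in> {0<..<m} \<and> 0 < - 1 * deriv u t) (at_right T)"
    using neg below offT by eventually_elim (use P(7) in auto)
  have "filterlim u (at_left m) (at_right T)"
    unfolding filterlim_at using uTr below by (auto elim!: eventually_mono)
  then have lim: "((\<lambda>t. G (u t)) \<longlongrightarrow> \<tau>) (at_right T)"
    using G\<tau> by (rule filterlim_compose[rotated])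
  have room: "\<exists>x\<in>{0<..<m}. G x = \<tau> + - 1 * (t - T)" if "t \<in> {T<..<T+\<tau>}" for t
    using p_clock[of "\<tau> - (t - T)"] that by (intro bexI[of _ "p (\<tau> - (t - T))"]) auto
  have fall: "t \<notin> S \<and> u t = p (t - s)" if t: "t \<in> {T<..<T+\<tau>}" for t
  proof -
    from wave_profile_arc[OF prof g_m _ dG _ _ start lim room t]
    have *: "t \<notin> S" "u t \<in> {0<..<m}" "G (u t) = \<tau> - (t - T)" using g_pos \<tau> by auto
    moreover have "p (\<tau> - (t - T)) \<in> {0<..<m}" "G (p (\<tau> - (t - T))) = \<tau> - (t - T)"
      using p_clock[of "\<tau> - (t - T)"] t by auto
    ultimately have "u t = p (\<tau> - (t - T))"
      using strict_mono_on_eqD[OF mono, of "u t" "p (\<tau> - (t - T))"] by auto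
    also have "\<tau> - (t - T) = 2 * \<tau> - (t - s)" by (simp add: T_def)
    also have "p \<dots> = p (t - s)" using t \<tau> by (intro sym) (auto simp: T_def)
    finally show ?thesis using * by simp
  qed
  have p2\<tau>: "p (2 * \<tau>) = 0" using sym[of 0] p0 \<tau> by simp
  have uE: "u (s + 2 * \<tau>) = 0"
  proof -
    have "eventually (\<lambda>t. t \<in> {T<..<T+\<tau>}) (at_left (T + \<tau>))"
      using \<tau> by (intro eventually_at_left_real) auto
    then have "eventually (\<lambda>t. p (t - s) = u t) (at_left (T + \<tau>))"
      by eventually_elim (use fall in auto)
    moreover have "((\<lambda>t. p (t - s)) \<longlongrightarrow> p (2 * \<tau>)) (at_left (T + \<tau>))"
      by (rule isCont_tendsto_compose[OF cp(1)]) (use \<tau> in \<open>auto simp: T_def intro!: tendsto_eq_intros\<close>)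
    ultimately have "(u \<longlongrightarrow> p (2 * \<tau>)) (at_left (T + \<tau>))"
      by (rule Lim_transform_eventually[rotated])
    moreover have "(u \<longlongrightarrow> u (T + \<tau>)) (at_left (T + \<tau>))"
      using P(1)[of "T + \<tau>"] by (simp add: isCont_def filterlim_at_split)
    ultimately have "u (T + \<tau>) = 0" using tendsto_unique trivial_limit_at_left_real p2\<tau> by metis
    then show ?thesis by (simp add: T_def algebra_simps)
  qed
  then show "s + 2 * \<tau> \<in> S" using P(7)[of "s + 2 * \<tau>"] by fastforce
  show "u (s + x) = p x" if x: "x \<in> {0..2 * \<tau>}"
  proof -
    consider "x = 0" | "x \<in> {0<..<\<tau>}" | "x = \<tau>" | "x \<in> {\<tau><..<2 * \<tau>}" | "x = 2 * \<tau>"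
      using x by fastforce
    then show ?thesis
    proof cases
      case 1 then show ?thesis using P(4)[OF s] p0 by simp
    next
      case 2 then show ?thesis using rise[of "s + x"] by simp
    next
      case 3 then show ?thesis using uT p\<tau> by (simp add: T_def)
    next
      case 4 then show ?thesis using fall[of "s + x"] by (simp add: T_def)
    next
      case 5 then show ?thesis using uE p2\<tau> by simp
    qed
  qed
qed

section \<open>Gluing arches to a wave\<close>

lemma wave_profile_energy:
  assumes prof: "wave_profile (speed_sq F) u S" and t: "t \<notin> S"
  shows "energy F u t = F 0"
  using wave_profileD(11)[OF prof t] speed_sq_eq[of "u t" F] wave_profileD(7)[OF prof t]
  by (simp add: energy_def)

lemma countable_of_locally_finite:
  assumes "\<And>a b :: real. finite (S \<inter> {a..b})"
  shows "countable S"
proof -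
  have "S \<subseteq> (\<Union>n::nat. S \<inter> {- real n..real n})"
  proof
    fix t assume "t \<in> S"
    obtain n where "\<bar>t\<bar> < real n" using reals_Archimedean2 by blast
    then have "t \<in> {- real n..real n}" by auto
    then show "t \<in> (\<Union>n::nat. S \<inter> {- real n..real n})" using \<open>t \<in> S\<close> by blast
  qed
  then show ?thesis
    by (rule countable_subset) (intro countable_UN countableI_type countable_finite assms)
qed

lemma wave_profile_imp_weak_singular:
  assumes prof: "wave_profile (speed_sq F) u S" and s: "s \<in> S" and tws: "tws F u"
  shows "weak_singular_tws_off F u S"
proof -
  note P = wave_profileD[OF prof]
  have cS: "countable S" using P(3) by (rule countable_of_locally_finite)
  have "\<not> u constant_on UNIV"
  proof
    assume "u constant_on UNIV"
    then have "u t = 0" for t using P(4)[OF s] by (metis UNIV_I constant_on_def)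
    then have "S = UNIV" using P(7) by fastforce
    then show False using cS uncountable_UNIV_real by simp
  qed
  moreover have "classical_energy_solution F (F 0) u (- S)"
    unfolding classical_energy_solution_def C1_differentiable_on_def
  proof (intro conjI exI[of _ "deriv u"] ballI)
    show "(u has_vector_derivative deriv u t) (at t)" if "t \<in> - S" for t
      using P(8)[of t] that by (simp add: has_real_derivative_iff_has_vector_derivative)
    show "continuous_on (- S) (deriv u)"
      using P(9) by (intro continuous_at_imp_continuous_on) (auto intro: DERIV_isCont)
  qed (use wave_profile_energy[OF prof] in auto)
  moreover have "(energy F u \<longlongrightarrow> F 0) (at r within - S)" for r
    by (rule tendsto_eventually) (auto simp: eventually_at_filter wave_profile_energy[OF prof])
  ultimately show ?thesis
    using tws cS unfolding weak_singular_tws_off_def by blast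
qed

lemma wave_profile_imp_peak_set:
  assumes prof: "wave_profile g u S" and g0: "0 < g 0" and an: "real_analytic_on u (- S)" and s: "s \<in> S"
  shows "peak_set u S"
  unfolding peak_set_def
proof (intro conjI ballI)
  note P = wave_profileD[OF prof]
  show "countable S" using P(3) by (rule countable_of_locally_finite)
  show "smooth_on u (- S)" using an P(2) by (intro real_analytic_on_imp_smooth_on) auto
  show "S \<noteq> {}" using s by auto
  show "\<exists>l. l \<noteq> 0 \<and> (deriv u \<longlongrightarrow> l) (at_right t) \<and> (deriv u \<longlongrightarrow> - l) (at_left t)" if "t \<in> S" for t
    using P(5,6)[OF that] g0 by (intro exI[of _ "sqrt (g 0)"]) simp
qed

text \<open>At the peaks \<open>u = 0\<close>, so that \<open>(u\<^sup>2)' = 2 u u'\<close> is continuous across them and the classical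
  equation between the peaks is already the weak one. The set \<open>E\<close> may contain further points, because
  the divergence form comes from the energy by a division by \<open>u'\<close> and is not available at the crests.\<close>

lemma wave_profile_imp_tws:
  assumes F: "real_analytic_on F UNIV" and prof: "wave_profile (speed_sq F) u S"
    and peaks: "peak_set u S" and bdd: "bounded (range u)"
    and E: "S \<subseteq> E" "\<And>a b. finite (E \<inter> {a..b})" "\<And>t. t \<notin> E \<Longrightarrow> deriv u t \<noteq> 0"
  shows "tws F u"
proof -
  note P = wave_profileD[OF prof]
  have cont: "continuous_on UNIV u" using P(1) by (intro continuous_at_imp_continuous_on) auto
  define W where "W t = 2 * u t * deriv u t" for t
  define W' where "W' t = (deriv u t)\<^sup>2 - 2 * deriv F (u t)" for t
  have Wcont: "isCont W t" for t
  proof (cases "t \<in> S")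
    case True
    obtain M where M: "\<And>r. r \<in> {t-1..t+1} \<Longrightarrow> \<bar>deriv u r\<bar> \<le> M"
      using deriv_locally_bounded[OF peaks] by blast
    have "(u \<longlongrightarrow> 0) (at t)" using P(1)[of t] P(4)[OF True] by (simp add: isCont_def)
    then have "((\<lambda>r. 2 * u r) \<longlongrightarrow> 2 * 0) (at t)" by (rule tendsto_mult_left)
    then have "((\<lambda>r. 2 * u r) \<longlongrightarrow> 0) (at t)" by simp
    moreover have "eventually (\<lambda>r. r \<in> {t-1<..<t+1}) (nhds t)"
      by (intro eventually_nhds_in_open) auto
    then have "eventually (\<lambda>r. norm (W r) \<le> norm (2 * u r) * M) (at t)"
      unfolding eventually_at_filter
    proof eventually_elim
      case (elim r)
      then show ?case using M[of r] by (auto simp: W_def abs_mult intro!: mult_left_mono)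
    qed
    ultimately have "(W \<longlongrightarrow> 0) (at t)" by (rule tendsto_0_le)
    then show ?thesis using P(4)[OF True] by (simp add: isCont_def W_def[of t])
  next
    case False
    then show ?thesis
      unfolding W_def using P(1)[of t] DERIV_isCont[OF P(9)[OF False]] by (intro continuous_intros) auto
  qed
  have intW': "loc_integrable W'"
    unfolding W'_def[abs_def] by (rule loc_integrable_flux_deriv[OF peaks cont F])
  have wdu: "weak_deriv u (deriv u)" by (rule weak_deriv_of_peaked(1)[OF peaks cont])
  have wdu2: "weak_deriv (\<lambda>t. (u t)\<^sup>2) W"
    unfolding W_def[abs_def] by (rule weak_deriv_of_peaked(2)[OF peaks cont])
  have contW: "continuous_on UNIV W" using Wcont by (intro continuous_at_imp_continuous_on) auto
  have wdW: "weak_deriv W W'"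
  proof (rule weak_deriv_piecewise[OF contW E(2) _ intW'])
    fix t assume t: "t \<notin> E"
    then have nS: "t \<notin> S" using E(1) by blast
    have "eventually (\<lambda>r. energy F u r = F 0) (nhds t)"
      using wave_profile_eventually_off(1)[OF prof nS] by eventually_elim (rule wave_profile_energy[OF prof])
    then show "(W has_real_derivative W' t) (at t)"
      unfolding W_def W'_def by (rule flux_DERIV[OF F P(8)[OF nS] P(9)[OF nS] E(3)[OF t]])
  qed
  have "loc_L2 u"
    unfolding loc_L2_def
  proof (intro conjI allI)
    show "u \<in> borel_measurable borel" using cont by (rule borel_measurable_continuous_onI)
    show "set_integrable lborel {a..b} (\<lambda>t. (u t)\<^sup>2)" for a b
      using loc_integrable_continuous[of "\<lambda>t. (u t)\<^sup>2"] cont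
      by (auto simp: loc_integrable_def intro!: continuous_intros)
  qed
  moreover have "loc_L2 (deriv u)"
    using deriv_borel_measurable[OF peaks] loc_integrable_deriv_square[OF peaks]
    by (simp add: loc_L2_def loc_integrable_def)
  ultimately have "H1_loc u"
    using cont wdu unfolding H1_loc_def by blast
  moreover have "(LINT t|lborel. W t * deriv \<phi> t + (deriv u t)\<^sup>2 * \<phi> t - 2 * deriv F (u t) * \<phi> t) = 0"
    if \<phi>: "test_function \<phi>" for \<phi>
  proof -
    have "(LINT t|lborel. W t * deriv \<phi> t + (deriv u t)\<^sup>2 * \<phi> t - 2 * deriv F (u t) * \<phi> t) =
      (LINT t|lborel. W t * deriv \<phi> t + W' t * \<phi> t)"
      by (intro Bochner_Integration.integral_cong) (auto simp: W'_def algebra_simps)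
    also have "\<dots> = (LINT t|lborel. W t * deriv \<phi> t) + (LINT t|lborel. W' t * \<phi> t)"
      by (intro Bochner_Integration.integral_add integrable_mult_test_function intW' \<phi>
          loc_integrable_continuous contW)
    also have "\<dots> = 0" using wdW \<phi> by (simp add: weak_deriv_def)
    finally show ?thesis .
  qed
  ultimately show ?thesis
    unfolding tws_def using bdd wdu wdu2 by blast
qed

lemma wave_profile_imp_peaked_tws:
  assumes F: "real_analytic_on F UNIV" and F0: "deriv F 0 < 0"
    and prof: "wave_profile (speed_sq F) u S" and s: "s \<in> S"
    and an: "real_analytic_on u (- S)" and bdd: "bounded (range u)"
    and E: "S \<subseteq> E" "\<And>a b. finite (E \<inter> {a..b})" "\<And>t. t \<notin> E \<Longrightarrow> deriv u t \<noteq> 0"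
  shows "peaked_tws F u"
proof -
  have peaks: "peak_set u S"
    by (rule wave_profile_imp_peak_set[OF prof _ an s]) (use F0 in \<open>simp add: speed_sq_0\<close>)
  have "tws F u" by (rule wave_profile_imp_tws[OF F prof peaks bdd E])
  then have "weak_singular_tws F u"
    unfolding weak_singular_tws_def using wave_profile_imp_weak_singular[OF prof s] by blast
  then show ?thesis
    unfolding peaked_tws_def singular_tws_def using peaks wave_profile_nonneg[OF prof] by blast
qed

text \<open>One description of both kinds of waves: \<open>I\<close> is \<open>[0, \<infinity>)\<close> for a solitary wave, whose only arch is
unbounded, and \<open>[0, 2 \<tau>)\<close> for a periodic one, where the two arches adjacent to a peak are covered.\<close>

definition arch_train :: "(real \<Rightarrow> real) \<Rightarrow> real set \<Rightarrow> (real \<Rightarrow> real) \<Rightarrow> real set \<Rightarrow> bool" where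
  "arch_train p I u S \<longleftrightarrow>
     (\<forall>s\<in>S. \<forall>t. \<bar>t - s\<bar> \<in> I \<longrightarrow> u t = p \<bar>t - s\<bar>) \<and> (\<forall>t. \<exists>s\<in>S. \<bar>t - s\<bar> \<in> I)"

context
  fixes p u :: "real \<Rightarrow> real" and I S :: "real set"
  assumes train: "arch_train p I u S" and I: "open {x. \<bar>x\<bar> \<in> I}" "0 \<in> I"
    and p_an: "real_analytic_on p I"
begin

lemma arch_train_local:
  assumes "s \<in> S" "\<bar>t - s\<bar> \<in> I" "t \<noteq> s" "\<sigma> = sgn (t - s)"
  shows "eventually (\<lambda>r. p (\<sigma> * (r - s)) = u r) (nhds t)"
proof -
  have "open ((\<lambda>r. r - s) -` {x. \<bar>x\<bar> \<in> I})"
    by (rule open_vimage[OF I(1)]) (intro continuous_intros)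
  then have "eventually (\<lambda>r. r \<in> (\<lambda>r. r - s) -` {x. \<bar>x\<bar> \<in> I}) (nhds t)"
    by (rule eventually_nhds_in_open) (use assms in simp)
  moreover have "open {r. 0 < \<sigma> * (r - s)}"
    by (intro open_Collect_less continuous_intros)
  then have "eventually (\<lambda>r. r \<in> {r. 0 < \<sigma> * (r - s)}) (nhds t)"
    by (rule eventually_nhds_in_open) (use assms in \<open>auto simp: sgn_if\<close>)
  ultimately show ?thesis
  proof eventually_elim
    case (elim r)
    then have "\<bar>r - s\<bar> \<in> I" by simp
    moreover have "\<bar>r - s\<bar> = \<sigma> * (r - s)"
      using elim assms(3,4) by (auto simp: sgn_if split: if_splits)
    ultimately show ?case using train assms(1) unfolding arch_train_def by metis
  qed
qed

lemma arch_train_DERIV: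
  assumes "s \<in> S" "\<bar>t - s\<bar> \<in> I" "t \<noteq> s"
  shows "(u has_real_derivative sgn (t - s) * deriv p \<bar>t - s\<bar>) (at t)"
proof -
  define \<sigma> where "\<sigma> = sgn (t - s)"
  have e: "\<sigma> * (t - s) = \<bar>t - s\<bar>" by (simp add: \<sigma>_def sgn_if)
  have "((\<lambda>r. p (\<sigma> * (r - s))) has_real_derivative deriv p \<bar>t - s\<bar> * \<sigma>) (at t)"
  proof (rule DERIV_chain2[where f = p])
    show "(p has_real_derivative deriv p \<bar>t - s\<bar>) (at (\<sigma> * (t - s)))"
      unfolding e by (rule real_analytic_on_DERIV[OF p_an assms(2)])
  qed (auto intro!: derivative_eq_intros)
  then show ?thesis
    using DERIV_transform_ev[OF _ arch_train_local[OF assms \<sigma>_def]] by (simp add: \<sigma>_def mult.commute)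
qed

lemma arch_train_analytic:
  assumes "s \<in> S" "\<bar>t - s\<bar> \<in> I" "t \<noteq> s"
  shows "real_analytic_on u {t}"
proof -
  define \<sigma> where "\<sigma> = sgn (t - s)"
  have e: "\<sigma> * (t - s) = \<bar>t - s\<bar>" by (simp add: \<sigma>_def sgn_if)
  have "real_analytic_on (\<lambda>r. p (\<sigma> * (r - s))) {t}"
  proof (rule real_analytic_on_compose[where f = p])
    show "real_analytic_on (\<lambda>r. \<sigma> * (r - s)) {t}"
      by (intro real_analytic_on_cmult real_analytic_on_diff real_analytic_on_ident real_analytic_on_const)
    show "real_analytic_on p ((\<lambda>r. \<sigma> * (r - s)) ` {t})"
      using real_analytic_onD[OF p_an assms(2)] e by simp
  qed
  then show ?thesis
    using arch_train_local[OF assms \<sigma>_def] by (rule real_analytic_on_cong_ev)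
qed

text \<open>Off the peaks \<open>u\<close> is locally \<open>p (\<sigma> (t - s))\<close> with \<open>\<sigma> = \<plusminus> 1\<close> and inherits analyticity and the equation from
\<open>p\<close>; at a peak the two signs give the opposite one-sided slopes.\<close>

lemma arch_train_wave_profile:
  assumes p0: "p 0 = 0" and pos: "\<And>x. x \<in> I \<Longrightarrow> x \<noteq> 0 \<Longrightarrow> 0 < p x"
    and sq: "\<And>x. x \<in> I \<Longrightarrow> (deriv p x)\<^sup>2 = g (p x)" and d0: "deriv p 0 = sqrt (g 0)"
    and fin: "\<And>a b. finite (S \<inter> {a..b})"
  shows "real_analytic_on u (- S)" "wave_profile g u S"
proof -
  have cover: "\<exists>s\<in>S. \<bar>t - s\<bar> \<in> I" for t
    using train by (simp add: arch_train_def)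
  have eq: "u t = p \<bar>t - s\<bar>" if "s \<in> S" "\<bar>t - s\<bar> \<in> I" for s t
    using train that by (simp add: arch_train_def)
  have zero: "u s = 0" if "s \<in> S" for s
    using eq[OF that, of s] I(2) p0 by simp
  have pos_off: "0 < u t" if "t \<notin> S" for t
  proof -
    obtain s where s: "s \<in> S" "\<bar>t - s\<bar> \<in> I" using cover by blast
    then have "t \<noteq> s" using that by auto
    then show ?thesis using pos[OF s(2)] eq[OF s] by simp
  qed
  have near: "eventually (\<lambda>t. \<bar>t - s\<bar> \<in> I) (nhds s)" for s
  proof -
    have "open ((\<lambda>r. r - s) -` {x. \<bar>x\<bar> \<in> I})"
      by (rule open_vimage[OF I(1)]) (intro continuous_intros)
    then have "eventually (\<lambda>r. r \<in> (\<lambda>r. r - s) -` {x. \<bar>x\<bar> \<in> I}) (nhds s)"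
      by (rule eventually_nhds_in_open) (use I(2) in simp)
    then show ?thesis by simp
  qed
  show an: "real_analytic_on u (- S)"
  proof (rule real_analytic_onI)
    fix t assume t: "t \<in> - S"
    obtain s where s: "s \<in> S" "\<bar>t - s\<bar> \<in> I" using cover by blast
    then show "real_analytic_on u {t}" using t by (intro arch_train_analytic[OF s]) auto
  qed
  have p_cont: "isCont p 0" "isCont (deriv p) 0"
    using real_analytic_on_DERIV[OF p_an I(2)] real_analytic_on_DERIV[OF real_analytic_on_deriv[OF p_an] I(2)]
    by (auto intro: DERIV_isCont)
  have abs0: "((\<lambda>t. \<bar>t - s\<bar>) \<longlongrightarrow> 0) (at s within A)" for s :: real and A
    by (auto intro!: tendsto_eq_intros)
  have cont: "isCont u t" for t
  proof (cases "t \<in> S")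
    case True
    have "((\<lambda>r. p \<bar>r - t\<bar>) \<longlongrightarrow> 0) (at t)"
      using isCont_tendsto_compose[OF p_cont(1) abs0] p0 by simp
    moreover have "eventually (\<lambda>r. p \<bar>r - t\<bar> = u r) (at t)"
      using near[of t] unfolding eventually_at_filter by eventually_elim (simp add: eq[OF True])
    ultimately have "(u \<longlongrightarrow> 0) (at t)" by (rule Lim_transform_eventually)
    then show ?thesis using zero[OF True] by (simp add: isCont_def)
  next
    case False
    then show ?thesis using real_analytic_on_DERIV[OF an, of t] by (auto intro: DERIV_isCont)
  qed
  have "S = u -` {0}" using zero pos_off by force
  then have clS: "closed S" by (metis closed_singleton closed_vimage continuous_at_imp_continuous_on cont)
  have side: "(deriv u \<longlongrightarrow> \<sigma> * sqrt (g 0)) (at s within A)"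
    if s: "s \<in> S" and A: "\<And>t. t \<in> A \<Longrightarrow> t \<noteq> s \<and> sgn (t - s) = \<sigma>" for s A \<sigma>
  proof -
    have "((\<lambda>r. \<sigma> * deriv p \<bar>r - s\<bar>) \<longlongrightarrow> \<sigma> * sqrt (g 0)) (at s within A)"
      using tendsto_mult_left[OF isCont_tendsto_compose[OF p_cont(2) abs0]] by (simp add: d0)
    moreover have "eventually (\<lambda>r. \<sigma> * deriv p \<bar>r - s\<bar> = deriv u r) (at s within A)"
      using near[of s] unfolding eventually_at_filter
    proof eventually_elim
      case (elim r)
      then show ?case
        using DERIV_imp_deriv[OF arch_train_DERIV[OF s, of r]] A[of r] by auto
    qed
    ultimately show ?thesis by (rule Lim_transform_eventually)
  qed
  show "wave_profile g u S"
    unfolding wave_profile_def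
  proof (intro conjI ballI allI impI)
    show "continuous_on UNIV u" using cont by (intro continuous_at_imp_continuous_on) auto
    show "(deriv u \<longlongrightarrow> sqrt (g 0)) (at_right s)" if "s \<in> S" for s
      using side[OF that, of "{s<..}" 1] by (simp add: sgn_if)
    show "(deriv u \<longlongrightarrow> - sqrt (g 0)) (at_left s)" if "s \<in> S" for s
      using side[OF that, of "{..<s}" "- 1"] by (simp add: sgn_if)
    fix t assume t: "t \<notin> S"
    note an2 = real_analytic_on_deriv[OF an] real_analytic_on_deriv[OF real_analytic_on_deriv[OF an]]
    show "(u has_real_derivative deriv u t) (at t)"
      "(deriv u has_real_derivative deriv (deriv u) t) (at t)" "isCont (deriv (deriv u)) t"
      using real_analytic_on_DERIV[OF an, of t] real_analytic_on_DERIV[OF an2(1), of t]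
        DERIV_isCont[OF real_analytic_on_DERIV[OF an2(2), of t]] t by auto
    obtain s where s: "s \<in> S" "\<bar>t - s\<bar> \<in> I" using cover by blast
    then have ts: "t \<noteq> s" using t by auto
    show "(deriv u t)\<^sup>2 = g (u t)"
      using DERIV_imp_deriv[OF arch_train_DERIV[OF s ts]] sq[OF s(2)] eq[OF s] ts
      by (simp add: power_mult_distrib sgn_if)
  qed (use clS fin zero pos_off in auto)
qed

end

section \<open>Solitary and periodic waves\<close>

context solitary_wave
begin

lemma p_range: "0 \<le> y \<Longrightarrow> p y \<in> {0..<m}"
  using p_clock[of y] p0 m_pos by (cases "y = 0") auto

lemma p_pos: "0 < y \<Longrightarrow> 0 < p y"
  using p_clock[of y] by auto

lemma p_strict_mono: "0 \<le> x \<Longrightarrow> x < y \<Longrightarrow> p x < p y"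
proof (rule DERIV_pos_imp_increasing[where f = p])
  fix z assume "0 \<le> x" "x \<le> z"
  then have z: "0 \<le> z" by simp
  then have "0 < sqrt (g (p z))" using g_pos[OF p_range] by simp
  then show "\<exists>D. DERIV p z :> D \<and> 0 < D" using p_DERIV[OF z] by blast
qed

text \<open>\<open>G (p y) = y\<close> is unbounded while \<open>G x\<close> is finite for every \<open>x < m\<close>, so \<open>p\<close> exceeds each such \<open>x\<close>.\<close>

lemma p_tendsto: "(p \<longlongrightarrow> m) at_top"
proof (rule order_tendstoI)
  fix a assume "a < m"
  define x where "x = (max 0 a + m) / 2"
  have x: "x \<in> {0<..<m}" "a < x" using \<open>a < m\<close> m_pos by (auto simp: x_def max_def)
  have mono: "strict_mono_on {0<..<m} G"
    by (rule strict_mono_on_clock[OF dG]) (use g_pos in auto)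
  have "a < p y" if "max 1 (G x) \<le> y" for y
  proof -
    have "p y \<in> {0<..<m}" "G x \<le> G (p y)" using p_clock[of y] that by auto
    then have "x \<le> p y" using strict_mono_on_less[OF mono, of "p y" x] x by (metis not_le)
    then show ?thesis using x(2) by simp
  qed
  then show "eventually (\<lambda>y. a < p y) at_top"
    unfolding eventually_at_top_linorder by blast
next
  fix a assume "m < a"
  then have "p y < a" if "0 \<le> y" for y using p_range[OF that] by auto
  then show "eventually (\<lambda>y. p y < a) at_top"
    unfolding eventually_at_top_linorder by blast
qed

text \<open>If \<open>F'' m \<noteq> 0\<close>, then \<open>g\<close> has a zero of order exactly two at \<open>m\<close>, so that \<open>p' \<ge> c (m - p)\<close>.\<close>

lemma p_exponential:
  assumes "deriv (deriv F) m \<noteq> 0"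
  obtains c where "c > 0" "\<And>y. 0 \<le> y \<Longrightarrow> m - p y \<le> m * exp (- c * y)"
proof -
  define q where "q = slope_from (slope_from g m) m"
  have dg: "deriv g m = 0" using flat deriv_g_m by simp
  have q: "g x = (x - m)\<^sup>2 * q x" for x
    unfolding q_def using flat by (rule g_double_zero)
  have qan: "real_analytic_on q UNIV"
    unfolding q_def by (intro real_analytic_on_slope_from g_analytic) auto
  note Dq = real_analytic_on_DERIV[OF qan UNIV_I] real_analytic_on_DERIV[OF real_analytic_on_deriv[OF qan] UNIV_I]
  note Dg = real_analytic_on_DERIV[OF g_analytic UNIV_I]
    real_analytic_on_DERIV[OF real_analytic_on_deriv[OF g_analytic] UNIV_I]
  have qm: "q m \<noteq> 0"
  proof
    assume q0: "q m = 0"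
    have "deriv g x = 2 * (x - m) * q x + (x - m)\<^sup>2 * deriv q x" for x
    proof (rule DERIV_imp_deriv)
      have "((\<lambda>x. (x - m)\<^sup>2 * q x) has_real_derivative 2 * (x - m) * q x + (x - m)\<^sup>2 * deriv q x) (at x)"
        by (auto intro!: derivative_eq_intros Dq(1))
      then show "(g has_real_derivative 2 * (x - m) * q x + (x - m)\<^sup>2 * deriv q x) (at x)"
        by (rule DERIV_transform_ev) (simp add: q)
    qed
    then have dg': "deriv g = (\<lambda>x. 2 * (x - m) * q x + (x - m)\<^sup>2 * deriv q x)" by blast
    have "((\<lambda>x. 2 * (x - m) * q x + (x - m)\<^sup>2 * deriv q x) has_real_derivative 2 * q m) (at m)"
      by (auto intro!: derivative_eq_intros Dq)
    then have ddg: "deriv (deriv g) m = 0"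
      unfolding dg' q0 by (simp add: DERIV_imp_deriv)
    have "deriv F x = - (g x + x * deriv g x) / 2" for x
    proof (rule DERIV_imp_deriv)
      have "((\<lambda>x. F 0 - x * g x / 2) has_real_derivative 0 - (1 * g x + deriv g x * x) / 2) (at x)"
        by (intro DERIV_diff DERIV_const DERIV_cdivide DERIV_mult DERIV_ident Dg)
      then have "((\<lambda>x. F 0 - x * g x / 2) has_real_derivative - (g x + x * deriv g x) / 2) (at x)"
        by (simp add: mult.commute diff_divide_distrib add_divide_distrib)
      then show "(F has_real_derivative - (g x + x * deriv g x) / 2) (at x)"
      proof (rule DERIV_transform_ev)
        show "eventually (\<lambda>y. F 0 - y * g y / 2 = F y) (nhds x)"
          using g_eq by (intro always_eventually allI) (simp add: algebra_simps)
      qed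
    qed
    then have dF: "deriv F = (\<lambda>x. - (g x + x * deriv g x) / 2)" by blast
    have "((\<lambda>x. - (g x + x * deriv g x) / 2) has_real_derivative
        - (deriv g m + (1 * deriv g m + deriv (deriv g) m * m)) / 2) (at m)"
      by (intro DERIV_cdivide DERIV_minus DERIV_add DERIV_mult DERIV_ident Dg)
    then have "deriv (deriv F) m = 0"
      unfolding dF using dg ddg by (simp add: DERIV_imp_deriv)
    then show False using assms by simp
  qed
  have q_pos: "0 < q x" if "x \<in> {0..<m}" for x
    using g_pos[OF that] q[of x] that by (simp add: zero_less_mult_iff)
  have "0 \<le> q m"
  proof (rule tendsto_lowerbound)
    show "(q \<longlongrightarrow> q m) (at_left m)"
      using real_analytic_UNIV_continuous(1)[OF qan, of m] by (simp add: isCont_def filterlim_at_split)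
    show "eventually (\<lambda>x. 0 \<le> q x) (at_left m)"
      using eventually_at_left_real[OF m_pos]
      by eventually_elim (auto intro!: less_imp_le q_pos)
  qed simp
  then have q_pos': "0 < q x" if "x \<in> {0..m}" for x
    using q_pos[of x] qm that by (cases "x = m") auto
  have ne: "{0..m} \<noteq> {}" using m_pos by simp
  obtain x0 where x0: "x0 \<in> {0..m}" "\<And>x. x \<in> {0..m} \<Longrightarrow> q x0 \<le> q x"
    using continuous_attains_inf[OF compact_Icc ne real_analytic_UNIV_continuous(2)[OF qan]] by blast
  define c where "c = sqrt (q x0)"
  have c: "c > 0" using q_pos'[OF x0(1)] by (simp add: c_def)
  have speed: "c * (m - x) \<le> sqrt (g x)" if "x \<in> {0..<m}" for x
  proof -
    have "(x - m)\<^sup>2 * q x0 \<le> g x"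
      unfolding q by (rule mult_left_mono) (use x0(2)[of x] that in auto)
    then have "sqrt ((x - m)\<^sup>2 * q x0) \<le> sqrt (g x)" by simp
    then show ?thesis using that by (simp add: real_sqrt_mult c_def mult.commute)
  qed
  have "m - p y \<le> m * exp (- c * y)" if "0 \<le> y" for y
  proof -
    have "(m - p y) * exp (c * y) \<le> (m - p 0) * exp (c * 0)"
    proof (rule DERIV_nonpos_imp_nonincreasing[where f = "\<lambda>y. (m - p y) * exp (c * y)"])
      fix z assume z: "0 \<le> z" "z \<le> y"
      have "((\<lambda>y. (m - p y) * exp (c * y)) has_real_derivative
          (c * (m - p z) - sqrt (g (p z))) * exp (c * z)) (at z)"
        by (auto intro!: derivative_eq_intros p_DERIV[OF z(1)] simp: algebra_simps)
      moreover have "(c * (m - p z) - sqrt (g (p z))) * exp (c * z) \<le> 0"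
        using speed[OF p_range[OF z(1)]] by (intro mult_nonpos_nonneg) auto
      ultimately show "\<exists>D. DERIV (\<lambda>y. (m - p y) * exp (c * y)) z :> D \<and> D \<le> 0" by blast
    qed (rule \<open>0 \<le> y\<close>)
    then show ?thesis by (simp add: p0 exp_minus field_simps)
  qed
  with c show thesis using that by blast
qed

lemma solitary_wave_exists: "peaked_tws F (\<lambda>t. p \<bar>t\<bar>)"
proof -
  let ?u = "\<lambda>t. p \<bar>t\<bar>"
  have tr: "arch_train p {0..} ?u {0}" by (simp add: arch_train_def)
  have "deriv p 0 = sqrt (g 0)" using DERIV_imp_deriv[OF p_DERIV, of 0] p0 by simp
  moreover have "(deriv p x)\<^sup>2 = g (p x)" if "x \<in> {0..}" for x
    using DERIV_imp_deriv[OF p_DERIV, of x] g_pos[OF p_range, of x] that by simp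
  ultimately have W: "real_analytic_on ?u (- {0})" "wave_profile g ?u {0}"
    using arch_train_wave_profile[OF tr _ _ p_an p0, of g] p_pos by auto
  have "?u t \<in> {0..m}" for t using p_range[of "\<bar>t\<bar>"] by simp
  then have "range ?u \<subseteq> {0..m}" by blast
  then have "bounded (range ?u)" by (rule bounded_subset[OF bounded_closed_interval])
  moreover have "deriv ?u t \<noteq> 0" if "t \<notin> {0}" for t
  proof
    assume "deriv ?u t = 0"
    then have "g (p \<bar>t\<bar>) = 0" using wave_profileD(11)[OF W(2) that] by simp
    then show False using g_pos[OF p_range, of "\<bar>t\<bar>"] by simp
  qed
  ultimately show ?thesis
    by (intro wave_profile_imp_peaked_tws[OF analytic F0 W(2) _ W(1), of 0 "{0}"]) auto
qed

context
  fixes u s assumes u: "\<And>t. u t = p \<bar>t - s\<bar>"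
begin

lemma solitary_is_local_max: "is_local_max (elevation m u) t \<longleftrightarrow> t = s"
proof
  assume "is_local_max (elevation m u) t"
  then have ev: "eventually (\<lambda>r. p \<bar>t - s\<bar> \<le> p \<bar>r - s\<bar>) (nhds t)"
    by (simp add: is_local_max_def elevation_def u)
  then obtain d where d: "d > 0" "\<And>r. dist r t < d \<Longrightarrow> p \<bar>t - s\<bar> \<le> p \<bar>r - s\<bar>"
    unfolding eventually_nhds_metric by blast
  show "t = s"
  proof (rule ccontr)
    assume ts: "t \<noteq> s"
    define h where "h = min d \<bar>t - s\<bar> / 2"
    have h: "0 < h" "h < d" "h < \<bar>t - s\<bar>" using d(1) ts by (auto simp: h_def min_def)
    define r where "r = t - sgn (t - s) * h"
    have r: "\<bar>r - s\<bar> = \<bar>t - s\<bar> - h" "dist r t = h"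
      using h ts by (auto simp: r_def sgn_if dist_real_def)
    have "p \<bar>r - s\<bar> < p \<bar>t - s\<bar>" by (rule p_strict_mono) (use r(1) h in auto)
    moreover have "p \<bar>t - s\<bar> \<le> p \<bar>r - s\<bar>" by (rule d(2)) (use r(2) h in simp)
    ultimately show False by simp
  qed
next
  assume "t = s"
  then show "is_local_max (elevation m u) t"
    using p_range by (simp add: is_local_max_def elevation_def u p0)
qed

lemma solitary_elevation_le: "elevation m u t \<le> elevation m u s"
  using p_range[of "\<bar>t - s\<bar>"] by (simp add: elevation_def u p0)

lemma solitary_symmetric: "symmetric_about (elevation m u) s"
  by (simp add: symmetric_about_def elevation_def u)

lemma solitary_not_periodic: "\<not> has_period u T"
proof
  assume T: "has_period u T"
  then have "u (s + T) = u s" "0 < T" by (simp_all add: has_period_def)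
  then show False using p_pos[of T] by (simp add: u p0)
qed

lemma solitary_limits: "(u \<longlongrightarrow> m) at_top" "(u \<longlongrightarrow> m) at_bot"
proof -
  have "filterlim (\<lambda>t. - s + t) at_top at_top"
    by (rule filterlim_tendsto_add_at_top[OF tendsto_const filterlim_ident])
  then have "filterlim (\<lambda>t. \<bar>t - s\<bar>) at_top at_top"
    by (rule filterlim_at_top_mono) (simp add: eventually_at_top_linorder exI[of _ s])
  then show "(u \<longlongrightarrow> m) at_top"
    unfolding u using p_tendsto by (rule filterlim_compose[rotated])
  have "filterlim (\<lambda>t::real. s + (- t)) at_top at_bot"
    by (rule filterlim_tendsto_add_at_top[OF tendsto_const filterlim_uminus_at_top_at_bot])
  then have "filterlim (\<lambda>t. \<bar>t - s\<bar>) at_top at_bot"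
    by (rule filterlim_at_top_mono) (rule always_eventually, auto)
  then show "(u \<longlongrightarrow> m) at_bot"
    unfolding u using p_tendsto by (rule filterlim_compose[rotated])
qed

lemma solitary_decay: "decays_to_zero (elevation m u)"
  unfolding decays_to_zero_def elevation_def
  using tendsto_diff[OF tendsto_const[of m] solitary_limits(1)]
    tendsto_diff[OF tendsto_const[of m] solitary_limits(2)] by simp

lemma solitary_exponential_decay:
  assumes "deriv (deriv F) m \<noteq> 0"
  shows "decays_exponentially (elevation m u)"
proof -
  obtain c where c: "c > 0" "\<And>y. 0 \<le> y \<Longrightarrow> m - p y \<le> m * exp (- c * y)"
    using p_exponential[OF assms] by blast
  have "\<bar>elevation m u t\<bar> \<le> (m * exp (c * \<bar>s\<bar>)) * exp (- c * \<bar>t\<bar>)" for t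
  proof -
    have "\<bar>elevation m u t\<bar> = m - p \<bar>t - s\<bar>"
      using p_range[of "\<bar>t - s\<bar>"] by (simp add: elevation_def u)
    also have "\<dots> \<le> m * exp (- c * \<bar>t - s\<bar>)" by (rule c(2)) simp
    also have "\<dots> \<le> m * exp (c * \<bar>s\<bar> + (- c * \<bar>t\<bar>))"
    proof -
      have "c * \<bar>t\<bar> \<le> c * (\<bar>s\<bar> + \<bar>t - s\<bar>)" using c(1) by (intro mult_left_mono) auto
      then show ?thesis using m_pos by (simp add: algebra_simps)
    qed
    finally show ?thesis by (simp only: exp_add mult.assoc)
  qed
  then show ?thesis
    unfolding decays_exponentially_def using c(1) m_pos by (intro exI[of _ "m * exp (c * \<bar>s\<bar>)"] conjI exI[of _ c]) auto
qed

end

end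

lemma finite_multiples_Icc:
  assumes "0 < (c::real)"
  shows "finite (range (\<lambda>n::int. c * of_int n) \<inter> {a..b})"
proof (rule finite_subset)
  show "range (\<lambda>n::int. c * of_int n) \<inter> {a..b} \<subseteq> (\<lambda>n::int. c * of_int n) ` {\<lfloor>a / c\<rfloor>..\<lceil>b / c\<rceil>}"
  proof
    fix t assume "t \<in> range (\<lambda>n::int. c * of_int n) \<inter> {a..b}"
    then obtain n :: int where n: "t = c * of_int n" "a \<le> c * of_int n" "c * of_int n \<le> b" by auto
    then have "a / c \<le> of_int n" "of_int n \<le> b / c" using assms by (auto simp: field_simps)
    then have "n \<in> {\<lfloor>a / c\<rfloor>..\<lceil>b / c\<rceil>}" by (auto simp: floor_le_iff le_ceiling_iff)
    then show "t \<in> (\<lambda>n::int. c * of_int n) ` {\<lfloor>a / c\<rfloor>..\<lceil>b / c\<rceil>}" using n(1) by blast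
  qed
qed simp

lemma unique_multiple_in_period:
  assumes "0 < (c::real)"
  shows "\<exists>!n::int. x + c * of_int n \<in> {a..<a + c}"
proof
  let ?n = "\<lceil>(a - x) / c\<rceil>"
  show "x + c * of_int ?n \<in> {a..<a + c}"
  proof -
    have "(a - x) / c \<le> of_int ?n" "of_int ?n - 1 < (a - x) / c" by linarith+
    then have "a - x \<le> of_int ?n * c" "(of_int ?n - 1) * c < a - x"
      using assms by (simp_all only: pos_divide_le_eq pos_less_divide_eq)
    then show ?thesis by (simp add: algebra_simps)
  qed
  fix n :: int assume "x + c * of_int n \<in> {a..<a + c}"
  then have "(a - x) / c \<le> of_int n" "of_int n < (a - x) / c + 1"
    using assms by (auto simp: field_simps)
  then show "n = ?n" by linarith
qed

lemma period_decomposition: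
  assumes "0 < (c::real)"
  obtains n :: int and x where "x \<in> {0..<c}" "t = s + c * of_int n + x"
proof
  let ?n = "\<lfloor>(t - s) / c\<rfloor>"
  have "of_int ?n \<le> (t - s) / c" "(t - s) / c < of_int ?n + 1" by linarith+
  then have "of_int ?n * c \<le> t - s" "t - s < (of_int ?n + 1) * c"
    using assms by (simp_all only: pos_le_divide_eq pos_divide_less_eq)
  then show "t - s - c * of_int ?n \<in> {0..<c}" by (simp add: algebra_simps)
  show "t = s + c * of_int ?n + (t - s - c * of_int ?n)" by simp
qed

context periodic_wave
begin

lemma p_rise:
  assumes "0 \<le> x" "x < y" "y \<le> \<tau>"
  shows "p x < p y"
proof (rule DERIV_pos_imp_increasing_open[where f = p])
  fix z assume "x < z" "z < y"
  then have z: "z \<in> {0<..<\<tau>}" using assms by auto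
  then have "0 < sqrt (g (p z))" using p_clock[OF z] g_pos by auto
  then show "\<exists>D. DERIV p z :> D \<and> 0 < D"
    using real_analytic_on_DERIV[OF p_an, of z] p_deriv[of z] z by auto
next
  show "continuous_on {x..y} p"
    using assms
    by (intro continuous_at_imp_continuous_on ballI DERIV_isCont[OF real_analytic_on_DERIV[OF p_an]]) auto
qed (rule assms)

lemma p_fall: "\<tau> \<le> x \<Longrightarrow> x < y \<Longrightarrow> y \<le> 2 * \<tau> \<Longrightarrow> p y < p x"
  using p_rise[of "2 * \<tau> - y" "2 * \<tau> - x"] sym[of x] sym[of y] \<tau> by simp

lemma p_range: "x \<in> {0..2 * \<tau>} \<Longrightarrow> p x \<in> {0..m}"
proof -
  have half: "p x \<in> {0..m}" if "x \<in> {0..\<tau>}" for x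
    using p_clock[of x] p0 p\<tau> m_pos that by (cases "x = 0"; cases "x = \<tau>") auto
  show "x \<in> {0..2 * \<tau>} \<Longrightarrow> p x \<in> {0..m}"
    using half[of x] half[of "2 * \<tau> - x"] sym[of x] by (cases "x \<le> \<tau>") auto
qed

lemma p_pos: "x \<in> {0<..<2 * \<tau>} \<Longrightarrow> 0 < p x"
  using p_rise[of 0 x] p_fall[of x "2 * \<tau>"] sym[of 0] p0 \<tau> by (cases "x \<le> \<tau>") auto

lemma p_less_m: "x \<in> {0..2 * \<tau>} \<Longrightarrow> x \<noteq> \<tau> \<Longrightarrow> p x < m"
  using p_rise[of x \<tau>] p_fall[of \<tau> x] p\<tau> by (cases "x \<le> \<tau>") auto

text \<open>Left of a peak the formula shows the end of the previous arch, which is the mirror image of the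
beginning of an arch by the symmetry of \<open>p\<close>. The turning points are the odd multiples of \<open>\<tau>\<close>.\<close>

lemma periodic_wave_exists: "peaked_tws F (\<lambda>t. p (t - 2 * \<tau> * of_int \<lfloor>t / (2 * \<tau>)\<rfloor>))"
proof -
  define u where "u t = p (t - 2 * \<tau> * of_int \<lfloor>t / (2 * \<tau>)\<rfloor>)" for t
  let ?S = "range (\<lambda>n::int. 2 * \<tau> * of_int n)" and ?E = "range (\<lambda>n::int. \<tau> * of_int n)"
  have tr: "arch_train p {0..<2 * \<tau>} u ?S"
    unfolding arch_train_def
  proof (intro conjI ballI allI impI)
    fix s t assume "s \<in> ?S" and d: "\<bar>t - s\<bar> \<in> {0..<2 * \<tau>}"
    then obtain n :: int where n: "s = 2 * \<tau> * of_int n" by auto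
    show "u t = p \<bar>t - s\<bar>"
    proof (cases "s \<le> t")
      case True
      have "\<lfloor>t / (2 * \<tau>)\<rfloor> = n"
        by (rule floor_unique) (use True d n \<tau> in \<open>auto simp: field_simps\<close>)
      then show ?thesis using True n by (simp add: u_def)
    next
      case False
      have "\<lfloor>t / (2 * \<tau>)\<rfloor> = n - 1"
        by (rule floor_unique) (use False d n \<tau> in \<open>auto simp: field_simps\<close>)
      moreover have "t - 2 * \<tau> * of_int (n - 1) = 2 * \<tau> - (s - t)" using n by (simp add: algebra_simps)
      ultimately have "u t = p (2 * \<tau> - (s - t))" by (simp only: u_def)
      also have "\<dots> = p (s - t)" by (rule sym) (use False d in auto)
      finally show ?thesis using False by simp
    qed
  next
    fix t
    obtain n :: int and x where "x \<in> {0..<2 * \<tau>}" "t = 0 + 2 * \<tau> * of_int n + x"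
      by (rule period_decomposition[of "2 * \<tau>" t 0]) (use \<tau> in auto)
    then show "\<exists>s\<in>?S. \<bar>t - s\<bar> \<in> {0..<2 * \<tau>}" by (intro bexI[of _ "2 * \<tau> * of_int n"]) auto
  qed
  have op: "open {x. \<bar>x\<bar> \<in> {0..<2 * \<tau>}}"
  proof -
    have "{x. \<bar>x\<bar> \<in> {0..<2 * \<tau>}} = {- 2 * \<tau><..<2 * \<tau>}" by auto
    then show ?thesis by simp
  qed
  have p_an': "real_analytic_on p {0..<2 * \<tau>}" by (rule real_analytic_on_subset[OF p_an]) auto
  have "deriv p 0 = sqrt (g 0)" using p_deriv[of 0] \<tau> p0 by simp
  then have W: "real_analytic_on u (- ?S)" "wave_profile g u ?S"
    using arch_train_wave_profile[OF tr op _ p_an' p0, of g] p_pos p_sq \<tau>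
      finite_multiples_Icc[of "2 * \<tau>"] by auto
  have "u t \<in> {0..m}" for t
  proof -
    obtain s where "s \<in> ?S" "\<bar>t - s\<bar> \<in> {0..<2 * \<tau>}" using tr unfolding arch_train_def by blast
    then have "u t = p \<bar>t - s\<bar>" using tr unfolding arch_train_def by blast
    then show ?thesis using p_range[of "\<bar>t - s\<bar>"] \<open>\<bar>t - s\<bar> \<in> {0..<2 * \<tau>}\<close> by auto
  qed
  then have "range u \<subseteq> {0..m}" by blast
  then have bdd: "bounded (range u)" by (rule bounded_subset[OF bounded_closed_interval])
  have SE: "?S \<subseteq> ?E"
  proof
    fix t assume "t \<in> ?S"
    then obtain n :: int where "t = 2 * \<tau> * of_int n" by auto
    then have "t = \<tau> * of_int (2 * n)" by simp
    then show "t \<in> ?E" by blast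
  qed
  have "deriv u t \<noteq> 0" if t: "t \<notin> ?E" for t
  proof -
    have tS: "t \<notin> ?S" using SE t by blast
    obtain n :: int and x where x: "x \<in> {0..<2 * \<tau>}" "t = 0 + 2 * \<tau> * of_int n + x"
      by (rule period_decomposition[of "2 * \<tau>" t 0]) (use \<tau> in auto)
    have ux: "u t = p x"
    proof -
      have "\<bar>t - 2 * \<tau> * of_int n\<bar> \<in> {0..<2 * \<tau>}" "\<bar>t - 2 * \<tau> * of_int n\<bar> = x" using x by auto
      then show ?thesis using tr unfolding arch_train_def by (metis rangeI)
    qed
    have "x \<noteq> \<tau>"
    proof
      assume "x = \<tau>"
      then have "t = \<tau> * of_int (2 * n + 1)" using x(2) by (simp add: algebra_simps)
      then show False using t by blast
    qed
    moreover have "x \<noteq> 0" using x tS by auto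
    ultimately have "u t \<in> {0..<m}" using p_less_m[of x] p_pos[of x] x(1) ux by auto
    then have "0 < (deriv u t)\<^sup>2" unfolding wave_profileD(11)[OF W(2) tS] by (rule g_pos)
    then show ?thesis by auto
  qed
  then have "peaked_tws F u"
    using finite_multiples_Icc[OF \<tau>]
    by (intro wave_profile_imp_peaked_tws[OF analytic F0 W(2) _ W(1) bdd SE, of 0]) (auto intro: range_eqI[of _ _ 0])
  then show ?thesis by (simp add: u_def[abs_def])
qed

end

section \<open>Classification\<close>

lemma is_local_max_ballE:
  assumes "is_local_max f t"
  obtains d where "d > 0" "\<And>r. \<bar>r - t\<bar> < d \<Longrightarrow> f r \<le> f t"
  using assms unfolding is_local_max_def eventually_nhds_metric dist_real_def by blast

lemma is_local_min_ballE:
  assumes "is_local_min f t"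
  obtains d where "d > 0" "\<And>r. \<bar>r - t\<bar> < d \<Longrightarrow> f t \<le> f r"
  using assms unfolding is_local_min_def eventually_nhds_metric dist_real_def by blast

context periodic_wave
begin

text \<open>Each arch ends in a peak that starts the next one, and by reflection each peak also ends an arch.\<close>

lemma periodic_profile:
  assumes prof: "wave_profile g u S" and s: "s \<in> S" and x: "x \<in> {0..2 * \<tau>}"
  shows "u (s + 2 * \<tau> * of_int n + x) = p x"
proof -
  have left: "r - 2 * \<tau> \<in> S" if "r \<in> S" for r
  proof -
    have "- r + 2 * \<tau> \<in> uminus ` S"
      by (rule periodic_profile_step(1)[OF wave_profile_reflect[OF prof]]) (use that in simp)
    then obtain s' where "s' \<in> S" "- r + 2 * \<tau> = - s'" by blast
    then show ?thesis by (metis add.commute minus_diff_eq neg_equal_iff_equal uminus_add_conv_diff)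
  qed
  have "s + 2 * \<tau> * of_int n \<in> S"
  proof (induction n rule: int_induct[where k = 0])
    case base
    then show ?case using s by simp
  next
    case (step1 i)
    then show ?case using periodic_profile_step(1)[OF prof, of "s + 2 * \<tau> * of_int i"] by (simp add: algebra_simps)
  next
    case (step2 i)
    then show ?case using left[of "s + 2 * \<tau> * of_int i"] by (simp add: algebra_simps)
  qed
  then show ?thesis using x by (rule periodic_profile_step(2)[OF prof])
qed

text \<open>The integrand is \<open>sqrt 2 / sqrt (g x)\<close>, whose primitive \<open>sqrt 2 * G\<close> grows from \<open>0\<close> to \<open>sqrt 2 * \<tau>\<close>.\<close>

lemma period_integral: "2 / sqrt 2 * (LBINT x:{0<..<m}. sqrt (x / (F 0 - F x))) = 2 * \<tau>"
proof -
  have "(LBINT x=ereal 0..ereal m. 1 / sqrt (g x)) = \<tau> - 0"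
  proof (rule interval_integral_FTC_nonneg(2)[where F = G])
    fix x assume "ereal 0 < ereal x" "ereal x < ereal m"
    then have x: "x \<in> {0<..<m}" by simp
    show "DERIV G x :> 1 / sqrt (g x)" using dG[OF x] .
    have "0 < g x" using g_pos[of x] x by simp
    then show "isCont (\<lambda>x. 1 / sqrt (g x)) x" by (intro continuous_intros g_cont) simp
  next
    show "AE x in lborel. ereal 0 < ereal x \<longrightarrow> ereal x < ereal m \<longrightarrow> 0 \<le> 1 / sqrt (g x)"
      using g_pos by (intro AE_I2) (simp add: less_imp_le)
    have "(G \<longlongrightarrow> 0) (at_right 0)"
      using G0 by (simp add: isCont_def filterlim_at_split)
    then show "((G \<circ> real_of_ereal) \<longlongrightarrow> 0) (at_right (ereal 0))" by (simp add: ereal_tendsto_simps)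
    show "((G \<circ> real_of_ereal) \<longlongrightarrow> \<tau>) (at_left (ereal m))" using G\<tau> by (simp add: ereal_tendsto_simps)
  qed (use m_pos in simp)
  then have \<tau>_eq: "(LBINT x:{0<..<m}. 1 / sqrt (g x)) = \<tau>"
    using interval_integral_Ioo[of "ereal 0" "ereal m" "\<lambda>x. 1 / sqrt (g x)"] m_pos by simp
  have "(LBINT x:{0<..<m}. sqrt (x / (F 0 - F x))) = (LBINT x:{0<..<m}. sqrt 2 * (1 / sqrt (g x)))"
  proof (rule set_lebesgue_integral_cong)
    have "sqrt (x / (F 0 - F x)) = sqrt 2 * (1 / sqrt (g x))" if "x \<in> {0<..<m}" for x
    proof -
      have e: "F 0 - F x = x * g x / 2" using g_eq[of x] by linarith
      have "x / (F 0 - F x) = 2 / g x" unfolding e using that by simp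
      then show ?thesis by (simp add: real_sqrt_divide)
    qed
    then show "\<forall>x. x \<in> {0<..<m} \<longrightarrow> sqrt (x / (F 0 - F x)) = sqrt 2 * (1 / sqrt (g x))" by blast
  qed simp
  also have "\<dots> = sqrt 2 * \<tau>" by (simp only: set_integral_mult_right \<tau>_eq)
  finally show ?thesis by simp
qed

context
  fixes u :: "real \<Rightarrow> real" and s :: real
  assumes u: "\<And>x n. x \<in> {0..2 * \<tau>} \<Longrightarrow> u (s + 2 * \<tau> * of_int n + x) = p x"
begin

lemma periodic_decomposition:
  obtains n :: int and x where "x \<in> {0..<2 * \<tau>}" "t = s + 2 * \<tau> * of_int n + x"
  by (rule period_decomposition[of "2 * \<tau>" t s]) (use \<tau> in auto)

lemma periodic_range: "u t \<in> {0..m}"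
proof -
  obtain n :: int and x where "x \<in> {0..<2 * \<tau>}" "t = s + 2 * \<tau> * of_int n + x" by (rule periodic_decomposition)
  then show ?thesis using u[of x n] p_range[of x] by simp
qed

lemma periodic_zero_iff: "u t = 0 \<longleftrightarrow> (\<exists>n::int. t = s + 2 * \<tau> * of_int n)"
proof
  assume z: "u t = 0"
  obtain n :: int and x where x: "x \<in> {0..<2 * \<tau>}" "t = s + 2 * \<tau> * of_int n + x" by (rule periodic_decomposition)
  then have "p x = 0" using u[of x n] z by simp
  then have "x = 0" using p_pos[of x] x(1) by force
  then show "\<exists>n::int. t = s + 2 * \<tau> * of_int n" using x(2) by auto
next
  assume "\<exists>n::int. t = s + 2 * \<tau> * of_int n"
  then obtain n :: int where "t = s + 2 * \<tau> * of_int n" by blast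
  then show "u t = 0" using u[of 0 n] p0 \<tau> by simp
qed

lemma periodic_analytic:
  assumes "u t \<noteq> 0"
  shows "real_analytic_on u {t}"
proof -
  obtain n :: int and x where x: "x \<in> {0..<2 * \<tau>}" "t = s + 2 * \<tau> * of_int n + x" by (rule periodic_decomposition)
  define c where "c = s + 2 * \<tau> * of_int n"
  have "x \<noteq> 0" using assms x(2) periodic_zero_iff[of t] by auto
  then have t: "t - c \<in> {0<..<2 * \<tau>}" using x by (simp add: c_def)
  have "real_analytic_on (\<lambda>r. p (r - c)) {t}"
  proof (rule real_analytic_on_compose[where f = p])
    show "real_analytic_on p ((\<lambda>r. r - c) ` {t})"
      by (rule real_analytic_on_subset[OF p_an]) (use t in auto)
  qed (intro real_analytic_on_diff real_analytic_on_ident real_analytic_on_const)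
  moreover have "eventually (\<lambda>r. r \<in> {c<..<c + 2 * \<tau>}) (nhds t)"
    by (intro eventually_nhds_in_open) (use t in auto)
  then have "eventually (\<lambda>r. p (r - c) = u r) (nhds t)"
  proof eventually_elim
    case (elim r)
    then show ?case using u[of "r - c" n] by (simp add: c_def)
  qed
  ultimately show ?thesis by (rule real_analytic_on_cong_ev)
qed

lemma periodic_shift: "u (t + 2 * \<tau> * of_int n) = u t"
proof -
  obtain k :: int and x where x: "x \<in> {0..<2 * \<tau>}" "t = s + 2 * \<tau> * of_int k + x" by (rule periodic_decomposition)
  have "t + 2 * \<tau> * of_int n = s + 2 * \<tau> * of_int (k + n) + x" using x(2) by (simp add: algebra_simps)
  then have "u (t + 2 * \<tau> * of_int n) = p x" by (simp only:, intro u) (use x(1) in auto)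
  also have "\<dots> = u t" unfolding x(2) by (rule u[symmetric]) (use x(1) in auto)
  finally show ?thesis .
qed

lemma periodic_minimal_period: "minimal_period u (2 * \<tau>)"
  unfolding minimal_period_def
proof (intro conjI allI impI)
  show "has_period u (2 * \<tau>)"
    using periodic_shift[of _ 1] \<tau> by (simp add: has_period_def)
  fix T assume T: "has_period u T"
  have "u (s + T) = 0"
    using T periodic_zero_iff[of s] by (simp add: has_period_def exI[of _ 0])
  then obtain n :: int where n: "T = 2 * \<tau> * of_int n" using periodic_zero_iff[of "s + T"] by auto
  have "0 < T" using T by (simp add: has_period_def)
  then have "0 < n" using n \<tau> by (simp add: zero_less_mult_iff)
  then have "1 \<le> real_of_int n" by linarith
  then show "2 * \<tau> \<le> T" using n \<tau> by simp
qed

lemma periodic_local_max_iff: "is_local_max u t \<longleftrightarrow> (\<exists>n::int. t = (s + \<tau>) + 2 * \<tau> * of_int n)"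
proof
  assume "is_local_max u t"
  then obtain d where d: "d > 0" "\<And>r. \<bar>r - t\<bar> < d \<Longrightarrow> u r \<le> u t" by (rule is_local_max_ballE) blast
  obtain n :: int and x where x: "x \<in> {0..<2 * \<tau>}" "t = s + 2 * \<tau> * of_int n + x" by (rule periodic_decomposition)
  have ut: "u t = p x" using u[of x n] x by simp
  have "x = \<tau>"
  proof (cases x \<tau> rule: linorder_cases)
    case less
    \<comment> \<open>on the rising side there are higher points immediately to the right\<close>
    define h where "h = min d (\<tau> - x) / 2"
    have h: "0 < h" "h < d" "x + h < \<tau>" using d(1) less by (auto simp: h_def min_def field_simps)
    have "p (x + h) = u (t + h)" using u[of "x + h" n] x h by (simp add: add.assoc)
    also have "\<dots> \<le> p x" using d(2)[of "t + h"] h ut by simp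
    finally show ?thesis using p_rise[of x "x + h"] x h by simp
  next
    case greater
    define h where "h = min d (x - \<tau>) / 2"
    have h: "0 < h" "h < d" "\<tau> < x - h" using d(1) greater by (auto simp: h_def min_def field_simps)
    have "p (x - h) = u (t - h)" using u[of "x - h" n] x h \<tau> by (simp add: add_diff_eq)
    also have "\<dots> \<le> p x" using d(2)[of "t - h"] h ut by simp
    finally show ?thesis using p_fall[of "x - h" x] x h by simp
  qed
  then show "\<exists>n::int. t = (s + \<tau>) + 2 * \<tau> * of_int n" using x(2) by (intro exI[of _ n]) simp
next
  assume "\<exists>n::int. t = (s + \<tau>) + 2 * \<tau> * of_int n"
  then obtain n :: int where "t = (s + \<tau>) + 2 * \<tau> * of_int n" by blast
  then have "t = s + 2 * \<tau> * of_int n + \<tau>" by simp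
  then have "u t = m" using u[of \<tau> n] \<tau> p\<tau> by simp
  then show "is_local_max u t" using periodic_range by (simp add: is_local_max_def)
qed

lemma periodic_local_min_iff: "is_local_min u t \<longleftrightarrow> (\<exists>n::int. t = s + 2 * \<tau> * of_int n)"
proof
  assume "is_local_min u t"
  then obtain d where d: "d > 0" "\<And>r. \<bar>r - t\<bar> < d \<Longrightarrow> u t \<le> u r" by (rule is_local_min_ballE) blast
  obtain n :: int and x where x: "x \<in> {0..<2 * \<tau>}" "t = s + 2 * \<tau> * of_int n + x" by (rule periodic_decomposition)
  have ut: "u t = p x" using u[of x n] x by simp
  have "x = 0"
  proof (rule ccontr)
    assume "x \<noteq> 0"
    show False
    proof (cases "x \<le> \<tau>")
      case True
      define h where "h = min d x / 2"
      have h: "0 < h" "h < d" "h < x" using d(1) \<open>x \<noteq> 0\<close> x(1) by (auto simp: h_def min_def field_simps)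
      have "p x \<le> u (t - h)" using d(2)[of "t - h"] h ut by simp
      also have "\<dots> = p (x - h)" using u[of "x - h" n] x h by (simp add: add_diff_eq)
      finally show False using p_rise[of "x - h" x] True h by simp
    next
      case False
      define h where "h = min d (2 * \<tau> - x) / 2"
      have h: "0 < h" "h < d" "x + h < 2 * \<tau>" using d(1) x(1) by (auto simp: h_def min_def field_simps)
      have "p x \<le> u (t + h)" using d(2)[of "t + h"] h ut by simp
      also have "\<dots> = p (x + h)" using u[of "x + h" n] x h by (simp add: add.assoc)
      finally show False using p_fall[of x "x + h"] False h by simp
    qed
  qed
  then show "\<exists>n::int. t = s + 2 * \<tau> * of_int n" using x(2) by auto
next
  assume "\<exists>n::int. t = s + 2 * \<tau> * of_int n"
  then have "u t = 0" by (simp add: periodic_zero_iff)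
  then show "is_local_min u t" using periodic_range by (simp add: is_local_min_def)
qed

lemma periodic_unique_extrema:
  "\<exists>!t. t \<in> {a..<a + 2 * \<tau>} \<and> is_local_max u t" "\<exists>!t. t \<in> {a..<a + 2 * \<tau>} \<and> is_local_min u t"
proof -
  have *: "\<exists>!t. t \<in> {a..<a + 2 * \<tau>} \<and> (\<exists>n::int. t = c + 2 * \<tau> * of_int n)" for c
    using unique_multiple_in_period[of "2 * \<tau>" c a] \<tau> by (auto simp: Ex1_def)
  show "\<exists>!t. t \<in> {a..<a + 2 * \<tau>} \<and> is_local_max u t" "\<exists>!t. t \<in> {a..<a + 2 * \<tau>} \<and> is_local_min u t"
    unfolding periodic_local_max_iff periodic_local_min_iff by (rule *)+
qed

lemma periodic_even: "u (s - r) = u (s + r)"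
proof -
  obtain n :: int and x where x: "x \<in> {0..<2 * \<tau>}" "s + r = s + 2 * \<tau> * of_int n + x" by (rule periodic_decomposition)
  have "s - r = s + 2 * \<tau> * of_int (- n - 1) + (2 * \<tau> - x)" using x(2) by (simp add: algebra_simps)
  then have "u (s - r) = p (2 * \<tau> - x)" by (simp only:, intro u) (use x(1) in auto)
  also have "\<dots> = p x" by (rule sym) (use x(1) in auto)
  also have "\<dots> = u (s + r)" unfolding x(2) by (rule u[symmetric]) (use x(1) in auto)
  finally show ?thesis .
qed

text \<open>The extrema are \<open>s\<close> plus the multiples of \<open>\<tau>\<close>, that is, of half the period; evenness about \<open>s\<close> and
periodicity give evenness about each of them.\<close>

lemma periodic_symmetric:
  assumes "is_local_max u t \<or> is_local_min u t"
  shows "symmetric_about u t"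
proof -
  obtain n :: int where "t = s + \<tau> * of_int n"
  proof -
    consider n :: int where "t = (s + \<tau>) + 2 * \<tau> * of_int n" | n :: int where "t = s + 2 * \<tau> * of_int n"
      using assms periodic_local_max_iff periodic_local_min_iff by blast
    then show thesis
    proof cases
      case 1
      then have "t = s + \<tau> * of_int (2 * n + 1)" by (simp add: algebra_simps)
      then show thesis by (rule that)
    next
      case 2
      then have "t = s + \<tau> * of_int (2 * n)" by simp
      then show thesis by (rule that)
    qed
  qed
  then have "u (t + r) = u (t - r)" for r
    using periodic_even[of "\<tau> * of_int n + r"] periodic_shift[of "s - (\<tau> * of_int n + r)" n]
    by (simp add: algebra_simps)
  then show ?thesis by (simp add: symmetric_about_def)
qed

end

end

text \<open>A periodic wave has more than one peak, and a solitary one takes the value \<open>0\<close> only once.\<close>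

lemma peaked_wave_types:
  assumes F: "real_analytic_on F UNIV" and u: "peaked_tws F u" and ret: "first_return F m"
    and peaks: "peak_set u S"
  shows "deriv F m = 0 \<Longrightarrow> peaked_solitary F u \<and> \<not> peaked_periodic F u"
    "deriv F m \<noteq> 0 \<Longrightarrow> peaked_periodic F u \<and> \<not> peaked_solitary F u"
proof -
  note prof = peaked_tws_imp_wave_profile[OF F u peaks]
  interpret potential F m by (intro potential.intro F prof(1) ret)
  obtain s where s: "s \<in> S" using peaks by (auto simp: peak_set_def)
  show "peaked_solitary F u \<and> \<not> peaked_periodic F u" if flat: "deriv F m = 0"
  proof -
    obtain p G where "solitary_wave F m p G" using ex_solitary_wave[OF flat] .
    then interpret solitary_wave F m p G .
    note shape = solitary_profile(2)[OF prof(2) s]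
    have "peak_set u {s}" using peaks solitary_profile(1)[OF prof(2) s] by simp
    then show ?thesis
      using u solitary_limits[of u s, OF shape] solitary_not_periodic[of u s, OF shape]
      unfolding peaked_solitary_def peaked_periodic_def by blast
  qed
  show "peaked_periodic F u \<and> \<not> peaked_solitary F u" if steep: "deriv F m \<noteq> 0"
  proof -
    obtain p G \<tau> where "periodic_wave F m p G \<tau>" using ex_periodic_wave[OF steep] .
    then interpret periodic_wave F m p G \<tau> .
    note shape = periodic_profile[OF prof(2) s]
    note zero = periodic_zero_iff[of u s, OF shape]
    have "\<not> peak_set u {q}" for q
    proof
      assume "peak_set u {q}"
      from peaked_tws_imp_wave_profile(2)[OF F u this] have "{q} = {t. u t = 0}"
        by (rule wave_profile_zero_set)
      moreover have "u s = 0" "u (s + 2 * \<tau>) = 0"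
        using zero[of s] zero[of "s + 2 * \<tau>"] by (auto intro: exI[of _ 0] exI[of _ 1])
      ultimately have "s = q" "s + 2 * \<tau> = q" by blast+
      then show False using \<tau> by simp
    qed
    then show ?thesis
      using u periodic_minimal_period[of u s, OF shape]
      unfolding peaked_solitary_def peaked_periodic_def minimal_period_def by blast
  qed
qed

theorem proposition6:
  fixes F :: "real \<Rightarrow> real"
  assumes "real_analytic_on F UNIV"
  shows
    "((\<exists>u. peaked_tws F u) \<longleftrightarrow> deriv F 0 < 0 \<and> (\<exists>m. first_return F m)) \<and>
     (\<forall>u m. peaked_tws F u \<and> first_return F m \<longrightarrow>
        (let T = 2 / sqrt 2 * (LBINT x:{0<..<m}. sqrt (x / (F 0 - F x))) in
          (peaked_periodic F u \<longleftrightarrow> deriv F m \<noteq> 0) \<and>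
          (peaked_solitary F u \<longleftrightarrow> deriv F m = 0) \<and>
          (\<forall>S. peak_set u S \<longrightarrow>
             weak_singular_tws_off F u S \<and>
             real_analytic_on u (- S) \<and>
             (\<forall>s\<in>S. \<not> isCont (deriv u) s)) \<and>
          (peaked_solitary F u \<longrightarrow>
             (\<exists>p. (\<forall>t. elevation m u t \<le> elevation m u p) \<and>
                  (\<forall>t. is_local_max (elevation m u) t \<longleftrightarrow> t = p) \<and>
                  symmetric_about (elevation m u) p) \<and>
             decays_to_zero (elevation m u) \<and>
             (deriv (deriv F) m \<noteq> 0 \<longrightarrow> decays_exponentially (elevation m u))) \<and>
          (peaked_periodic F u \<longrightarrow>
             minimal_period u T \<and>
             (\<forall>a. (\<exists>!t. t \<in> {a..<a + T} \<and> is_local_max u t) \<and>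
                  (\<exists>!t. t \<in> {a..<a + T} \<and> is_local_min u t)) \<and>
             (\<forall>t. is_local_max u t \<or> is_local_min u t \<longrightarrow> symmetric_about u t))))"
proof (intro conjI allI impI)
  note F = assms
  have tws: "tws F u" if "peaked_tws F u" for u
    using that by (auto simp: peaked_tws_def singular_tws_def strong_singular_tws_def
        weak_singular_tws_def weak_singular_tws_off_def)
  show "(\<exists>u. peaked_tws F u) \<longleftrightarrow> deriv F 0 < 0 \<and> (\<exists>m. first_return F m)"
  proof
    assume "\<exists>u. peaked_tws F u"
    then obtain u S where u: "peaked_tws F u" "peak_set u S" unfolding peaked_tws_def by blast
    note prof = peaked_tws_imp_wave_profile[OF F u]
    obtain s where s: "s \<in> S" using u(2) by (auto simp: peak_set_def)
    have "bounded (range u)" using tws[OF u(1)] by (simp add: tws_def)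
    then show "deriv F 0 < 0 \<and> (\<exists>m. first_return F m)"
      using prof(1) first_return_exists[OF F prof s] by blast
  next
    assume "deriv F 0 < 0 \<and> (\<exists>m. first_return F m)"
    then obtain m where m: "deriv F 0 < 0" "first_return F m" by blast
    interpret potential F m by (intro potential.intro F m)
    show "\<exists>u. peaked_tws F u"
    proof (cases "deriv F m = 0")
      case True
      then obtain p G where "solitary_wave F m p G" using ex_solitary_wave by blast
      then show ?thesis using solitary_wave.solitary_wave_exists by blast
    next
      case False
      then obtain p G \<tau> where "periodic_wave F m p G \<tau>" using ex_periodic_wave by blast
      then show ?thesis using periodic_wave.periodic_wave_exists by blast
    qed
  qed
  fix u m assume um: "peaked_tws F u \<and> first_return F m"
  then have u: "peaked_tws F u" and ret: "first_return F m" by auto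
  obtain S0 where S0: "peak_set u S0" using u unfolding peaked_tws_def by blast
  note prof0 = peaked_tws_imp_wave_profile[OF F u S0]
  interpret potential F m by (intro potential.intro F prof0(1) ret)
  obtain s where s: "s \<in> S0" using S0 by (auto simp: peak_set_def)
  define T where "T = 2 / sqrt 2 * (LBINT x:{0<..<m}. sqrt (x / (F 0 - F x)))"
  note types = peaked_wave_types[OF F u ret S0]
  have per: "peaked_periodic F u \<longleftrightarrow> deriv F m \<noteq> 0" and sol: "peaked_solitary F u \<longleftrightarrow> deriv F m = 0"
    using types by blast+
  have an: "real_analytic_on u (- S0)"
  proof (cases "deriv F m = 0")
    case True
    then obtain p G where "solitary_wave F m p G" using ex_solitary_wave by blast
    then interpret solitary_wave F m p G .
    have "arch_train p {0..} u {s}"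
      using solitary_profile(2)[OF prof0(2) s] by (simp add: arch_train_def)
    then have *: "real_analytic_on u {t}" if "t \<noteq> s" for t
      using arch_train_analytic[OF _ _ _ p_an, of u "{s}" s t] that by simp
    show ?thesis
      unfolding solitary_profile(1)[OF prof0(2) s] by (rule real_analytic_onI) (use * in simp)
  next
    case False
    then obtain p G \<tau> where "periodic_wave F m p G \<tau>" using ex_periodic_wave by blast
    then interpret periodic_wave F m p G \<tau> .
    note shape = periodic_profile[OF prof0(2) s]
    show ?thesis
    proof (rule real_analytic_onI)
      fix t assume t: "t \<in> - S0"
      have "S0 = {t. u t = 0}" using prof0(2) by (rule wave_profile_zero_set)
      then have "u t \<noteq> 0" using t by blast
      then show "real_analytic_on u {t}" by (rule periodic_analytic[of u s, OF shape, rotated])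
    qed
  qed
  show "let T = 2 / sqrt 2 * (LBINT x:{0<..<m}. sqrt (x / (F 0 - F x))) in
          (peaked_periodic F u \<longleftrightarrow> deriv F m \<noteq> 0) \<and>
          (peaked_solitary F u \<longleftrightarrow> deriv F m = 0) \<and>
          (\<forall>S. peak_set u S \<longrightarrow>
             weak_singular_tws_off F u S \<and>
             real_analytic_on u (- S) \<and>
             (\<forall>s\<in>S. \<not> isCont (deriv u) s)) \<and>
          (peaked_solitary F u \<longrightarrow>
             (\<exists>p. (\<forall>t. elevation m u t \<le> elevation m u p) \<and>
                  (\<forall>t. is_local_max (elevation m u) t \<longleftrightarrow> t = p) \<and>
                  symmetric_about (elevation m u) p) \<and>
             decays_to_zero (elevation m u) \<and>
             (deriv (deriv F) m \<noteq> 0 \<longrightarrow> decays_exponentially (elevation m u))) \<and>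
          (peaked_periodic F u \<longrightarrow>
             minimal_period u T \<and>
             (\<forall>a. (\<exists>!t. t \<in> {a..<a + T} \<and> is_local_max u t) \<and>
                  (\<exists>!t. t \<in> {a..<a + T} \<and> is_local_min u t)) \<and>
             (\<forall>t. is_local_max u t \<or> is_local_min u t \<longrightarrow> symmetric_about u t))"
    unfolding Let_def T_def[symmetric]
  proof (intro conjI per sol impI)
    show "\<forall>S. peak_set u S \<longrightarrow> weak_singular_tws_off F u S \<and> real_analytic_on u (- S) \<and>
             (\<forall>s\<in>S. \<not> isCont (deriv u) s)"
    proof (intro allI impI)
      fix S assume S: "peak_set u S"
      have prof: "wave_profile g u S" by (rule peaked_tws_imp_wave_profile(2)[OF F u S])
      have "S = S0" using wave_profile_zero_set[OF prof] wave_profile_zero_set[OF prof0(2)] by simp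
      then show "weak_singular_tws_off F u S \<and> real_analytic_on u (- S) \<and> (\<forall>s\<in>S. \<not> isCont (deriv u) s)"
        using wave_profile_imp_weak_singular[OF prof _ tws[OF u], of s] s an peak_not_isCont_deriv[OF S] by blast
    qed
  next
    assume "peaked_solitary F u"
    then have flat: "deriv F m = 0" using sol by simp
    obtain p G where "solitary_wave F m p G" using ex_solitary_wave[OF flat] .
    then interpret solitary_wave F m p G .
    note shape = solitary_profile(2)[OF prof0(2) s]
    show "\<exists>p. (\<forall>t. elevation m u t \<le> elevation m u p) \<and>
        (\<forall>t. is_local_max (elevation m u) t \<longleftrightarrow> t = p) \<and> symmetric_about (elevation m u) p"
      using solitary_elevation_le[of u s, OF shape] solitary_is_local_max[of u s, OF shape]
        solitary_symmetric[of u s, OF shape] by blast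
    show "decays_to_zero (elevation m u)" by (rule solitary_decay[of u s, OF shape])
    show "decays_exponentially (elevation m u)" if "deriv (deriv F) m \<noteq> 0"
      by (rule solitary_exponential_decay[of u s, OF shape that])
  next
    assume "peaked_periodic F u"
    then have steep: "deriv F m \<noteq> 0" using per by simp
    obtain p G \<tau> where "periodic_wave F m p G \<tau>" using ex_periodic_wave[OF steep] .
    then interpret periodic_wave F m p G \<tau> .
    note shape = periodic_profile[OF prof0(2) s]
    have T: "T = 2 * \<tau>" unfolding T_def by (rule period_integral)
    show "minimal_period u T" unfolding T by (rule periodic_minimal_period[of u s, OF shape])
    show "\<forall>a. (\<exists>!t. t \<in> {a..<a + T} \<and> is_local_max u t) \<and> (\<exists>!t. t \<in> {a..<a + T} \<and> is_local_min u t)"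
      unfolding T using periodic_unique_extrema[of u s, OF shape] by blast
    show "\<forall>t. is_local_max u t \<or> is_local_min u t \<longrightarrow> symmetric_about u t"
      using periodic_symmetric[of u s, OF shape] by blast
  qed
qed

end
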